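(* Let $k$ be a field, $M\supseteq k$ an infinite field, $H$ a subgroup of $F_{20}$, and $f^H_{v_1,v_2}(X)\in k(v_1,v_2)[X]$ a quintic $k$-generic polynomial for $H$. For $\mathbf{a}\in M^2$ write $L_{\mathbf{a}}=\mathrm{Spl}_M f^H_{\mathbf{a}}(X)$ and $G_{\mathbf{a}}=\mathrm{Gal}(f^H_{\mathbf{a}}/M)$. Let $\mathbf{a},\mathbf{a}'\in M^2$ be such that $f^H_{\mathbf{a}}(X)$ and $f^H_{\mathbf{a}'}(X)$ are irreducible over $M$ and $G_{\mathbf{a}}\ge G_{\mathbf{a}'}$, and put $G_{\mathbf{a},\mathbf{a}'}=\mathrm{Gal}(f^H_{\mathbf{a}}f^H_{\mathbf{a}'}/M)$. Let $\Theta$ be an $S_5\times S_5'$-primitive $F_{20}''$-invariant, and let $\mathcal{R}^1_{\mathbf{a},\mathbf{a}'}$, $\mathcal{R}^2_{\mathbf{a},\mathbf{a}'}$ be as in the context. Then $(G_{\mathbf{a}},G_{\mathbf{a}'},G_{\mathbf{a},\mathbf{a}'})$, the field $L_{\mathbf{a}}\cap L_{\mathbf{a}'}$, and the decomposition types over $M$ are related according to exactly one of the following rows (listed as: $G_{\mathbf{a}}$; $G_{\mathbf{a}'}$; GAP ID and structure of $G_{\mathbf{a},\mathbf{a}'}$; intersection; $\mathrm{DT}(\mathcal{R}^1_{\mathbf{a},\mathbf{a}'})$; $\mathrm{DT}(\mathcal{R}^2_{\mathbf{a},\mathbf{a}'})$): (I-1) $F_{20}$; $F_{20}$; $[400,205]$,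 $F_{20}\times F_{20}$; $L_{\mathbf{a}}\cap L_{\mathbf{a}'}=M$; $20$; $100$. (I-2) $F_{20}$; $F_{20}$; $[200,42]$, $(D_5\times D_5)\rtimes C_2$; $[L_{\mathbf{a}}\cap L_{\mathbf{a}'}:M]=2$; $10^2$; $50^2$. (I-3) $F_{20}$; $F_{20}$; $[100,11]$, $(C_5\times C_5)\rtimes C_4$; $[L_{\mathbf{a}}\cap L_{\mathbf{a}'}:M]=4$; $5^4$; $50^2$. (I-4) $F_{20}$; $F_{20}$; $[100,12]$, $(C_5\times C_5)\rtimes C_4$; $[L_{\mathbf{a}}\cap L_{\mathbf{a}'}:M]=4$; $10^2$; $25^4$. (I-5) $F_{20}$; $F_{20}$; $[20,3]$, $F_{20}$; $L_{\mathbf{a}}=L_{\mathbf{a}'}$; $5^3,4,1$; $20^4,10^2$. (I-6) $F_{20}$; $D_5$; $[200,41]$, $F_{20}\times D_5$; $L_{\mathbf{a}}\cap L_{\mathbf{a}'}=M$; $20$; $100$. (I-7) $F_{20}$; $D_5$; $[100,10]$, $(C_5\times C_5)\rtimes C_4$; $[L_{\mathbf{a}}\cap L_{\mathbf{a}'}:M]=2$; $20$; $100$. (I-8) $F_{20}$; $C_5$; $[100,9]$, $F_{20}\times C_5$; $L_{\mathbf{a}}\cap L_{\mathbf{a}'}=M$; $20$; $100$. (II-1) $D_5$; $D_5$; $[100,13]$, $D_5\times D_5$; $L_{\mathbf{a}}\cap L_{\mathbf{a}'}=M$; $10^2$; $50^2$. (II-2) $D_5$; $D_5$; $[50,4]$,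 $(C_5\times C_5)\rtimes C_2$; $[L_{\mathbf{a}}\cap L_{\mathbf{a}'}:M]=2$; $5^4$; $25^4$. (II-3) $D_5$; $D_5$; $[10,1]$, $D_5$; $L_{\mathbf{a}}=L_{\mathbf{a}'}$; $5^3,2^2,1$; $10^8,5^4$. (II-4) $D_5$; $C_5$; $[50,3]$, $D_5\times C_5$; $L_{\mathbf{a}}\cap L_{\mathbf{a}'}=M$; $10^2$; $50^2$. (III-1) $C_5$; $C_5$; $[25,2]$, $C_5\times C_5$; $L_{\mathbf{a}}\neq L_{\mathbf{a}'}$; $5^4$; $25^4$. (III-2) $C_5$; $C_5$; $[5,1]$, $C_5$; $L_{\mathbf{a}}=L_{\mathbf{a}'}$; $5^3,1^5$; $5^{20}$. Moreover, if $\mathcal{R}^1_{\mathbf{a},\mathbf{a}'}(X)$ has no repeated factors, then $L_{\mathbf{a}}=L_{\mathbf{a}'}$ if and only if $\mathcal{R}^1_{\mathbf{a},\mathbf{a}'}(X)$ has a linear factor over $M$.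
   Context: A polynomial $f_{\mathbf{v}}(X)\in k(v_1,v_2)[X]$ is $k$-generic for a finite group $G$ if its Galois group over $k(v_1,v_2)$ is isomorphic to $G$ and every $G$-Galois extension $L/M'$ with $M'\supseteq k$ infinite is the splitting field of some specialization $f_{\mathbf{c}}(X)$, $\mathbf{c}\in(M')^2$. In $S_5$ let $\sigma=(12345)$, $\rho=(1243)$, $\tau=\rho^2$; $C_5=\langle\sigma\rangle$, $D_5=\langle\sigma,\tau\rangle$, $F_{20}=\langle\sigma,\rho\rangle$ (Frobenius group of order 20). Galois groups of quintics are regarded as permutation groups of the roots; the roots $\alpha_1,\ldots,\alpha_5$ of $f^H_{\mathbf{a}}$ and $\beta_1,\ldots,\beta_5$ of $f^H_{\mathbf{a}'}$ are ordered so that these groups lie in $F_{20}$, and "$G_{\mathbf{a}}=D_5$" etc. means isomorphic (equivalently conjugate) to that subgroup. Let $x_1,\ldots,x_5,y_1,\ldots,y_5$ be indeterminates; $S_5\times S_5'$ (two copies of $S_5$) acts on $k[x_i,y_i,1/\Delta_{\mathbf{x}},1/\Delta_{\mathbf{y}}]$ ($\Delta$ the Vandermonde products) by $(g,h):x_i\mapsto x_{g(i)},\,y_i\mapsto y_{h(i)}$; $F_{20}''=\{(g,g):g\in F_{20}\}$. $\Theta$ is an $S_5\times S_5'$-primitive $F_{20}''$-invariant if its stabilizer in $S_5\times S_5'$ is exactly $F_{20}''$. With $\omega$ the evaluation $x_i\mapsto\alpha_i$, $y_i\mapsto\beta_i$, define $\mathcal{R}_{\mathbf{a},\mathbf{a}'}(X)=\prod_{\pi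 F_{20}''\in(S_5\times S_5')/F_{20}''}(X-\omega(\pi\Theta))$ (degree 120), $\mathcal{R}^1_{\mathbf{a},\mathbf{a}'}(X)=\prod_{\pi F_{20}''\in(F_{20}\times F_{20})/F_{20}''}(X-\omega(\pi\Theta))$ (degree 20), and $\mathcal{R}^2_{\mathbf{a},\mathbf{a}'}=\mathcal{R}_{\mathbf{a},\mathbf{a}'}/\mathcal{R}^1_{\mathbf{a},\mathbf{a}'}$. The decomposition type $\mathrm{DT}$ of such a resolvent over $M$ is the partition of its degree given by the lengths of the orbits of $G_{\mathbf{a},\mathbf{a}'}\le F_{20}\times F_{20}$ acting by left multiplication on the corresponding set of left cosets of $F_{20}''$; when the resolvent has no repeated factors this is the multiset of degrees of its irreducible factors over $M$. Exponents denote multiplicities (e.g. $5^3,4,1$). GAP IDs refer to the SmallGroups library.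
   Formalization: (S5×S5')/F20'' has 720 cosets, not 120: R is taken over (S5×F20)/F20'', or over (S5×S5')/S5'' for an S5''-invariant. In I-2 the extension of C2 by D5×D5 does not split; it is stated as an extension. Roots are assumed distinct, f_a, f_a' defined. *)

theory Defs
  imports
    "HOL-Algebra.Algebra"
    "HOL-Algebra.Algebraic_Closure_Type"
    "HOL-Computational_Algebra.Computational_Algebra"
    "HOL-Combinatorics.Cycles"
    "HOL-Library.Poly_Mapping"
begin

definition sigma5 :: "nat \<Rightarrow> nat" where
  "sigma5 = cycle_of_list [1, 2, 3, 4, 5]"

definition rho5 :: "nat \<Rightarrow> nat" where
  "rho5 = cycle_of_list [1, 2, 4, 3]"

definition tau5 :: "nat \<Rightarrow> nat" where
  "tau5 = rho5 \<circ> rho5"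

abbreviation S5 :: "(nat \<Rightarrow> nat) monoid" where
  "S5 \<equiv> sym_group 5"

definition C5 :: "(nat \<Rightarrow> nat) monoid" where
  "C5 = S5\<lparr>carrier := generate S5 {sigma5}\<rparr>"

definition D5 :: "(nat \<Rightarrow> nat) monoid" where
  "D5 = S5\<lparr>carrier := generate S5 {sigma5, tau5}\<rparr>"

definition F20 :: "(nat \<Rightarrow> nat) monoid" where
  "F20 = S5\<lparr>carrier := generate S5 {sigma5, rho5}\<rparr>"

definition diagonal :: "(nat \<Rightarrow> nat) monoid \<Rightarrow> ((nat \<Rightarrow> nat) \<times> (nat \<Rightarrow> nat)) set" where
  "diagonal G = {(g, g) | g. g \<in> carrier G}"

definition semidirect ::
  "'a monoid \<Rightarrow> 'b monoid \<Rightarrow> ('b \<Rightarrow> 'a \<Rightarrow> 'a) \<Rightarrow> ('a \<times> 'b) monoid" where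
  "semidirect N Q act =
    \<lparr>carrier = carrier N \<times> carrier Q,
     monoid.mult = (\<lambda>(n, q) (n', q'). (n \<otimes>\<^bsub>N\<^esub> act q n', q \<otimes>\<^bsub>Q\<^esub> q')),
     monoid.one = (\<one>\<^bsub>N\<^esub>, \<one>\<^bsub>Q\<^esub>)\<rparr>"

abbreviation Z :: "nat \<Rightarrow> int monoid" where
  "Z \<equiv> integer_mod_group"

text \<open>
  The four groups \<open>(C\<^sub>5 \<times> C\<^sub>5) \<rtimes> C\<^sub>4\<close> in which a generator of \<open>C\<^sub>4\<close> acts on the first factor by
  squaring and on the second one by the \<open>u\<close>-th power are pairwise non-isomorphic: \<open>u = 1\<close> gives
  \<open>F\<^sub>2\<^sub>0 \<times> C\<^sub>5\<close>, that is [100,9], and \<open>u = 4, 2, 3\<close> give [100,10], [100,11], [100,12].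
\<close>

definition C5xC5_C4 :: "int \<Rightarrow> ((int \<times> int) \<times> int) monoid" where
  "C5xC5_C4 u = semidirect (Z 5 \<times>\<times> Z 5) (Z 4)
     (\<lambda>i (x, y). (2 ^ nat i * x mod 5, u ^ nat i * y mod 5))"

definition SmallGroup_100_10 :: "((int \<times> int) \<times> int) monoid" where
  "SmallGroup_100_10 = C5xC5_C4 4"

definition SmallGroup_100_11 :: "((int \<times> int) \<times> int) monoid" where
  "SmallGroup_100_11 = C5xC5_C4 2"

definition SmallGroup_100_12 :: "((int \<times> int) \<times> int) monoid" where
  "SmallGroup_100_12 = C5xC5_C4 3"

definition SmallGroup_50_4 :: "((int \<times> int) \<times> int) monoid" where
  "SmallGroup_50_4 = semidirect (Z 5 \<times>\<times> Z 5) (Z 2)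
     (\<lambda>i (x, y). ((- 1) ^ nat i * x mod 5, (- 1) ^ nat i * y mod 5))"

definition SmallGroup_200_42 :: "((int \<times> int) \<times> (int \<times> int)) monoid" where
  "SmallGroup_200_42 = semidirect (Z 5 \<times>\<times> Z 5) (Z 4 \<times>\<times> Z 2)
     (\<lambda>(i, j) (x, y). (2 ^ nat i * (- 1) ^ nat j * x mod 5, 2 ^ nat i * y mod 5))"

definition splitting_field :: "'a::field set \<Rightarrow> 'a poly \<Rightarrow> 'a set" where
  "splitting_field K p = generate_field ring_of_type_algebra (K \<union> {x. poly p x = 0})"

definition aut_group :: "'a::field set \<Rightarrow> 'a set \<Rightarrow> ('a \<Rightarrow> 'a) monoid" where
  "aut_group K L = (BijGroup L)\<lparr>carrier := {s \<in> Bij L.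
     s \<in> ring_hom (ring_of_type_algebra\<lparr>carrier := L\<rparr>) (ring_of_type_algebra\<lparr>carrier := L\<rparr>) \<and>
     (\<forall>x\<in>K. s x = x)}\<rparr>"

definition galois_extension :: "'a::field set \<Rightarrow> 'a set \<Rightarrow> bool" where
  "galois_extension K L \<longleftrightarrow>
     subfield K ring_of_type_algebra \<and> subfield L ring_of_type_algebra \<and> K \<subseteq> L \<and>
     finite (carrier (aut_group K L)) \<and>
     {x \<in> L. \<forall>s\<in>carrier (aut_group K L). s x = x} = K"

definition G_galois_extension ::
  "('g, 'h) monoid_scheme \<Rightarrow> 'a::field set \<Rightarrow> 'a set \<Rightarrow> bool" where
  "G_galois_extension G K L \<longleftrightarrow> galois_extension K L \<and> aut_group K L \<cong> G"

abbreviation base_field :: "'a::field alg_closure set" where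
  "base_field \<equiv> range to_ac"

definition Spl :: "'a::field poly \<Rightarrow> 'a alg_closure set" where
  "Spl p = splitting_field base_field (map_poly to_ac p)"

definition Gal :: "'a::field poly \<Rightarrow> ('a alg_closure \<Rightarrow> 'a alg_closure) monoid" where
  "Gal p = aut_group base_field (Spl p)"

definition fract_defined :: "('r::idom \<Rightarrow> 's::field) \<Rightarrow> 'r fract \<Rightarrow> bool" where
  "fract_defined \<phi> q \<longleftrightarrow> (\<exists>n d. q = Fract n d \<and> \<phi> d \<noteq> 0)"

definition fract_eval :: "('r::idom \<Rightarrow> 's::field) \<Rightarrow> 'r fract \<Rightarrow> 's" where
  "fract_eval \<phi> q = (THE y. \<exists>n d. q = Fract n d \<and> \<phi> d \<noteq> 0 \<and> y = \<phi> n / \<phi> d)"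

text \<open>In \<^typ>\<open>'k poly poly\<close> the inner indeterminate is \<open>v\<^sub>1\<close> and the outer one is \<open>v\<^sub>2\<close>.\<close>

definition eval2 :: "('k::field \<Rightarrow> 's::field) \<Rightarrow> 's \<times> 's \<Rightarrow> 'k poly poly \<Rightarrow> 's" where
  "eval2 \<iota> c p = poly (map_poly (\<lambda>q. poly (map_poly \<iota> q) (fst c)) p) (snd c)"

definition specializable ::
  "('k::field \<Rightarrow> 's::field) \<Rightarrow> 's \<times> 's \<Rightarrow> 'k poly poly fract poly \<Rightarrow> bool" where
  "specializable \<iota> c f \<longleftrightarrow> (\<forall>i. fract_defined (eval2 \<iota> c) (poly.coeff f i))"

definition specialize ::
  "('k::field \<Rightarrow> 's::field) \<Rightarrow> 's \<times> 's \<Rightarrow> 'k poly poly fract poly \<Rightarrow> 's poly" where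
  "specialize \<iota> c f = map_poly (fract_eval (eval2 \<iota> c)) f"

type_synonym 'k mpoly = "(nat \<Rightarrow>\<^sub>0 nat) \<Rightarrow>\<^sub>0 'k"

definition mconst :: "'k::comm_ring_1 \<Rightarrow> 'k mpoly" where
  "mconst c = Poly_Mapping.single 0 c"

definition mvar :: "nat \<Rightarrow> 'k::comm_ring_1 mpoly" where
  "mvar i = Poly_Mapping.single (Poly_Mapping.single i 1) 1"

definition mvars :: "'k::comm_ring_1 mpoly \<Rightarrow> nat set" where
  "mvars P = (\<Union>m\<in>Poly_Mapping.keys P. Poly_Mapping.keys m)"

definition meval :: "('k::comm_ring_1 \<Rightarrow> 's::comm_ring_1) \<Rightarrow> (nat \<Rightarrow> 's) \<Rightarrow> 'k mpoly \<Rightarrow> 's" where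
  "meval \<phi> \<nu> P = (\<Sum>m\<in>Poly_Mapping.keys P. \<phi> (Poly_Mapping.lookup P m) *
     (\<Prod>i\<in>Poly_Mapping.keys m. \<nu> i ^ Poly_Mapping.lookup m i))"

text \<open>
  The extensions \<open>L/M'\<close> in the definition of genericity range over the subfields of the algebraic
  closure of \<open>k(t\<^sub>0, t\<^sub>1, t\<^sub>2, \<dots>)\<close>, a universal domain over \<open>k\<close>. This is no restriction: for an
  arbitrary \<open>G\<close>-Galois extension \<open>L/M'\<close> choose a \<open>G\<close>-stable, countably generated extension
  \<open>L\<^sub>0 \<subseteq> L\<close> of \<open>k\<close> with \<open>L = M' L\<^sub>0\<close> whose fixed field \<open>M\<^sub>0 = L\<^sub>0 \<inter> M'\<close> is infinite. Then \<open>L\<^sub>0/M\<^sub>0\<close> is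
  \<open>G\<close>-Galois and embeds into the universal domain over \<open>k\<close>, and if \<open>L\<^sub>0\<close> is the splitting field of
  \<open>f\<^sub>c\<close> over \<open>M\<^sub>0\<close>, then \<open>L\<close> is the splitting field of \<open>f\<^sub>c\<close> over \<open>M'\<close>.
\<close>

type_synonym 'k universal_domain = "'k mpoly fract alg_closure"

definition const_ud :: "'k::field \<Rightarrow> 'k universal_domain" where
  "const_ud c = to_ac (Fract (mconst c) 1)"

definition generic_poly ::
  "('g, 'h) monoid_scheme \<Rightarrow> 'k::field poly poly fract poly \<Rightarrow> bool" where
  "generic_poly G f \<longleftrightarrow>
     f \<noteq> 0 \<and> G_galois_extension G base_field (Spl f) \<and>
     (\<forall>M' L :: 'k universal_domain set.
        range const_ud \<subseteq> M' \<and> infinite M' \<and> G_galois_extension G M' L \<longrightarrow>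
        (\<exists>c \<in> M' \<times> M'. specializable const_ud c f \<and> specialize const_ud c f \<noteq> 0 \<and>
           L = splitting_field M' (specialize const_ud c f)))"

definition enumerates_roots :: "(nat \<Rightarrow> 'm::field alg_closure) \<Rightarrow> 'm poly \<Rightarrow> bool" where
  "enumerates_roots \<alpha> p \<longleftrightarrow> bij_betw \<alpha> {1..5} {x. poly (map_poly to_ac p) x = 0}"

definition perm_gal :: "(nat \<Rightarrow> 'm::field alg_closure) \<Rightarrow> 'm poly \<Rightarrow> (nat \<Rightarrow> nat) monoid" where
  "perm_gal \<alpha> p = S5\<lparr>carrier := {g \<in> carrier S5.
     \<exists>s\<in>carrier (Gal p). \<forall>i\<in>{1..5}. s (\<alpha> i) = \<alpha> (g i)}\<rparr>"

definition perm_gal2 ::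
  "(nat \<Rightarrow> 'm::field alg_closure) \<Rightarrow> 'm poly \<Rightarrow> (nat \<Rightarrow> 'm alg_closure) \<Rightarrow> 'm poly \<Rightarrow>
   ((nat \<Rightarrow> nat) \<times> (nat \<Rightarrow> nat)) monoid" where
  "perm_gal2 \<alpha> p \<beta> q = (S5 \<times>\<times> S5)\<lparr>carrier := {(g, h) \<in> carrier (S5 \<times>\<times> S5).
     \<exists>s\<in>carrier (Gal (p * q)). \<forall>i\<in>{1..5}. s (\<alpha> i) = \<alpha> (g i) \<and> s (\<beta> i) = \<beta> (h i)}\<rparr>"

text \<open>For \<open>1 \<le> i \<le> 5\<close> the indeterminate \<open>x\<^sub>i\<close> is \<open>mvar i\<close>, and \<open>y\<^sub>i\<close> is \<open>mvar (5 + i)\<close>.\<close>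

definition join_xy :: "(nat \<Rightarrow> 's) \<Rightarrow> (nat \<Rightarrow> 's) \<Rightarrow> nat \<Rightarrow> 's" where
  "join_xy x y j = (if j \<le> 5 then x j else y (j - 5))"

definition Delta_x :: "'k::field mpoly" where
  "Delta_x = (\<Prod>j\<in>{1..5}. \<Prod>i\<in>{1..<j}. mvar i - mvar j)"

definition Delta_y :: "'k::field mpoly" where
  "Delta_y = (\<Prod>j\<in>{1..5}. \<Prod>i\<in>{1..<j}. mvar (5 + i) - mvar (5 + j))"

definition localized_ring :: "'k::field mpoly fract set" where
  "localized_ring = {Fract P (Delta_x ^ m * Delta_y ^ n) | P m n. mvars P \<subseteq> {1..10}}"

definition perm_act :: "(nat \<Rightarrow> nat) \<times> (nat \<Rightarrow> nat) \<Rightarrow> 'k::field mpoly fract \<Rightarrow> 'k mpoly fract" where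
  "perm_act \<pi> = fract_eval (meval (\<lambda>c. Fract (mconst c) 1)
     (join_xy (\<lambda>i. Fract (mvar (fst \<pi> i)) 1) (\<lambda>i. Fract (mvar (5 + snd \<pi> i)) 1)))"

definition primitive_invariant ::
  "((nat \<Rightarrow> nat) \<times> (nat \<Rightarrow> nat)) set \<Rightarrow> 'k::field mpoly fract \<Rightarrow> bool" where
  "primitive_invariant U \<Theta> \<longleftrightarrow>
     \<Theta> \<in> localized_ring \<and> {\<pi> \<in> carrier (S5 \<times>\<times> S5). perm_act \<pi> \<Theta> = \<Theta>} = U"

definition cosets_in ::
  "((nat \<Rightarrow> nat) \<times> (nat \<Rightarrow> nat)) monoid \<Rightarrow> ((nat \<Rightarrow> nat) \<times> (nat \<Rightarrow> nat)) set \<Rightarrow>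
   ((nat \<Rightarrow> nat) \<times> (nat \<Rightarrow> nat)) set set" where
  "cosets_in K U = {\<pi> <#\<^bsub>S5 \<times>\<times> S5\<^esub> U | \<pi>. \<pi> \<in> carrier K}"

text \<open>
  The index sets of the resolvents for an invariant with stabilizer \<open>U\<close>.
  For \<open>U = S\<^sub>5''\<close> the set \<open>cosets_in (S5 \<times>\<times> F20) U\<close> consists of all 120 left cosets of \<open>S\<^sub>5''\<close> in
  \<open>S\<^sub>5 \<times> S\<^sub>5'\<close>. For \<open>U = F\<^sub>2\<^sub>0''\<close> it has 120 elements as well, whereas there are 720 left cosets of
  \<open>F\<^sub>2\<^sub>0''\<close> in \<open>S\<^sub>5 \<times> S\<^sub>5'\<close>. In both cases \<open>(g, h)U\<close> corresponds to \<open>g h\<^sup>-\<^sup>1\<close> in \<open>S\<^sub>5\<close>, and the action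
  of \<open>F\<^sub>2\<^sub>0 \<times> F\<^sub>2\<^sub>0\<close> is that on the double cosets of \<open>F\<^sub>2\<^sub>0\<close> in \<open>S\<^sub>5\<close>, with 20 and 100 elements.
\<close>

definition index_R ::
  "((nat \<Rightarrow> nat) \<times> (nat \<Rightarrow> nat)) set \<Rightarrow> ((nat \<Rightarrow> nat) \<times> (nat \<Rightarrow> nat)) set set" where
  "index_R U = cosets_in (S5 \<times>\<times> F20) U"

definition index_R1 ::
  "((nat \<Rightarrow> nat) \<times> (nat \<Rightarrow> nat)) set \<Rightarrow> ((nat \<Rightarrow> nat) \<times> (nat \<Rightarrow> nat)) set set" where
  "index_R1 U = cosets_in (F20 \<times>\<times> F20) U"

definition index_R2 ::
  "((nat \<Rightarrow> nat) \<times> (nat \<Rightarrow> nat)) set \<Rightarrow> ((nat \<Rightarrow> nat) \<times> (nat \<Rightarrow> nat)) set set" where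
  "index_R2 U = index_R U - index_R1 U"

definition omega ::
  "('k::field \<Rightarrow> 'm::field) \<Rightarrow> (nat \<Rightarrow> 'm alg_closure) \<Rightarrow> (nat \<Rightarrow> 'm alg_closure) \<Rightarrow>
   'k mpoly fract \<Rightarrow> 'm alg_closure" where
  "omega \<iota> \<alpha> \<beta> = fract_eval (meval (\<lambda>c. to_ac (\<iota> c)) (join_xy \<alpha> \<beta>))"

text \<open>The choice of representatives is immaterial when \<open>\<Theta>\<close> is invariant under the subgroup.\<close>

definition resolvent ::
  "('k::field \<Rightarrow> 'm::field) \<Rightarrow> (nat \<Rightarrow> 'm alg_closure) \<Rightarrow> (nat \<Rightarrow> 'm alg_closure) \<Rightarrow>
   'k mpoly fract \<Rightarrow> ((nat \<Rightarrow> nat) \<times> (nat \<Rightarrow> nat)) set set \<Rightarrow> 'm alg_closure poly" where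
  "resolvent \<iota> \<alpha> \<beta> \<Theta> I =
     (\<Prod>C\<in>I. [:- omega \<iota> \<alpha> \<beta> (perm_act (SOME \<pi>. \<pi> \<in> C) \<Theta>), 1:])"

definition decomp_type ::
  "((nat \<Rightarrow> nat) \<times> (nat \<Rightarrow> nat)) monoid \<Rightarrow> ((nat \<Rightarrow> nat) \<times> (nat \<Rightarrow> nat)) set set \<Rightarrow> nat multiset"
  where
  "decomp_type G I =
     image_mset card (mset_set (orbits G I (\<lambda>\<gamma> C. \<gamma> <#\<^bsub>S5 \<times>\<times> S5\<^esub> C)))"

abbreviation ext_degree :: "'m::field alg_closure set \<Rightarrow> nat \<Rightarrow> bool" where
  "ext_degree E n \<equiv> ring.dimension ring_of_type_algebra n base_field E"

datatype table_row =
  I_1 | I_2 | I_3 | I_4 | I_5 | I_6 | I_7 | I_8 | II_1 | II_2 | II_3 | II_4 | III_1 | III_2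

text \<open>
  The group in row \<open>I_2\<close> is an extension of \<open>C\<^sub>2\<close> by \<open>D\<^sub>5 \<times> D\<^sub>5\<close> that does not split: all its
  involutions lie in the subgroup \<open>D\<^sub>5 \<times> D\<^sub>5\<close>. The SmallGroups identifiers of the remaining groups are
  [400,205] \<open>F\<^sub>2\<^sub>0 \<times> F\<^sub>2\<^sub>0\<close>, [20,3] \<open>F\<^sub>2\<^sub>0\<close>, [200,41] \<open>F\<^sub>2\<^sub>0 \<times> D\<^sub>5\<close>, [100,9] \<open>F\<^sub>2\<^sub>0 \<times> C\<^sub>5\<close>,
  [100,13] \<open>D\<^sub>5 \<times> D\<^sub>5\<close>, [10,1] \<open>D\<^sub>5\<close>, [50,3] \<open>D\<^sub>5 \<times> C\<^sub>5\<close>, [25,2] \<open>C\<^sub>5 \<times> C\<^sub>5\<close>, [5,1] \<open>C\<^sub>5\<close>.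
\<close>

fun satisfies_row ::
  "table_row \<Rightarrow> (nat \<Rightarrow> nat) monoid \<Rightarrow> (nat \<Rightarrow> nat) monoid \<Rightarrow>
   ((nat \<Rightarrow> nat) \<times> (nat \<Rightarrow> nat)) monoid \<Rightarrow>
   'm::field alg_closure set \<Rightarrow> 'm alg_closure set \<Rightarrow> nat multiset \<Rightarrow> nat multiset \<Rightarrow> bool" where
  "satisfies_row I_1 A B G L L' R1 R2 \<longleftrightarrow>
     A \<cong> F20 \<and> B \<cong> F20 \<and> G \<cong> F20 \<times>\<times> F20 \<and> L \<inter> L' = base_field \<and>
     R1 = {#20#} \<and> R2 = {#100#}"
| "satisfies_row I_2 A B G L L' R1 R2 \<longleftrightarrow>
     A \<cong> F20 \<and> B \<cong> F20 \<and> G \<cong> SmallGroup_200_42 \<and>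
     (\<exists>N. N \<lhd> G \<and> G\<lparr>carrier := N\<rparr> \<cong> D5 \<times>\<times> D5 \<and> G Mod N \<cong> Z 2) \<and>
     ext_degree (L \<inter> L') 2 \<and>
     R1 = replicate_mset 2 10 \<and> R2 = replicate_mset 2 50"
| "satisfies_row I_3 A B G L L' R1 R2 \<longleftrightarrow>
     A \<cong> F20 \<and> B \<cong> F20 \<and> G \<cong> SmallGroup_100_11 \<and> ext_degree (L \<inter> L') 4 \<and>
     R1 = replicate_mset 4 5 \<and> R2 = replicate_mset 2 50"
| "satisfies_row I_4 A B G L L' R1 R2 \<longleftrightarrow>
     A \<cong> F20 \<and> B \<cong> F20 \<and> G \<cong> SmallGroup_100_12 \<and> ext_degree (L \<inter> L') 4 \<and>
     R1 = replicate_mset 2 10 \<and> R2 = replicate_mset 4 25"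
| "satisfies_row I_5 A B G L L' R1 R2 \<longleftrightarrow>
     A \<cong> F20 \<and> B \<cong> F20 \<and> G \<cong> F20 \<and> L = L' \<and>
     R1 = replicate_mset 3 5 + {#4, 1#} \<and> R2 = replicate_mset 4 20 + replicate_mset 2 10"
| "satisfies_row I_6 A B G L L' R1 R2 \<longleftrightarrow>
     A \<cong> F20 \<and> B \<cong> D5 \<and> G \<cong> F20 \<times>\<times> D5 \<and> L \<inter> L' = base_field \<and>
     R1 = {#20#} \<and> R2 = {#100#}"
| "satisfies_row I_7 A B G L L' R1 R2 \<longleftrightarrow>
     A \<cong> F20 \<and> B \<cong> D5 \<and> G \<cong> SmallGroup_100_10 \<and> ext_degree (L \<inter> L') 2 \<and>
     R1 = {#20#} \<and> R2 = {#100#}"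
| "satisfies_row I_8 A B G L L' R1 R2 \<longleftrightarrow>
     A \<cong> F20 \<and> B \<cong> C5 \<and> G \<cong> F20 \<times>\<times> C5 \<and> L \<inter> L' = base_field \<and>
     R1 = {#20#} \<and> R2 = {#100#}"
| "satisfies_row II_1 A B G L L' R1 R2 \<longleftrightarrow>
     A \<cong> D5 \<and> B \<cong> D5 \<and> G \<cong> D5 \<times>\<times> D5 \<and> L \<inter> L' = base_field \<and>
     R1 = replicate_mset 2 10 \<and> R2 = replicate_mset 2 50"
| "satisfies_row II_2 A B G L L' R1 R2 \<longleftrightarrow>
     A \<cong> D5 \<and> B \<cong> D5 \<and> G \<cong> SmallGroup_50_4 \<and> ext_degree (L \<inter> L') 2 \<and>
     R1 = replicate_mset 4 5 \<and> R2 = replicate_mset 4 25"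
| "satisfies_row II_3 A B G L L' R1 R2 \<longleftrightarrow>
     A \<cong> D5 \<and> B \<cong> D5 \<and> G \<cong> D5 \<and> L = L' \<and>
     R1 = replicate_mset 3 5 + replicate_mset 2 2 + {#1#} \<and>
     R2 = replicate_mset 8 10 + replicate_mset 4 5"
| "satisfies_row II_4 A B G L L' R1 R2 \<longleftrightarrow>
     A \<cong> D5 \<and> B \<cong> C5 \<and> G \<cong> D5 \<times>\<times> C5 \<and> L \<inter> L' = base_field \<and>
     R1 = replicate_mset 2 10 \<and> R2 = replicate_mset 2 50"
| "satisfies_row III_1 A B G L L' R1 R2 \<longleftrightarrow>
     A \<cong> C5 \<and> B \<cong> C5 \<and> G \<cong> C5 \<times>\<times> C5 \<and> L \<noteq> L' \<and>
     R1 = replicate_mset 4 5 \<and> R2 = replicate_mset 4 25"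
| "satisfies_row III_2 A B G L L' R1 R2 \<longleftrightarrow>
     A \<cong> C5 \<and> B \<cong> C5 \<and> G \<cong> C5 \<and> L = L' \<and>
     R1 = replicate_mset 3 5 + replicate_mset 5 1 \<and> R2 = replicate_mset 20 5"

end

theory Submission
  imports Defs
begin

text \<open>
  Let \<open>\<Gamma>\<close> be the group of automorphisms of the algebraic closure over \<open>M\<close>. The Galois groups in
  question are the images of \<open>\<Gamma>\<close> in the permutations of the \<open>\<alpha>\<^sub>i\<close> and \<open>\<beta>\<^sub>i\<close>, so \<open>G\<^bsub>a,a'\<^esub>\<close> is a subdirect
  product of \<open>G\<^sub>a\<close> and \<open>G\<^sub>a'\<close>. By transitivity these are among the groups of maps \<open>x \<mapsto> u x + b\<close> over
  \<open>\<int>/5\<close> with \<open>u\<close> in a fixed group of units. If \<open>G\<^bsub>a,a'\<^esub>\<close> contains a nontrivial translation \<open>(1, t)\<close>, then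
  it contains \<open>C\<^sub>5 \<times> C\<^sub>5\<close> and is determined by a group \<open>Q\<close> of pairs of units; otherwise it is the
  diagonal of \<open>G\<^sub>a\<close> conjugated by an element \<open>(1, k)\<close> with \<open>k \<in> F\<^sub>2\<^sub>0\<close>. The 20 cosets of the first resolvent
  correspond to the maps \<open>w x + e\<close>, and with a transposition \<open>t\<close> satisfying \<open>u t u = t\<close> for all scalings
  \<open>u\<close> the other 100 cosets correspond to the products \<open>(w x + b) t (x + c)\<close>, on which
  the orbits can be read off. The degree of \<open>L\<^sub>a \<inter> L\<^sub>a'\<close> is \<open>|G\<^sub>a| |G\<^sub>a'| / |G\<^bsub>a,a'\<^esub>|\<close>. Finally, a simple root of
  the resolvent in \<open>M\<close> is a coset fixed by \<open>G\<^bsub>a,a'\<^esub>\<close>, which makes both projections of \<open>G\<^bsub>a,a'\<^esub>\<close> injective.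
\<close>

section \<open>Intermediate fields of the algebraic closure\<close>

text \<open>The transposition is no accident: modulo 5 it is x \<mapsto> - x^3, that is - 1/x with 0
  fixed, so u t u = t amounts to u^4 = 1. It normalises the four scalings, and the nontrivial double
  coset of F20 has 20 * 20 / 4 = 100 elements, parametrised without repetition by a unit and two
  offsets. Pairs of scalings (u, v) act on the unit through u / v in the first resolvent and through
  u v in the second; gluing the two groups by u = v or by u = 1 / v thus exchanges which resolvent
  has four classes and which has two, the contrast between rows I-3 and I-4. On the field side the
  obstacle is inseparability: the closure may contain elements outside M that every automorphism
  fixes. Each descent to a smaller field is therefore confined to fields generated by roots of the
  two quintics, which are separable because each has five distinct roots. The infinitude of M enters
  through the choice of generators, where a scalar must avoid finitely many values.\<close>

lemma type_algebra_simps [simp]: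
  "carrier (ring_of_type_algebra :: 'a::field ring) = UNIV"
  "x \<otimes>\<^bsub>ring_of_type_algebra\<^esub> y = (x * y :: 'a)"
  "\<one>\<^bsub>ring_of_type_algebra\<^esub> = (1 :: 'a)"
  "\<zero>\<^bsub>ring_of_type_algebra\<^esub> = (0 :: 'a)"
  "x \<oplus>\<^bsub>ring_of_type_algebra\<^esub> y = (x + y :: 'a)"
  by (simp_all add: ring_of_type_algebra_def)

lemma type_algebra_a_inv [simp]: "\<ominus>\<^bsub>ring_of_type_algebra\<^esub> x = - (x :: 'a::field)"
proof -
  interpret field "ring_of_type_algebra :: 'a ring" by (rule field_from_type_algebra)
  show ?thesis by (rule minus_equality) auto
qed

lemma type_algebra_m_inv [simp]:
  assumes "x \<noteq> 0" shows "inv\<^bsub>ring_of_type_algebra\<^esub> x = inverse (x :: 'a::field)"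
proof -
  interpret field "ring_of_type_algebra :: 'a ring" by (rule field_from_type_algebra)
  show ?thesis by (rule comm_inv_char) (use assms in auto)
qed

definition coeffs_in :: "'a::zero set \<Rightarrow> 'a poly \<Rightarrow> bool" where
  "coeffs_in E g \<longleftrightarrow> (\<forall>i. Polynomial.coeff g i \<in> E)"

text \<open>Closure under sums and products already gives a subfield here: negatives come from
  \<open>- 1\<close> in the base field, inverses from algebraicity over it.\<close>

definition intermediate :: "'a::field alg_closure set \<Rightarrow> bool" where
  "intermediate E \<longleftrightarrow> base_field \<subseteq> E \<and> (\<forall>x\<in>E. \<forall>y\<in>E. x + y \<in> E \<and> x * y \<in> E)"

lemma intermediateD:
  assumes "intermediate E"
  shows "to_ac k \<in> E" "0 \<in> E" "1 \<in> E" "- 1 \<in> E"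
    "x \<in> E \<Longrightarrow> y \<in> E \<Longrightarrow> x + y \<in> E" "x \<in> E \<Longrightarrow> y \<in> E \<Longrightarrow> x * y \<in> E"
    "x \<in> E \<Longrightarrow> - x \<in> E" "x \<in> E \<Longrightarrow> y \<in> E \<Longrightarrow> x - y \<in> E" "x \<in> E \<Longrightarrow> x ^ n \<in> E"
proof -
  have k: "to_ac k \<in> E" for k using assms by (auto simp: intermediate_def)
  show "to_ac k \<in> E" by (rule k)
  show "0 \<in> E" using k[of 0] by simp
  show one: "1 \<in> E" using k[of 1] by simp
  show m1: "- 1 \<in> E" using k[of "- 1"] by simp
  show add: "x + y \<in> E" if "x \<in> E" "y \<in> E" for x y
    using assms that by (auto simp: intermediate_def)
  show mul: "x * y \<in> E" if "x \<in> E" "y \<in> E" for x y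
    using assms that by (auto simp: intermediate_def)
  show neg: "- x \<in> E" if "x \<in> E" for x using mul[OF m1 that] by simp
  show "x - y \<in> E" if "x \<in> E" "y \<in> E" using add[OF that(1) neg[OF that(2)]] by simp
  show "x ^ n \<in> E" if "x \<in> E" using that one mul by (induction n) auto
qed

lemma intermediate_sum:
  assumes "intermediate E" "\<And>i. i \<in> I \<Longrightarrow> f i \<in> E"
  shows "sum f I \<in> E"
  using assms(2) by (induction I rule: infinite_finite_induct) (auto intro: intermediateD[OF assms(1)])

lemma intermediate_prod:
  assumes "intermediate E" "\<And>i. i \<in> I \<Longrightarrow> f i \<in> E"
  shows "prod f I \<in> E"
  using assms(2) by (induction I rule: infinite_finite_induct) (auto intro: intermediateD[OF assms(1)])

lemma coeffs_in_pCons: "coeffs_in E (pCons c g) \<longleftrightarrow> c \<in> E \<and> coeffs_in E g"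
  by (auto simp: coeffs_in_def coeff_pCons split: nat.split)

lemma intermediate_poly:
  assumes "intermediate E" "coeffs_in E g" "x \<in> E"
  shows "poly g x \<in> E"
  using assms(2) by (induction g)
    (auto simp: coeffs_in_pCons assms(3) intro!: intermediateD[OF assms(1)])

lemma coeffs_in_arith:
  assumes "intermediate E"
  shows "coeffs_in E 0" "coeffs_in E 1" "c \<in> E \<Longrightarrow> coeffs_in E [:c:]"
    "c \<in> E \<Longrightarrow> coeffs_in E (Polynomial.monom c n)"
    "coeffs_in E g \<Longrightarrow> coeffs_in E h \<Longrightarrow> coeffs_in E (g + h)"
    "coeffs_in E g \<Longrightarrow> coeffs_in E h \<Longrightarrow> coeffs_in E (g - h)"
    "coeffs_in E g \<Longrightarrow> coeffs_in E h \<Longrightarrow> coeffs_in E (g * h)"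
    "c \<in> E \<Longrightarrow> coeffs_in E g \<Longrightarrow> coeffs_in E (Polynomial.smult c g)"
  by (auto simp: coeffs_in_def coeff_mult coeff_pCons split: nat.split
      intro!: intermediateD[OF assms] intermediate_sum[OF assms])

lemma intermediate_base: "intermediate base_field"
  by (auto simp: intermediate_def simp flip: to_ac_add to_ac_mult)

lemma coeffs_in_map_poly_to_ac:
  "intermediate E \<Longrightarrow> coeffs_in E (map_poly to_ac p)"
  by (auto simp: coeffs_in_def coeff_map_poly intro: intermediateD)

lemma map_poly_to_ac_mult: "map_poly to_ac (f * g) = map_poly to_ac f * map_poly to_ac g"
  by (rule poly_eqI) (simp add: coeff_map_poly coeff_mult to_ac_sum)

lemma coeffs_in_baseE:
  assumes "coeffs_in base_field g" obtains p where "g = map_poly to_ac p"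
proof
  show "g = map_poly to_ac (map_poly of_ac g)"
    using assms by (intro poly_eqI) (auto simp: coeff_map_poly coeffs_in_def to_ac_of_ac)
qed

text \<open>All elements are algebraic over the base field, so subrings containing it are fields.\<close>

lemma intermediate_inverse:
  assumes E: "intermediate E" and x: "x \<in> E"
  shows "inverse x \<in> E"
proof (cases "x = 0")
  case False
  have "inverse x \<in> E" if "p \<noteq> 0" "poly (map_poly to_ac p) x = 0" for p
    using that
  proof (induction p)
    \<comment> \<open>Zero constant coefficients are stripped, as \<open>x\<close> is nonzero. At
      the first nonzero one the relation \<open>c + x * q(x) = 0\<close> exhibits the inverse of
      \<open>x\<close> as \<open>- q(x) / c\<close>.\<close>
    case (pCons c q)
    show ?case
    proof (cases "c = 0")
      case True
      then show ?thesis using pCons False by (auto simp: map_poly_pCons)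
    next
      case c: False
      let ?q = "poly (map_poly to_ac q) x"
      have "to_ac c + x * ?q = 0" using pCons by (simp add: map_poly_pCons)
      then have "x * (- ?q * to_ac (inverse c)) = 1"
        using c by (simp add: field_simps eq_neg_iff_add_eq_0 neg_eq_iff_add_eq_0)
      then have "inverse x = - ?q * to_ac (inverse c)" by (rule inverse_unique)
      moreover have "?q \<in> E" by (intro intermediate_poly E coeffs_in_map_poly_to_ac x)
      ultimately show ?thesis
        by (metis E intermediateD(1,6,7))
    qed
  qed simp
  then show ?thesis using alg_closure_algebraic[of x] by blast
qed (use intermediateD[OF E] in simp)

lemma intermediate_iff_subfield:
  "intermediate E \<longleftrightarrow> base_field \<subseteq> E \<and> subfield E ring_of_type_algebra"
proof -
  interpret field "ring_of_type_algebra :: 'a alg_closure ring" by (rule field_from_type_algebra)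
  show ?thesis
  proof
    assume E: "intermediate E"
    have "subring E ring_of_type_algebra"
      by (rule subringI) (auto intro: intermediateD[OF E])
    then have "subfield E ring_of_type_algebra"
      by (rule subfieldI') (auto intro: intermediate_inverse[OF E])
    then show "base_field \<subseteq> E \<and> subfield E ring_of_type_algebra"
      using E by (auto simp: intermediate_def)
  next
    assume *: "base_field \<subseteq> E \<and> subfield E ring_of_type_algebra"
    then have "subring E ring_of_type_algebra" using subfieldE(1) by blast
    from subringE(6,7)[OF this] * show "intermediate E"
      by (auto simp: intermediate_def)
  qed
qed

text \<open>The base field is built in, so that a splitting field is the hull of its roots
  alone.\<close>

definition field_hull :: "'a::field alg_closure set \<Rightarrow> 'a alg_closure set" where
  "field_hull S = generate_field ring_of_type_algebra (base_field \<union> S)"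

lemma field_hull:
  shows field_hull_intermediate: "intermediate (field_hull S)"
    and field_hull_superset: "S \<subseteq> field_hull S"
    and field_hull_least: "intermediate E \<Longrightarrow> S \<subseteq> E \<Longrightarrow> field_hull S \<subseteq> E"
proof -
  interpret field "ring_of_type_algebra :: 'a alg_closure ring" by (rule field_from_type_algebra)
  note * = generate_fieldE[OF _ field_hull_def, of S, simplified]
  show "intermediate (field_hull S)" "S \<subseteq> field_hull S"
    using * by (auto simp: intermediate_iff_subfield)
  show "field_hull S \<subseteq> E" if "intermediate E" "S \<subseteq> E"
    using that *(3)[of E] by (auto simp: intermediate_iff_subfield)
qed

lemma field_hull_mono: "S \<subseteq> T \<Longrightarrow> field_hull S \<subseteq> field_hull T"
  by (meson field_hull_intermediate field_hull_least field_hull_superset order_trans)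

lemma field_hull_idem: "intermediate E \<Longrightarrow> field_hull E = E"
  by (simp add: field_hull_least field_hull_superset subset_antisym)

lemma Spl_eq_field_hull: "Spl p = field_hull {x. poly (map_poly to_ac p) x = 0}"
  by (simp add: Spl_def splitting_field_def field_hull_def)

section \<open>Simple extensions and minimal polynomials over an intermediate field\<close>

definition simple_ext :: "'a::field alg_closure set \<Rightarrow> 'a alg_closure \<Rightarrow> 'a alg_closure set" where
  "simple_ext E x = {poly g x | g. coeffs_in E g}"

lemma simple_ext:
  assumes E: "intermediate E"
  shows "intermediate (simple_ext E x)" "E \<subseteq> simple_ext E x" "x \<in> simple_ext E x"
    "intermediate F \<Longrightarrow> E \<subseteq> F \<Longrightarrow> x \<in> F \<Longrightarrow> simple_ext E x \<subseteq> F"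
proof -
  note arith = coeffs_in_arith[OF E]
  have 1: "E \<subseteq> simple_ext E x"
  proof
    fix c assume "c \<in> E"
    then have "coeffs_in E [:c:]" "c = poly [:c:] x" by (auto intro: arith)
    then show "c \<in> simple_ext E x" unfolding simple_ext_def by blast
  qed
  then show "E \<subseteq> simple_ext E x" .
  have "a + b \<in> simple_ext E x \<and> a * b \<in> simple_ext E x"
    if "a \<in> simple_ext E x" "b \<in> simple_ext E x" for a b
    using that arith(5,7) unfolding simple_ext_def
    by (smt (verit) mem_Collect_eq poly_add poly_mult)
  then show "intermediate (simple_ext E x)"
    using E 1 by (auto simp: intermediate_def)
  have "coeffs_in E [:0, 1:]" "x = poly [:0, 1:] x"
    by (auto simp: coeffs_in_pCons arith intermediateD[OF E])
  then show "x \<in> simple_ext E x" unfolding simple_ext_def by blast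
  show "simple_ext E x \<subseteq> F" if "intermediate F" "E \<subseteq> F" "x \<in> F"
  proof
    fix y assume "y \<in> simple_ext E x"
    then obtain g where "y = poly g x" "coeffs_in E g" by (auto simp: simple_ext_def)
    moreover from this have "coeffs_in F g" using that by (auto simp: coeffs_in_def)
    ultimately show "y \<in> F" using intermediate_poly that by blast
  qed
qed

text \<open>Serves inductions over finitely many generators: one generator is absorbed into the
  ground field, and the induction hypothesis is applied over \<open>simple_ext E x\<close>.\<close>

lemma field_hull_insert:
  assumes E: "intermediate E"
  shows "field_hull (E \<union> insert x S) = field_hull (simple_ext E x \<union> S)"
proof
  show "field_hull (E \<union> insert x S) \<subseteq> field_hull (simple_ext E x \<union> S)"
    using simple_ext(2,3)[OF E, of x] by (intro field_hull_mono) auto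
  have sup: "E \<union> insert x S \<subseteq> field_hull (E \<union> insert x S)" by (rule field_hull_superset)
  then have "simple_ext E x \<subseteq> field_hull (E \<union> insert x S)"
    by (intro simple_ext(4)[OF E field_hull_intermediate]) auto
  with sup have "simple_ext E x \<union> S \<subseteq> field_hull (E \<union> insert x S)" by auto
  then show "field_hull (simple_ext E x \<union> S) \<subseteq> field_hull (E \<union> insert x S)"
    by (intro field_hull_least field_hull_intermediate)
qed

text \<open>The field \<open>E\<close> is a set rather than a type, so the polynomial lives over the
  closure with its coefficients constrained. Least degree is taken as the defining property;
  divisibility follows from it by division with remainder.\<close>

definition min_poly_over :: "'a::field alg_closure set \<Rightarrow> 'a alg_closure \<Rightarrow> 'a alg_closure poly \<Rightarrow> bool"
  where "min_poly_over E x m \<longleftrightarrow> coeffs_in E m \<and> Polynomial.lead_coeff m = 1 \<and> poly m x = 0 \<and>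
    (\<forall>g. coeffs_in E g \<and> g \<noteq> 0 \<and> poly g x = 0 \<longrightarrow> Polynomial.degree m \<le> Polynomial.degree g)"

lemma min_poly_overD:
  assumes "min_poly_over E x m"
  shows "coeffs_in E m" "Polynomial.lead_coeff m = 1" "poly m x = 0" "m \<noteq> 0"
    "coeffs_in E g \<Longrightarrow> poly g x = 0 \<Longrightarrow> Polynomial.degree g < Polynomial.degree m \<Longrightarrow> g = 0"
  using assms unfolding min_poly_over_def by (auto simp: not_le[symmetric])

lemma min_poly_over_degree_pos:
  assumes "min_poly_over E x m" shows "Polynomial.degree m > 0"
proof (rule ccontr)
  assume "\<not> Polynomial.degree m > 0"
  then obtain c where "m = [:c:]" by (meson degree_eq_zeroE neq0_conv)
  then show False using min_poly_overD[OF assms] by auto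
qed

lemma min_poly_over_exists:
  assumes E: "intermediate E"
  shows "\<exists>m. min_poly_over E x m"
proof -
  define P where "P g \<longleftrightarrow> coeffs_in E g \<and> g \<noteq> 0 \<and> poly g x = 0" for g
  obtain p where "p \<noteq> 0" "poly (map_poly to_ac p) x = 0" using alg_closure_algebraic by blast
  then have "P (map_poly to_ac p)"
    unfolding P_def by (auto simp: coeffs_in_map_poly_to_ac[OF E] map_poly_eq_0_iff)
  then obtain g where g: "P g" "\<And>h. P h \<Longrightarrow> Polynomial.degree g \<le> Polynomial.degree h"
    using ex_has_least_nat[of P _ Polynomial.degree] by blast
  let ?m = "Polynomial.smult (inverse (Polynomial.lead_coeff g)) g"
  have c: "inverse (Polynomial.lead_coeff g) \<in> E"
    using g(1) E by (auto simp: P_def coeffs_in_def intro: intermediate_inverse)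
  have "min_poly_over E x ?m"
    unfolding min_poly_over_def using g coeffs_in_arith(8)[OF E c, of g]
    by (auto simp: P_def)
  then show ?thesis by blast
qed

text \<open>Long division that keeps track of the coefficients: subtracting a monomial multiple of
  \<open>m\<close> cancels the leading term of \<open>g\<close>, and as \<open>m\<close> is monic
  nothing leaves \<open>E\<close>.\<close>

lemma coeffs_in_divmod_monic:
  assumes E: "intermediate E" and m: "coeffs_in E m" "Polynomial.lead_coeff m = 1"
    "Polynomial.degree m > 0" and g: "coeffs_in E g"
  shows "\<exists>q r. g = m * q + r \<and> coeffs_in E q \<and> coeffs_in E r \<and> Polynomial.degree r < Polynomial.degree m"
  using g
proof (induction "Polynomial.degree g" arbitrary: g rule: less_induct)
  case less
  show ?case
  proof (cases "Polynomial.degree g < Polynomial.degree m")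
    case True
    then show ?thesis using less.prems coeffs_in_arith(1)[OF E] by (intro exI[of _ 0] exI[of _ g]) auto
  next
    case False
    define c where "c = Polynomial.monom (Polynomial.lead_coeff g) (Polynomial.degree g - Polynomial.degree m)"
    let ?g = "g - m * c"
    have g0: "g \<noteq> 0" using False m by auto
    have c: "coeffs_in E c" using less.prems unfolding c_def
      by (intro coeffs_in_arith[OF E]) (auto simp: coeffs_in_def)
    have g': "coeffs_in E ?g" by (intro coeffs_in_arith[OF E] less.prems c m)
    have dc: "Polynomial.degree (m * c) = Polynomial.degree g"
      using g0 m False by (subst degree_mult_eq) (auto simp: c_def degree_monom_eq monom_eq_0_iff)
    moreover have "Polynomial.lead_coeff (m * c) = Polynomial.lead_coeff g"
      using g0 by (simp add: lead_coeff_mult m c_def degree_monom_eq)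
    ultimately have "?g = 0 \<or> Polynomial.degree ?g < Polynomial.degree g"
      by (metis degree_diff_le dual_order.order_iff_strict eq_zero_or_degree_less coeff_diff diff_self order_refl le_zero_eq)
    then have "Polynomial.degree ?g < Polynomial.degree g" using False m by auto
    from less.hyps[OF this g'] obtain q r where
      "?g = m * q + r" "coeffs_in E q" "coeffs_in E r" "Polynomial.degree r < Polynomial.degree m" by blast
    then show ?thesis using c
      by (intro exI[of _ "q + c"] exI[of _ r]) (auto simp: algebra_simps intro!: coeffs_in_arith[OF E])
  qed
qed

lemma min_poly_over_divides:
  assumes E: "intermediate E" and m: "min_poly_over E x m" and g: "coeffs_in E g" "poly g x = 0"
  shows "\<exists>q. coeffs_in E q \<and> g = m * q"
proof -
  note mD = min_poly_overD[OF m]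
  obtain q r where qr: "g = m * q + r" "coeffs_in E q" "coeffs_in E r" "Polynomial.degree r < Polynomial.degree m"
    using coeffs_in_divmod_monic[OF E mD(1,2) min_poly_over_degree_pos[OF m] g(1)] by blast
  then have "poly r x = 0" using g mD by simp
  then have "r = 0" using mD(5) qr by blast
  then show ?thesis using qr by auto
qed

lemma simple_ext_eq_lower_degree:
  assumes E: "intermediate E" and m: "min_poly_over E x m"
  shows "simple_ext E x = {poly g x | g. coeffs_in E g \<and> Polynomial.degree g < Polynomial.degree m}"
proof -
  have "\<exists>r. poly g x = poly r x \<and> coeffs_in E r \<and> Polynomial.degree r < Polynomial.degree m" if "coeffs_in E g" for g
    using coeffs_in_divmod_monic[OF E min_poly_overD(1,2)[OF m] min_poly_over_degree_pos[OF m] that]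
      min_poly_overD(3)[OF m] by auto
  then show ?thesis unfolding simple_ext_def by blast
qed

text \<open>The space is built up as a flag: values at \<open>x\<close> of polynomials of degree
  below \<open>j\<close>, enlarged by the line through \<open>x ^ j\<close>. Minimality of the
  degree of \<open>m\<close> is exactly what keeps \<open>x ^ j\<close> outside the preceding
  space.\<close>

lemma dimension_simple_ext:
  assumes E: "intermediate E" and m: "min_poly_over E x m"
  shows "ring.dimension ring_of_type_algebra (Polynomial.degree m) E (simple_ext E x)"
proof -
  interpret field "ring_of_type_algebra :: 'a alg_closure ring" by (rule field_from_type_algebra)
  \<comment> \<open>The disjunct \<open>g = 0\<close> makes \<open>?V 0\<close> the zero space; the
    zero polynomial has degree 0 and would be missed by the degree bound.\<close>
  let ?V = "\<lambda>j. {poly g x | g. coeffs_in E g \<and> (g = 0 \<or> Polynomial.degree g < j)}"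
  note arith = coeffs_in_arith[OF E]
  have dim: "dimension j E (?V j)" if "j \<le> Polynomial.degree m" for j
    using that
  proof (induction j)
    case 0
    have "?V 0 = {\<zero>\<^bsub>ring_of_type_algebra\<^esub>}" using arith(1) by auto
    then show ?case by (metis zero_dim)
  next
    case (Suc j)
    have notin: "x ^ j \<notin> ?V j"
    proof
      assume "x ^ j \<in> ?V j"
      then obtain g where g: "x ^ j = poly g x" "coeffs_in E g" "g = 0 \<or> Polynomial.degree g < j" by auto
      let ?h = "Polynomial.monom 1 j - g"
      have "poly ?h x = 0" using g by (simp add: poly_monom)
      moreover have "coeffs_in E ?h" by (intro arith g intermediateD[OF E])
      moreover have "Polynomial.degree ?h < Polynomial.degree m"
        using g(3) Suc.prems
        by (metis Suc_le_lessD degree_diff_le degree_monom_le less_imp_le_nat order_le_less_trans degree_0 zero_le)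
      ultimately have "?h = 0" using min_poly_overD(5)[OF m] by blast
      then have "Polynomial.coeff ?h j = 0" by simp
      then show False using g(3) by (auto simp: coeff_eq_0)
    qed
    have "dimension (Suc j) E (line_extension E (x ^ j) (?V j))"
      by (rule Suc_dim[OF _ notin]) (use Suc in auto)
    also have "line_extension E (x ^ j) (?V j) = ?V (Suc j)" (is "?L = _")
    proof (intro equalityI subsetI)
      fix u assume "u \<in> ?L"
      then obtain k g where kg: "k \<in> E" "coeffs_in E g" "g = 0 \<or> Polynomial.degree g < j" "u = k * x ^ j + poly g x"
        by (auto simp: line_extension_mem_iff)
      then have "u = poly (Polynomial.monom k j + g) x" by (simp add: poly_monom)
      moreover have "Polynomial.degree (Polynomial.monom k j + g) \<le> j"
        using kg(3) by (intro degree_add_le degree_monom_le) auto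
      moreover have "coeffs_in E (Polynomial.monom k j + g)" by (intro arith kg)
      ultimately show "u \<in> ?V (Suc j)" by (auto simp: less_Suc_eq_le simp del: poly_add)
    next
      fix u assume "u \<in> ?V (Suc j)"
      then obtain g where g: "u = poly g x" "coeffs_in E g" and "g = 0 \<or> Polynomial.degree g < Suc j"
        by blast
      then have dg: "Polynomial.degree g \<le> j" by auto
      let ?k = "Polynomial.coeff g j" let ?h = "g - Polynomial.monom ?k j"
      have k: "?k \<in> E" using g by (auto simp: coeffs_in_def)
      have "?h = 0 \<or> Polynomial.degree ?h < j"
      proof -
        have "Polynomial.degree ?h \<le> j" using dg by (intro degree_diff_le degree_monom_le) auto
        moreover have "Polynomial.coeff ?h j = 0" by simp
        ultimately show ?thesis by (metis eq_zero_or_degree_less)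
      qed
      moreover have "coeffs_in E ?h" by (intro arith g k)
      ultimately have V: "poly ?h x \<in> ?V j" by blast
      show "u \<in> ?L" unfolding line_extension_mem_iff
        by (intro bexI[OF _ k] bexI[OF _ V]) (use g in \<open>simp add: poly_monom\<close>)
    qed
    finally show ?case .
  qed
  have "(g = 0 \<or> Polynomial.degree g < Polynomial.degree m) \<longleftrightarrow> Polynomial.degree g < Polynomial.degree m" for g
    using min_poly_over_degree_pos[OF m] by auto
  then have "simple_ext E x = ?V (Polynomial.degree m)"
    unfolding simple_ext_eq_lower_degree[OF E m] by blast
  then show ?thesis using dim[OF order_refl] by (simp only:)
qed

section \<open>Extension of embeddings and fixed elements\<close>

text \<open>An embedding of a subfield, encoded by its graph so that unions of chains are immediate.
  Single-valuedness is reduced to the value at 0, since differences of related pairs are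
  related.\<close>

definition partial_emb :: "('a::field alg_closure \<times> 'a alg_closure) set \<Rightarrow> bool" where
  "partial_emb R \<longleftrightarrow> (\<forall>k\<in>base_field. (k, k) \<in> R) \<and>
     (\<forall>x y x' y'. (x, y) \<in> R \<longrightarrow> (x', y') \<in> R \<longrightarrow> (x + x', y + y') \<in> R \<and> (x * x', y * y') \<in> R) \<and>
     (\<forall>y. (0, y) \<in> R \<longrightarrow> y = 0)"

lemma partial_embD:
  assumes "partial_emb R"
  shows "(to_ac k, to_ac k) \<in> R" "(0, 0) \<in> R" "(1, 1) \<in> R"
    "(x, y) \<in> R \<Longrightarrow> (x', y') \<in> R \<Longrightarrow> (x + x', y + y') \<in> R"
    "(x, y) \<in> R \<Longrightarrow> (x', y') \<in> R \<Longrightarrow> (x * x', y * y') \<in> R"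
    "(x, y) \<in> R \<Longrightarrow> (x', y') \<in> R \<Longrightarrow> (x - x', y - y') \<in> R"
    "(x, y) \<in> R \<Longrightarrow> (x, z) \<in> R \<Longrightarrow> y = z"
    "(0, y) \<in> R \<Longrightarrow> y = 0"
proof -
  have k: "(to_ac k, to_ac k) \<in> R" for k using assms by (auto simp: partial_emb_def)
  show "(to_ac k, to_ac k) \<in> R" by (rule k)
  show "(0, 0) \<in> R" "(1, 1) \<in> R" using k[of 0] k[of 1] by simp_all
  show add: "(x + x', y + y') \<in> R" if "(x, y) \<in> R" "(x', y') \<in> R" for x y x' y'
    using assms that by (auto simp: partial_emb_def)
  show mul: "(x * x', y * y') \<in> R" if "(x, y) \<in> R" "(x', y') \<in> R" for x y x' y'
    using assms that by (auto simp: partial_emb_def)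
  show sub: "(x - x', y - y') \<in> R" if "(x, y) \<in> R" "(x', y') \<in> R" for x y x' y'
    using add[OF that(1) mul[OF k[of "-1"] that(2)]] by simp
  show z: "y = 0" if "(0, y) \<in> R" for y using assms that by (auto simp: partial_emb_def)
  show "y = z" if "(x, y) \<in> R" "(x, z) \<in> R" using z[of "y - z"] sub[OF that] by simp
qed

lemma intermediate_Domain: "partial_emb R \<Longrightarrow> intermediate (Domain R)"
  unfolding intermediate_def by (auto intro: partial_embD)

text \<open>Application of a partial embedding to the coefficients of a polynomial, as a relation
  because \<open>R\<close> need not be total.\<close>

definition rel_coeffs ::
  "('a::zero \<times> 'b::zero) set \<Rightarrow> 'a poly \<Rightarrow> 'b poly \<Rightarrow> bool" where
  "rel_coeffs R g h \<longleftrightarrow> (\<forall>i. (Polynomial.coeff g i, Polynomial.coeff h i) \<in> R)"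

lemma rel_coeffs_pCons: "rel_coeffs R (pCons a g) (pCons b h) \<longleftrightarrow> (a, b) \<in> R \<and> rel_coeffs R g h"
  by (auto simp: rel_coeffs_def coeff_pCons split: nat.split)

lemma rel_coeffs_arith:
  assumes R: "partial_emb R"
  shows "rel_coeffs R 0 0" "rel_coeffs R g h \<Longrightarrow> rel_coeffs R g' h' \<Longrightarrow> rel_coeffs R (g + g') (h + h')"
    "rel_coeffs R g h \<Longrightarrow> rel_coeffs R g' h' \<Longrightarrow> rel_coeffs R (g - g') (h - h')"
    "rel_coeffs R g h \<Longrightarrow> rel_coeffs R g' h' \<Longrightarrow> rel_coeffs R (g * g') (h * h')"
    "(a, b) \<in> R \<Longrightarrow> rel_coeffs R (Polynomial.monom a n) (Polynomial.monom b n)"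
proof -
  have sum: "(\<Sum>i\<in>I. f i, \<Sum>i\<in>I. f' i) \<in> R" if "\<And>i. i \<in> I \<Longrightarrow> (f i, f' i) \<in> R"
    for I :: "nat set" and f f'
    using that by (induction I rule: infinite_finite_induct) (auto intro: partial_embD[OF R])
  show "rel_coeffs R g h \<Longrightarrow> rel_coeffs R g' h' \<Longrightarrow> rel_coeffs R (g * g') (h * h')"
    by (auto simp: rel_coeffs_def coeff_mult intro!: sum partial_embD(5)[OF R])
qed (auto simp: rel_coeffs_def intro: partial_embD[OF R])

lemma rel_coeffs_exists:
  assumes R: "partial_emb R" and "coeffs_in (Domain R) g"
  shows "\<exists>h. rel_coeffs R g h"
  using assms(2)
proof (induction g)
  case 0
  then show ?case using rel_coeffs_arith(1)[OF R] by blast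
next
  case (pCons a g)
  then obtain b h where "(a, b) \<in> R" "rel_coeffs R g h" by (auto simp: coeffs_in_pCons)
  then show ?case using rel_coeffs_pCons by blast
qed

definition adjoin_emb where
  "adjoin_emb R x y = {(poly g x, poly h y) | g h. rel_coeffs R g h}"

text \<open>Well-definedness is the point: if \<open>g\<close> vanishes at \<open>x\<close>, then
  \<open>m\<close> divides \<open>g\<close>, so the image of \<open>g\<close> is a multiple of
  \<open>m'\<close> and vanishes at \<open>y\<close>.\<close>

lemma adjoin_emb:
  assumes R: "partial_emb R" and m: "min_poly_over (Domain R) x m"
    and m': "rel_coeffs R m m'" and y: "poly m' y = 0"
  shows "partial_emb (adjoin_emb R x (y :: 'a::field alg_closure))" "R \<subseteq> adjoin_emb R x y" "(x, y) \<in> adjoin_emb R x y"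
proof -
  note arith = rel_coeffs_arith[OF R] note mD = min_poly_overD[OF m]
  have D: "intermediate (Domain R)" by (rule intermediate_Domain[OF R])
  show sub: "R \<subseteq> adjoin_emb R x y"
  proof clarify
    fix a b assume "(a, b) \<in> R"
    then have "rel_coeffs R [:a:] [:b:]" by (auto simp: rel_coeffs_pCons arith)
    then show "(a, b) \<in> adjoin_emb R x y" unfolding adjoin_emb_def
      by (intro CollectI exI[of _ "[:a:]"] exI[of _ "[:b:]"]) auto
  qed
  have "rel_coeffs R [:0, 1:] [:0, 1:]" by (auto simp: rel_coeffs_pCons arith partial_embD[OF R])
  then show "(x, y) \<in> adjoin_emb R x y" unfolding adjoin_emb_def
    by (intro CollectI exI[of _ "[:0, 1:]"]) auto
  have zero: "poly h y = 0" if gh: "rel_coeffs R g h" "poly g x = 0" for g h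
  proof -
    have g: "coeffs_in (Domain R) g" using that by (auto simp: rel_coeffs_def coeffs_in_def)
    obtain q where q: "coeffs_in (Domain R) q" "g = m * q"
      using min_poly_over_divides[OF D m g gh(2)] by blast
    obtain q' where "rel_coeffs R q q'" using rel_coeffs_exists[OF R q(1)] by blast
    then have "rel_coeffs R g (m' * q')" using arith(4)[OF m'] q by blast
    then have "h = m' * q'"
      using gh(1) unfolding rel_coeffs_def by (intro poly_eqI) (blast intro: partial_embD(7)[OF R])
    then show ?thesis using y by simp
  qed
  show "partial_emb (adjoin_emb R x y)"
    unfolding partial_emb_def
  proof (intro conjI ballI allI impI)
    fix k :: "'a alg_closure" assume "k \<in> base_field"
    then show "(k, k) \<in> adjoin_emb R x y" using partial_embD(1)[OF R] sub by auto
  next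
    fix a b a' b' assume "(a, b) \<in> adjoin_emb R x y" "(a', b') \<in> adjoin_emb R x y"
    then obtain g h g' h' where gh: "rel_coeffs R g h" "rel_coeffs R g' h'"
      and eq: "a = poly g x" "b = poly h y" "a' = poly g' x" "b' = poly h' y"
      by (auto simp: adjoin_emb_def)
    show "(a + a', b + b') \<in> adjoin_emb R x y" unfolding adjoin_emb_def eq
      by (intro CollectI exI[of _ "g + g'"] exI[of _ "h + h'"] conjI arith gh) auto
    show "(a * a', b * b') \<in> adjoin_emb R x y" unfolding adjoin_emb_def eq
      by (intro CollectI exI[of _ "g * g'"] exI[of _ "h * h'"] conjI arith gh) auto
  next
    fix b assume "(0, b) \<in> adjoin_emb R x y"
    then show "b = 0" using zero unfolding adjoin_emb_def by auto
  qed
qed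

text \<open>Only the homomorphism laws over the base field are recorded. Injectivity is automatic
  for fields, and surjectivity follows because finite root sets are permuted.\<close>

definition abs_gal :: "('a::field alg_closure \<Rightarrow> 'a alg_closure) set" where
  "abs_gal = {s. (\<forall>x y. s (x + y) = s x + s y \<and> s (x * y) = s x * s y) \<and> (\<forall>k. s (to_ac k) = to_ac k)}"

text \<open>By Zorn's lemma there is a maximal partial embedding above \<open>R\<close>; algebraic
  closedness allows any element missing from its domain to be adjoined.\<close>

lemma partial_emb_extends:
  assumes R: "partial_emb R"
  shows "\<exists>s\<in>abs_gal. \<forall>(x, y)\<in>R. s x = y"
proof -
  define \<A> where "\<A> = {Q. partial_emb Q \<and> R \<subseteq> Q}"
  have "\<exists>M\<in>\<A>. \<forall>Q\<in>\<A>. M \<subseteq> Q \<longrightarrow> Q = M"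
  proof (rule subset_Zorn_nonempty)
    show "\<A> \<noteq> {}" using R by (auto simp: \<A>_def)
    fix \<C> assume "\<C> \<noteq> {}" and chain: "subset.chain \<A> \<C>"
    then obtain Q0 where Q0: "Q0 \<in> \<C>" "Q0 \<in> \<A>" by (auto simp: subset_chain_def)
    have common: "\<exists>Q\<in>\<C>. u \<in> Q \<and> v \<in> Q" if "u \<in> \<Union>\<C>" "v \<in> \<Union>\<C>" for u v
    proof -
      from that obtain Q Q' where "Q \<in> \<C>" "u \<in> Q" "Q' \<in> \<C>" "v \<in> Q'" by blast
      moreover from this have "Q \<subseteq> Q' \<or> Q' \<subseteq> Q" using chain by (auto simp: subset_chain_def)
      ultimately show ?thesis by blast
    qed
    have PQ: "partial_emb Q" if "Q \<in> \<C>" for Q using that chain by (auto simp: subset_chain_def \<A>_def)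
    have "partial_emb (\<Union>\<C>)"
      unfolding partial_emb_def
    proof (intro conjI ballI allI impI)
      fix k :: "'a alg_closure" assume "k \<in> base_field"
      then show "(k, k) \<in> \<Union>\<C>" using Q0 PQ by (auto intro: partial_embD)
    next
      fix x y x' y' assume "(x, y) \<in> \<Union>\<C>" "(x', y') \<in> \<Union>\<C>"
      then obtain Q where "Q \<in> \<C>" "(x, y) \<in> Q" "(x', y') \<in> Q" using common by blast
      then show "(x + x', y + y') \<in> \<Union>\<C>" "(x * x', y * y') \<in> \<Union>\<C>"
        using PQ partial_embD(4,5) by blast+
    next
      fix y assume "(0, y) \<in> \<Union>\<C>"
      then show "y = 0" using PQ partial_embD(8) by blast
    qed
    moreover have "R \<subseteq> \<Union>\<C>" using Q0 by (auto simp: \<A>_def)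
    ultimately show "\<Union>\<C> \<in> \<A>" by (simp add: \<A>_def)
  qed
  then obtain M where M: "partial_emb M" "R \<subseteq> M"
    and max: "\<And>Q. partial_emb Q \<Longrightarrow> M \<subseteq> Q \<Longrightarrow> Q = M" by (auto simp: \<A>_def)
  have total: "x \<in> Domain M" for x
  proof -
    obtain m where m: "min_poly_over (Domain M) x m"
      using min_poly_over_exists[OF intermediate_Domain[OF M(1)]] by blast
    obtain m' where m': "rel_coeffs M m m'" using rel_coeffs_exists[OF M(1) min_poly_overD(1)[OF m]] by blast
    \<comment> \<open>The image of the monic polynomial \<open>m\<close> cannot drop in degree, so
      it is not constant and has a root.\<close>
    have "Polynomial.coeff m' (Polynomial.degree m) = 1"
      using m' min_poly_overD(2)[OF m] partial_embD(3,7)[OF M(1)] unfolding rel_coeffs_def by metis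
    then have "Polynomial.degree m \<le> Polynomial.degree m'" by (intro le_degree) simp
    then obtain y where "poly m' y = 0"
      using alg_closed_imp_poly_has_root[of m'] min_poly_over_degree_pos[OF m] by auto
    from adjoin_emb[OF M(1) m m' this] max show ?thesis by blast
  qed
  define s where "s x = (THE y. (x, y) \<in> M)" for x
  have s: "(x, y) \<in> M \<Longrightarrow> s x = y" for x y
    unfolding s_def using partial_embD(7)[OF M(1)] by blast
  have s': "(x, s x) \<in> M" for x using total[of x] s by auto
  have "s \<in> abs_gal"
    unfolding abs_gal_def using partial_embD(4,5)[OF M(1) s' s'] partial_embD(1)[OF M(1)] s by blast
  then show ?thesis using s M(2) by blast
qed

section \<open>Automorphisms of the closure: compatibility with polynomials, permutation of roots,
  group structure\<close>

lemma abs_gal_simps: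
  assumes "s \<in> abs_gal"
  shows "s (x + y) = s x + s y" "s (x * y) = s x * s y" "s (to_ac k) = to_ac k"
    "s 0 = 0" "s 1 = 1" "s (- x) = - s x" "s (x - y) = s x - s y" "s (x ^ n) = s x ^ n"
proof -
  show add: "s (x + y) = s x + s y" and mul: "s (x * y) = s x * s y" and k: "s (to_ac k) = to_ac k"
    for x y k using assms by (auto simp: abs_gal_def)
  show "s 0 = 0" and one: "s 1 = 1" using k[of 0] k[of 1] by simp_all
  show neg: "s (- x) = - s x" for x using mul[of "to_ac (-1)" x] unfolding k by simp
  show "s (x - y) = s x - s y" using add[of x "- y"] neg by simp
  show "s (x ^ n) = s x ^ n" by (induction n) (auto simp: one mul)
qed

lemma abs_gal_sum: "s \<in> abs_gal \<Longrightarrow> s (sum f I) = (\<Sum>i\<in>I. s (f i))"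
  by (induction I rule: infinite_finite_induct) (auto simp: abs_gal_simps)

lemma abs_gal_prod: "s \<in> abs_gal \<Longrightarrow> s (prod f I) = (\<Prod>i\<in>I. s (f i))"
  by (induction I rule: infinite_finite_induct) (auto simp: abs_gal_simps)

lemma abs_gal_poly: "s \<in> abs_gal \<Longrightarrow> s (poly g x) = poly (map_poly s g) (s x)"
  by (induction g) (auto simp: abs_gal_simps map_poly_pCons)

lemma abs_gal_poly_fixed:
  assumes "s \<in> abs_gal" "coeffs_in E g" "\<And>e. e \<in> E \<Longrightarrow> s e = e"
  shows "s (poly g x) = poly g (s x)"
proof -
  have "map_poly s g = g"
    using assms abs_gal_simps(4)[OF assms(1)] by (intro poly_eqI) (auto simp: coeff_map_poly coeffs_in_def)
  then show ?thesis using abs_gal_poly[OF assms(1)] by metis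
qed

lemma abs_gal_root:
  assumes "s \<in> abs_gal" "poly (map_poly to_ac p) x = 0"
  shows "poly (map_poly to_ac p) (s x) = 0"
proof -
  have "s (poly (map_poly to_ac p) x) = poly (map_poly to_ac p) (s x)"
    by (rule abs_gal_poly_fixed[OF assms(1) coeffs_in_map_poly_to_ac[OF intermediate_base]])
      (auto simp: abs_gal_simps[OF assms(1)])
  then show ?thesis using assms abs_gal_simps(4) by metis
qed

lemma abs_gal_inj: assumes s: "s \<in> abs_gal" shows "inj s"
proof (rule injI)
  fix x y assume "s x = s y"
  then have 0: "s (x - y) = 0" by (simp add: abs_gal_simps[OF s])
  show "x = y"
  proof (rule ccontr)
    assume "x \<noteq> y"
    then have "s ((x - y) * inverse (x - y)) = 1" by (simp add: abs_gal_simps[OF s])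
    then show False using 0 by (simp add: abs_gal_simps(2)[OF s])
  qed
qed

lemma abs_gal_roots_image:
  assumes s: "s \<in> abs_gal" and "p \<noteq> 0"
  defines "T \<equiv> {x. poly (map_poly to_ac p) x = 0}"
  shows "s ` T = T"
proof (rule endo_inj_surj)
  show "finite T" unfolding T_def by (rule poly_roots_finite) (use assms in \<open>simp add: map_poly_eq_0_iff\<close>)
  show "s ` T \<subseteq> T" using abs_gal_root[OF s] by (auto simp: T_def)
  show "inj_on s T" using abs_gal_inj[OF s] by (rule inj_on_subset) auto
qed

text \<open>Each element is a root of a nonzero polynomial over the base field, whose finite root
  set is mapped onto itself.\<close>

lemma abs_gal_surj: assumes s: "s \<in> abs_gal" shows "surj s"
proof -
  have "y \<in> range s" for y
  proof -
    obtain p where "p \<noteq> 0" "poly (map_poly to_ac p) y = 0" using alg_closure_algebraic by blast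
    then show ?thesis using abs_gal_roots_image[OF s, of p] by blast
  qed
  then show ?thesis by blast
qed

lemma abs_gal_bij: "s \<in> abs_gal \<Longrightarrow> bij s"
  by (simp add: bij_def abs_gal_inj abs_gal_surj)

lemma abs_gal_id: "id \<in> abs_gal" by (simp add: abs_gal_def)

lemma abs_gal_comp: "s \<in> abs_gal \<Longrightarrow> t \<in> abs_gal \<Longrightarrow> s \<circ> t \<in> abs_gal"
  by (simp add: abs_gal_def)

lemma abs_gal_inv: assumes s: "s \<in> abs_gal" shows "inv' s \<in> abs_gal"
proof -
  have i: "inv' s x = y \<longleftrightarrow> x = s y" for x y
    using abs_gal_bij[OF s] by (metis bij_inv_eq_iff)
  have "s (inv' s x) = x" for x using i by metis
  then show ?thesis unfolding abs_gal_def by (auto simp: i abs_gal_simps[OF s])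
qed

text \<open>The identity on \<open>E\<close> extends to \<open>x\<close> by sending it to any other
  root of its minimal polynomial, and from there to the whole closure.\<close>

lemma abs_gal_conjugate:
  assumes E: "intermediate E" and m: "min_poly_over E x m" and y: "poly m y = 0"
  shows "\<exists>s\<in>abs_gal. (\<forall>e\<in>E. s e = e) \<and> s x = y"
proof -
  have R: "partial_emb (Id_on E)" unfolding partial_emb_def using E by (auto simp: intermediate_def)
  have "rel_coeffs (Id_on E) m m" using min_poly_overD(1)[OF m] by (auto simp: rel_coeffs_def coeffs_in_def)
  note * = adjoin_emb[OF R _ this y] 
  from m have "min_poly_over (Domain (Id_on E)) x m" by simp
  note * = *[OF this]
  obtain s where "s \<in> abs_gal" "\<forall>(a, b)\<in>adjoin_emb (Id_on E) x y. s a = b"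
    using partial_emb_extends[OF *(1)] by blast
  then show ?thesis using *(2,3) by (intro bexI[of _ s]) auto
qed

text \<open>Any annihilating polynomial with as many roots as its degree will do. This form passes
  to larger ground fields trivially, and to the minimal polynomial by counting roots of
  factors.\<close>

definition separable_over :: "'a::field alg_closure set \<Rightarrow> 'a alg_closure \<Rightarrow> bool" where
  "separable_over E x \<longleftrightarrow> (\<exists>g. coeffs_in E g \<and> g \<noteq> 0 \<and> poly g x = 0 \<and> card {z. poly g z = 0} = Polynomial.degree g)"

text \<open>Each factor has at most as many roots as its degree, and the degrees add up; if the
  total is attained, both bounds are.\<close>

lemma card_roots_factor:
  fixes g :: "'a::field poly"
  assumes "g = m * q" "g \<noteq> 0" "card {z. poly g z = 0} = Polynomial.degree g"
  shows "card {z. poly m z = 0} = Polynomial.degree m"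
proof -
  have nz: "m \<noteq> 0" "q \<noteq> 0" using assms by auto
  have "{z. poly g z = 0} = {z. poly m z = 0} \<union> {z. poly q z = 0}" using assms by auto
  then have "Polynomial.degree g \<le> card {z. poly m z = 0} + card {z. poly q z = 0}"
    using assms(3) card_Un_le[of "{z. poly m z = 0}" "{z. poly q z = 0}"] by simp
  moreover have "Polynomial.degree g = Polynomial.degree m + Polynomial.degree q"
    using nz assms(1) by (simp add: degree_mult_eq)
  moreover note card_poly_roots_bound[OF nz(1)] card_poly_roots_bound[OF nz(2)]
  ultimately show ?thesis by linarith
qed

lemma separable_over_mono: "separable_over E x \<Longrightarrow> E \<subseteq> F \<Longrightarrow> separable_over F x"
  unfolding separable_over_def coeffs_in_def by blast

text \<open>Fixed elements descend one generator at a time: an element \<open>g(a)\<close> with \<open>g\<close> of smaller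
  degree than the separable minimal polynomial of \<open>a\<close> takes the same value at all conjugates
  of \<open>a\<close>, so \<open>g\<close> is constant.\<close>

lemma fixed_in_base:
  assumes "finite S" and "intermediate E" and "\<And>a. a \<in> S \<Longrightarrow> separable_over E a"
    and "x \<in> field_hull (E \<union> S)"
    and "\<And>s. s \<in> abs_gal \<Longrightarrow> (\<And>e. e \<in> E \<Longrightarrow> s e = e) \<Longrightarrow> s x = x"
  shows "x \<in> E"
  using assms
proof (induction S arbitrary: E rule: finite_induct)
  case empty
  then show ?case by (simp add: field_hull_idem)
next
  case (insert a S)
  note E = insert.prems(1)
  note ext = simple_ext(1-3)[OF E, of a]
  have "x \<in> simple_ext E a"
  proof (rule insert.IH[OF ext(1)])
    show "x \<in> field_hull (simple_ext E a \<union> S)"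
      using insert.prems(3) field_hull_insert[OF E] by blast
    show "separable_over (simple_ext E a) b" if "b \<in> S" for b
      using insert.prems(2)[of b] that separable_over_mono ext(2) by blast
    show "s x = x" if "s \<in> abs_gal" "\<And>e. e \<in> simple_ext E a \<Longrightarrow> s e = e" for s
      using insert.prems(4)[OF that(1)] that(2) ext(2) by blast
  qed
  obtain m where m: "min_poly_over E a m" using min_poly_over_exists[OF E] by blast
  obtain g where g: "x = poly g a" "coeffs_in E g" "Polynomial.degree g < Polynomial.degree m"
    using \<open>x \<in> simple_ext E a\<close> simple_ext_eq_lower_degree[OF E m] by blast
  obtain h where h: "coeffs_in E h" "h \<noteq> 0" "poly h a = 0" "card {z. poly h z = 0} = Polynomial.degree h"
    using insert.prems(2)[of a] by (auto simp: separable_over_def)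
  obtain q where "h = m * q" using min_poly_over_divides[OF E m h(1,3)] by blast
  then have card: "card {z. poly m z = 0} = Polynomial.degree m" using card_roots_factor h by blast
  have "poly (g - [:x:]) z = 0" if z: "poly m z = 0" for z
  proof -
    obtain s where s: "s \<in> abs_gal" "\<forall>e\<in>E. s e = e" "s a = z" using abs_gal_conjugate[OF E m z] by blast
    then have "x = poly g z" using insert.prems(4)[of s] abs_gal_poly_fixed[OF s(1) g(2), of a] g(1) by auto
    then show ?thesis by simp
  qed
  then have sub: "{z. poly m z = 0} \<subseteq> {z. poly (g - [:x:]) z = 0}" by blast
  have "g - [:x:] = 0"
  proof (rule ccontr)
    assume nz: "g - [:x:] \<noteq> 0"
    have "Polynomial.degree m \<le> Polynomial.degree (g - [:x:])"
      using card card_mono[OF poly_roots_finite[OF nz] sub] card_poly_roots_bound[OF nz] by linarith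
    also have "\<dots> \<le> Polynomial.degree g" by (rule degree_diff_le) auto
    finally show False using g by simp
  qed
  then have "x = Polynomial.coeff g 0" by (metis coeff_pCons_0 eq_iff_diff_eq_0)
  then show ?case using g by (auto simp: coeffs_in_def)
qed

section \<open>Galois groups as permutation groups\<close>

text \<open>The set on which two automorphisms agree is itself an intermediate field.\<close>

lemma abs_gal_agree_field_hull:
  assumes s: "s \<in> abs_gal" "t \<in> abs_gal" and eq: "\<And>x. x \<in> S \<Longrightarrow> s x = t x" and x: "x \<in> field_hull S"
  shows "s x = t x"
proof -
  have "intermediate {x. s x = t x}"
    by (auto simp: intermediate_def abs_gal_simps[OF s(1)] abs_gal_simps[OF s(2)])
  then show ?thesis using field_hull_least[of "{x. s x = t x}" S] eq x by auto
qed

lemma abs_gal_Spl: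
  assumes s: "s \<in> abs_gal" shows "s ` Spl p = Spl p"
proof -
  have into: "s x \<in> Spl p" if s: "s \<in> abs_gal" and x: "x \<in> Spl p" for s x
  proof -
    have int: "intermediate (Spl p)" unfolding Spl_eq_field_hull by (rule field_hull_intermediate)
    have "intermediate {x. s x \<in> Spl p}"
      unfolding intermediate_def
      by (intro conjI ballI subsetI CollectI; elim CollectE rangeE)
        (simp_all add: abs_gal_simps(1-3)[OF s] intermediateD(1,5,6)[OF int])
    moreover have "{x. poly (map_poly to_ac p) x = 0} \<subseteq> {x. s x \<in> Spl p}"
      unfolding Spl_eq_field_hull
      by (intro subsetI CollectI field_hull_superset[THEN subsetD]) (simp add: abs_gal_root[OF s])
    ultimately have "Spl p \<subseteq> {x. s x \<in> Spl p}"
      using field_hull_least by (metis Spl_eq_field_hull)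
    then show ?thesis using x by auto
  qed
  show ?thesis
  proof
    show "s ` Spl p \<subseteq> Spl p" using into[OF s] by blast
    show "Spl p \<subseteq> s ` Spl p"
    proof
      fix x assume "x \<in> Spl p"
      then have "inv' s x \<in> Spl p" by (rule into[OF abs_gal_inv[OF s]])
      moreover have "s (inv' s x) = x" using abs_gal_surj[OF s] by (simp add: surj_f_inv_f)
      ultimately show "x \<in> s ` Spl p" by (metis imageI)
    qed
  qed
qed

text \<open>The restriction must be taken with \<open>restrict\<close>, because the members of
  \<open>Bij\<close> are extensional functions.\<close>

lemma abs_gal_restrict_Gal:
  assumes s: "s \<in> abs_gal" shows "restrict s (Spl p) \<in> carrier (Gal p)"
proof -
  have int: "intermediate (Spl p)" unfolding Spl_eq_field_hull by (rule field_hull_intermediate)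
  have "bij_betw s (Spl p) (Spl p)"
    using abs_gal_Spl[OF s] abs_gal_inj[OF s] by (auto simp: bij_betw_def intro: inj_on_subset)
  then have "restrict s (Spl p) \<in> Bij (Spl p)" by (simp add: Bij_def)
  moreover have "s x \<in> Spl p" if "x \<in> Spl p" for x using abs_gal_Spl[OF s] that by blast
  ultimately show ?thesis
    by (auto simp: Gal_def aut_group_def ring_hom_def abs_gal_simps[OF s] intermediateD[OF int])
qed

text \<open>The graph of \<open>t\<close> is a partial embedding. Together with restriction this
  identifies Galois groups of splitting fields with images of \<open>abs_gal\<close>, so one group
  serves both quintics and their product.\<close>

lemma Gal_extends:
  assumes t: "t \<in> carrier (Gal p)"
  shows "\<exists>s\<in>abs_gal. \<forall>x\<in>Spl p. s x = t x"
proof -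
  have int: "intermediate (Spl p)" unfolding Spl_eq_field_hull by (rule field_hull_intermediate)
  have t: "t \<in> Bij (Spl p)" "\<And>x y. x \<in> Spl p \<Longrightarrow> y \<in> Spl p \<Longrightarrow> t (x + y) = t x + t y \<and> t (x * y) = t x * t y"
    "\<And>k. t (to_ac k) = to_ac k"
    using t by (auto simp: Gal_def aut_group_def ring_hom_def)
  let ?R = "{(x, t x) | x. x \<in> Spl p}"
  have "partial_emb ?R"
    unfolding partial_emb_def
  proof (intro conjI ballI allI impI)
    fix k :: "'a alg_closure" assume "k \<in> base_field"
    then show "(k, k) \<in> ?R" using t(3) intermediateD(1)[OF int] by auto
  next
    fix x y x' y' assume "(x, y) \<in> ?R" "(x', y') \<in> ?R"
    then have "x \<in> Spl p" "x' \<in> Spl p" "y = t x" "y' = t x'" by auto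
    then show "(x + x', y + y') \<in> ?R" "(x * x', y * y') \<in> ?R"
      using t(2)[of x x'] intermediateD(5,6)[OF int] by simp_all
  next
    fix y assume "(0, y) \<in> ?R"
    then show "y = 0" using t(3)[of 0] by simp
  qed
  then obtain s where s: "s \<in> abs_gal" "\<forall>(x, y)\<in>?R. s x = y" using partial_emb_extends by blast
  have "s x = t x" if "x \<in> Spl p" for x using s(2)[THEN bspec, of "(x, t x)"] that by simp
  with s(1) show ?thesis by blast
qed

text \<open>An automorphism only permutes the linear factors, so it fixes every coefficient; the
  coefficients lie in a field generated by separable elements and hence in the base field. Applied
  to the conjugates of a single element and to the resolvent.\<close>

lemma resolvent_descends:
  fixes f :: "'i \<Rightarrow> 'a::field alg_closure"
  assumes fin: "finite I" "finite S" and sep: "\<And>a. a \<in> S \<Longrightarrow> separable_over base_field a"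
    and f: "\<And>i. i \<in> I \<Longrightarrow> f i \<in> field_hull S"
    and perm: "\<And>s. s \<in> abs_gal \<Longrightarrow> \<exists>\<pi>. bij_betw \<pi> I I \<and> (\<forall>i\<in>I. s (f i) = f (\<pi> i))"
  shows "\<exists>r. map_poly to_ac r = (\<Prod>i\<in>I. [:- f i, 1:])"
proof -
  let ?P = "\<lambda>f. \<Prod>i\<in>I. [:- f i, 1:]"
  note hull = field_hull_intermediate[of S]
  have map_prod: "map_poly s (\<Prod>i\<in>J. [:- f i, 1:]) = (\<Prod>i\<in>J. [:- s (f i), 1:])"
    if s: "s \<in> abs_gal" for s and J :: "'i set" and f
  proof -
    have mult: "map_poly s (g * h) = map_poly s g * map_poly s h" for g h
      by (rule poly_eqI)
        (simp add: coeff_map_poly coeff_mult abs_gal_simps[OF s] abs_gal_sum[OF s])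
    show ?thesis
      by (induction J rule: infinite_finite_induct)
        (auto simp: mult abs_gal_simps[OF s] map_poly_pCons simp del: mult_pCons_left)
  qed
  have hullP: "coeffs_in (field_hull S) (\<Prod>i\<in>J. [:- f i, 1:])" if "J \<subseteq> I" for J
    using that f
    by (induction J rule: infinite_finite_induct)
      (auto intro!: coeffs_in_arith(2,7)[OF hull] simp: coeffs_in_pCons intermediateD[OF hull] coeffs_in_arith(1)[OF hull]
        simp del: mult_pCons_left)
  have "coeffs_in base_field (?P f)"
    unfolding coeffs_in_def
  proof
    fix n
    show "Polynomial.coeff (?P f) n \<in> base_field"
    proof (rule fixed_in_base[OF fin(2) intermediate_base sep])
      have "Polynomial.coeff (?P f) n \<in> field_hull S" using hullP[of I] by (simp add: coeffs_in_def)
      then show "Polynomial.coeff (?P f) n \<in> field_hull (base_field \<union> S)"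
        using field_hull_mono[of S "base_field \<union> S"] by blast
    next
      fix s :: "'a alg_closure \<Rightarrow> 'a alg_closure" assume s: "s \<in> abs_gal"
      obtain \<pi> where \<pi>: "bij_betw \<pi> I I" "\<And>i. i \<in> I \<Longrightarrow> s (f i) = f (\<pi> i)" using perm[OF s] by blast
      have "s (Polynomial.coeff (?P f) n) = Polynomial.coeff (map_poly s (?P f)) n"
        by (simp add: coeff_map_poly abs_gal_simps[OF s])
      also have "map_poly s (?P f) = (\<Prod>i\<in>I. [:- f (\<pi> i), 1:])"
        unfolding map_prod[OF s] using \<pi>(2) by (intro prod.cong) auto
      also have "\<dots> = ?P f" by (rule prod.reindex_bij_betw[OF \<pi>(1)])
      finally show "s (Polynomial.coeff (?P f) n) = Polynomial.coeff (?P f) n" .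
    qed
  qed
  then show ?thesis using coeffs_in_baseE by metis
qed

text \<open>Provides the scalar at which finitely many polynomials can be told apart by their
  values, as in proofs of the primitive element theorem.\<close>

lemma base_avoids_roots:
  assumes "infinite (UNIV :: 'a::field set)" "finite \<P>" "\<And>g. g \<in> \<P> \<Longrightarrow> g \<noteq> (0 :: 'a alg_closure poly)"
  shows "\<exists>k :: 'a. \<forall>g\<in>\<P>. poly g (to_ac k) \<noteq> 0"
proof -
  have "finite (\<Union>g\<in>\<P>. {x. poly g x = 0})" using assms poly_roots_finite by blast
  moreover have "infinite (range (to_ac :: 'a \<Rightarrow> _))"
    using assms(1) inj_to_ac finite_imageD by blast
  ultimately obtain x where "x \<in> range (to_ac :: 'a \<Rightarrow> _)" "x \<notin> (\<Union>g\<in>\<P>. {x. poly g x = 0})"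
    by (meson finite_subset subsetI)
  then show ?thesis by auto
qed

lemma card_eq_card_image_times_fiber:
  assumes "finite A" "\<And>a. a \<in> A \<Longrightarrow> card {x \<in> A. f x = f a} = k"
  shows "card A = card (f ` A) * k"
proof -
  have "card A = (\<Sum>y\<in>f ` A. card {x \<in> A. f x = y})"
    using sum.image_gen[OF assms(1), of "\<lambda>_. 1 :: nat" f] by simp
  also have "\<dots> = (\<Sum>y\<in>f ` A. k)" using assms(2) by (intro sum.cong) auto
  finally show ?thesis by simp
qed

section \<open>The permutation action on the roots of one and of two quintics\<close>

locale separable_quintic =
  fixes p :: "'m::field poly" and \<alpha> :: "nat \<Rightarrow> 'm alg_closure"
  assumes enum: "enumerates_roots \<alpha> p" and deg: "Polynomial.degree p = 5"
begin

lemma inj_roots: "inj_on \<alpha> {1..5}" and roots: "\<alpha> ` {1..5} = {x. poly (map_poly to_ac p) x = 0}"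
  using enum by (auto simp: enumerates_roots_def bij_betw_def)

lemma nonzero: "p \<noteq> 0" using deg by auto

lemma Spl_eq: "Spl p = field_hull (\<alpha> ` {1..5})"
  by (simp only: Spl_eq_field_hull roots)

lemma root_in_Spl: "i \<in> {1..5} \<Longrightarrow> \<alpha> i \<in> Spl p"
  unfolding Spl_eq using field_hull_superset by blast

text \<open>The quintic itself is the witness: it has degree 5 and five distinct roots.\<close>

lemma separable: "intermediate E \<Longrightarrow> a \<in> \<alpha> ` {1..5} \<Longrightarrow> separable_over E a"
  unfolding separable_over_def
  using nonzero deg card_image[OF inj_roots] unfolding roots
  by (intro exI[of _ "map_poly to_ac p"])
    (auto simp: coeffs_in_map_poly_to_ac map_poly_eq_0_iff degree_map_poly)

lemma perm_unique:
  assumes "g permutes {1..5}" "h permutes {1..5}" "\<And>i. i \<in> {1..5} \<Longrightarrow> \<alpha> (g i) = \<alpha> (h i)"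
  shows "g = h"
proof
  fix i
  show "g i = h i"
  proof (cases "i \<in> {1..5}")
    case True
    then show ?thesis
      using assms permutes_in_image inj_roots by (metis inj_onD)
  qed (use assms permutes_not_in in metis)
qed

lemma perm_exists:
  assumes s: "s \<in> abs_gal"
  shows "\<exists>g. g permutes {1..5} \<and> (\<forall>i\<in>{1..5}. s (\<alpha> i) = \<alpha> (g i))"
proof -
  let ?j = "the_inv_into {1..5} \<alpha>"
  define g where "g i = (if i \<in> {1..5} then ?j (s (\<alpha> i)) else i)" for i
  have "bij_betw \<alpha> {1..5} (\<alpha> ` {1..5})" using inj_roots by (simp add: bij_betw_def)
  moreover have "bij_betw s (\<alpha> ` {1..5}) (\<alpha> ` {1..5})"
    using abs_gal_roots_image[OF s nonzero] abs_gal_inj[OF s]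
    unfolding roots by (auto simp: bij_betw_def intro: inj_on_subset)
  moreover have "bij_betw ?j (\<alpha> ` {1..5}) {1..5}"
    using inj_roots by (simp add: bij_betw_the_inv_into inj_on_imp_bij_betw)
  ultimately have "bij_betw (?j \<circ> (s \<circ> \<alpha>)) {1..5} {1..5}" by (meson bij_betw_trans)
  then have "bij_betw g {1..5} {1..5}" by (rule bij_betw_cong[THEN iffD1, rotated]) (simp add: g_def)
  then have "g permutes {1..5}" by (rule bij_imp_permutes) (simp only: g_def if_False)
  moreover have "s (\<alpha> i) = \<alpha> (g i)" if "i \<in> {1..5}" for i
  proof -
    have "s (\<alpha> i) \<in> \<alpha> ` {1..5}" using abs_gal_roots_image[OF s nonzero] that unfolding roots[symmetric] by blast
    then have "\<alpha> (?j (s (\<alpha> i))) = s (\<alpha> i)" by (rule f_the_inv_into_f[OF inj_roots])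
    then show ?thesis unfolding g_def using that by (simp only: if_True)
  qed
  ultimately show ?thesis by blast
qed

text \<open>Trades automorphisms of the splitting field for those of the closure, which can be
  compared across different splitting fields.\<close>

lemma perm_gal_iff:
  "g \<in> carrier (perm_gal \<alpha> p) \<longleftrightarrow>
     g permutes {1..5} \<and> (\<exists>s\<in>abs_gal. \<forall>i\<in>{1..5}. s (\<alpha> i) = \<alpha> (g i))"
proof -
  have "(\<exists>s\<in>carrier (Gal p). \<forall>i\<in>{1..5}. s (\<alpha> i) = \<alpha> (g i)) \<longleftrightarrow>
        (\<exists>s\<in>abs_gal. \<forall>i\<in>{1..5}. s (\<alpha> i) = \<alpha> (g i))" (is "?l \<longleftrightarrow> ?r")
  proof
    assume ?l then show ?r using Gal_extends root_in_Spl by metis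
  next
    assume ?r then show ?l using abs_gal_restrict_Gal root_in_Spl by (metis restrict_apply')
  qed
  then show ?thesis by (simp add: perm_gal_def sym_group_def)
qed

text \<open>The minimal polynomial of one root divides the irreducible quintic and is therefore a
  constant multiple of it, so all five roots are conjugate.\<close>

lemma perm_gal_transitive:
  assumes irr: "Factorial_Ring.irreducible p" and ij: "i \<in> {1..5}" "j \<in> {1..5}"
  shows "\<exists>g\<in>carrier (perm_gal \<alpha> p). g i = j"
proof -
  obtain m where m: "min_poly_over base_field (\<alpha> i) m" using min_poly_over_exists[OF intermediate_base] by blast
  have "poly (map_poly to_ac p) (\<alpha> i) = 0" and j0: "poly (map_poly to_ac p) (\<alpha> j) = 0" using roots ij by blast+
  with min_poly_over_divides[OF intermediate_base m coeffs_in_map_poly_to_ac[OF intermediate_base]]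
  obtain q where q: "coeffs_in base_field q" "map_poly to_ac p = m * q" by blast
  obtain m0 where m0: "m = map_poly to_ac m0" using coeffs_in_baseE min_poly_overD(1)[OF m] by blast
  obtain q0 where q0: "q = map_poly to_ac q0" using coeffs_in_baseE q(1) by blast
  have "map_poly to_ac p = map_poly to_ac (m0 * q0)" using q m0 q0 by (simp add: map_poly_to_ac_mult)
  then have "p = m0 * q0" by (metis (no_types) coeff_map_poly poly_eqI to_ac_0 to_ac_eq_iff)
  moreover have "\<not> is_unit m0"
    using min_poly_over_degree_pos[OF m] by (auto simp: m0 degree_map_poly is_unit_poly_iff)
  ultimately have "is_unit q0" using irr Factorial_Ring.irreducibleD by blast
  then obtain c where "q0 = [:c:]" "c \<noteq> 0" by (metis is_unit_poly_iff is_unit_iff_degree dvd_field_iff degree_0 not_one_le_zero zero_neq_one dvd_0_left)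
  then have "poly m (\<alpha> j) = 0" using j0 q q0 by (auto simp: map_poly_pCons)
  from abs_gal_conjugate[OF intermediate_base m this]
  obtain s where s: "s \<in> abs_gal" "s (\<alpha> i) = \<alpha> j" by blast
  obtain g where g: "g permutes {1..5}" "\<forall>i\<in>{1..5}. s (\<alpha> i) = \<alpha> (g i)" using perm_exists[OF s(1)] by blast
  then have "\<alpha> (g i) = \<alpha> j" "g i \<in> {1..5}" using s ij by (auto simp: permutes_in_image simp del: atLeastAtMost_iff)
  then have "g i = j" using inj_roots ij by (metis inj_onD)
  then show ?thesis using g s perm_gal_iff by blast
qed

end

locale two_separable_quintics = P: separable_quintic p \<alpha> + Q: separable_quintic q \<beta>
  for p q :: "'m::field poly" and \<alpha> \<beta> :: "nat \<Rightarrow> 'm alg_closure"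
begin

lemma perm_gal2_iff:
  "(g, h) \<in> carrier (perm_gal2 \<alpha> p \<beta> q) \<longleftrightarrow> g permutes {1..5} \<and> h permutes {1..5} \<and>
     (\<exists>s\<in>abs_gal. \<forall>i\<in>{1..5}. s (\<alpha> i) = \<alpha> (g i) \<and> s (\<beta> i) = \<beta> (h i))"
proof -
  have prod: "poly (map_poly to_ac (p * q)) x = poly (map_poly to_ac p) x * poly (map_poly to_ac q) x" for x
    by (simp add: map_poly_to_ac_mult)
  have "Spl p \<subseteq> Spl (p * q)"
    unfolding Spl_eq_field_hull by (rule field_hull_mono) (auto simp: prod)
  moreover have "Spl q \<subseteq> Spl (p * q)"
    unfolding Spl_eq_field_hull by (rule field_hull_mono) (auto simp: prod)
  ultimately have in_Spl: "\<alpha> i \<in> Spl (p * q)" "\<beta> i \<in> Spl (p * q)" if "i \<in> {1..5}" for i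
    using P.root_in_Spl Q.root_in_Spl that by blast+
  have "(\<exists>s\<in>carrier (Gal (p * q)). \<forall>i\<in>{1..5}. s (\<alpha> i) = \<alpha> (g i) \<and> s (\<beta> i) = \<beta> (h i)) \<longleftrightarrow>
        (\<exists>s\<in>abs_gal. \<forall>i\<in>{1..5}. s (\<alpha> i) = \<alpha> (g i) \<and> s (\<beta> i) = \<beta> (h i))" (is "?l \<longleftrightarrow> ?r")
  proof
    assume ?l
    then obtain t where t: "t \<in> carrier (Gal (p * q))"
      "\<forall>i\<in>{1..5}. t (\<alpha> i) = \<alpha> (g i) \<and> t (\<beta> i) = \<beta> (h i)" by blast
    obtain s where s: "s \<in> abs_gal" "\<forall>x\<in>Spl (p * q). s x = t x" using Gal_extends[OF t(1)] by blast
    show ?r by (rule bexI[OF _ s(1)]) (metis s(2) t(2) in_Spl)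
  next
    assume ?r
    then obtain s where s: "s \<in> abs_gal" "\<forall>i\<in>{1..5}. s (\<alpha> i) = \<alpha> (g i) \<and> s (\<beta> i) = \<beta> (h i)" by blast
    show ?l
      by (rule bexI[OF _ abs_gal_restrict_Gal[OF s(1)]]) (metis s(2) in_Spl restrict_apply')
  qed
  then show ?thesis by (simp add: perm_gal2_def sym_group_def DirProd_def)
qed

lemma perm_pair_exists:
  assumes "s \<in> abs_gal"
  shows "\<exists>g h. (g, h) \<in> carrier (perm_gal2 \<alpha> p \<beta> q) \<and> (\<forall>i\<in>{1..5}. s (\<alpha> i) = \<alpha> (g i) \<and> s (\<beta> i) = \<beta> (h i))"
proof -
  obtain g where g: "g permutes {1..5}" "\<forall>i\<in>{1..5}. s (\<alpha> i) = \<alpha> (g i)" using P.perm_exists[OF assms] by blast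
  obtain h where h: "h permutes {1..5}" "\<forall>i\<in>{1..5}. s (\<beta> i) = \<beta> (h i)" using Q.perm_exists[OF assms] by blast
  have "(g, h) \<in> carrier (perm_gal2 \<alpha> p \<beta> q)"
    unfolding perm_gal2_iff by (intro conjI g(1) h(1) bexI[OF _ assms] ballI) (use g h in auto)
  then show ?thesis using g(2) h(2) by blast
qed

text \<open>An automorphism that realises \<open>g\<close> on the roots of \<open>p\<close> permutes
  the roots of \<open>q\<close> as well; hence the projection is onto. This is the first half of
  subdirectness.\<close>

lemma fst_perm_gal2: "fst ` carrier (perm_gal2 \<alpha> p \<beta> q) = carrier (perm_gal \<alpha> p)"
proof (intro equalityI subsetI)
  fix g assume "g \<in> fst ` carrier (perm_gal2 \<alpha> p \<beta> q)"
  then obtain h where "(g, h) \<in> carrier (perm_gal2 \<alpha> p \<beta> q)" by force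
  then show "g \<in> carrier (perm_gal \<alpha> p)" unfolding perm_gal2_iff P.perm_gal_iff by blast
next
  fix g assume "g \<in> carrier (perm_gal \<alpha> p)"
  then obtain s where s: "s \<in> abs_gal" "g permutes {1..5}" "\<forall>i\<in>{1..5}. s (\<alpha> i) = \<alpha> (g i)"
    unfolding P.perm_gal_iff by blast
  obtain h where "h permutes {1..5}" "\<forall>i\<in>{1..5}. s (\<beta> i) = \<beta> (h i)" using Q.perm_exists[OF s(1)] by blast
  with s have "(g, h) \<in> carrier (perm_gal2 \<alpha> p \<beta> q)" unfolding perm_gal2_iff by blast
  then show "g \<in> fst ` carrier (perm_gal2 \<alpha> p \<beta> q)" by force
qed

lemma snd_perm_gal2: "snd ` carrier (perm_gal2 \<alpha> p \<beta> q) = carrier (perm_gal \<beta> q)"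
proof (intro equalityI subsetI)
  fix h assume "h \<in> snd ` carrier (perm_gal2 \<alpha> p \<beta> q)"
  then obtain g where "(g, h) \<in> carrier (perm_gal2 \<alpha> p \<beta> q)" by force
  then show "h \<in> carrier (perm_gal \<beta> q)" unfolding perm_gal2_iff Q.perm_gal_iff by blast
next
  fix h assume "h \<in> carrier (perm_gal \<beta> q)"
  then obtain s where s: "s \<in> abs_gal" "h permutes {1..5}" "\<forall>i\<in>{1..5}. s (\<beta> i) = \<beta> (h i)"
    unfolding Q.perm_gal_iff by blast
  obtain g where "g permutes {1..5}" "\<forall>i\<in>{1..5}. s (\<alpha> i) = \<alpha> (g i)" using P.perm_exists[OF s(1)] by blast
  with s have "(g, h) \<in> carrier (perm_gal2 \<alpha> p \<beta> q)" unfolding perm_gal2_iff by blast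
  then show "h \<in> snd ` carrier (perm_gal2 \<alpha> p \<beta> q)" by force
qed

lemma perm_gal2_comp:
  assumes "(g, h) \<in> carrier (perm_gal2 \<alpha> p \<beta> q)" "(g', h') \<in> carrier (perm_gal2 \<alpha> p \<beta> q)"
  shows "(g \<circ> g', h \<circ> h') \<in> carrier (perm_gal2 \<alpha> p \<beta> q)"
proof -
  obtain s where s: "s \<in> abs_gal" "\<forall>i\<in>{1..5}. s (\<alpha> i) = \<alpha> (g i) \<and> s (\<beta> i) = \<beta> (h i)"
    and gh: "g permutes {1..5}" "h permutes {1..5}"
    using assms(1) unfolding perm_gal2_iff by blast
  obtain t where t: "t \<in> abs_gal" "\<forall>i\<in>{1..5}. t (\<alpha> i) = \<alpha> (g' i) \<and> t (\<beta> i) = \<beta> (h' i)"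
    and gh': "g' permutes {1..5}" "h' permutes {1..5}"
    using assms(2) unfolding perm_gal2_iff by blast
  have "(s \<circ> t) (\<alpha> i) = \<alpha> ((g \<circ> g') i) \<and> (s \<circ> t) (\<beta> i) = \<beta> ((h \<circ> h') i)" if "i \<in> {1..5}" for i
  proof -
    have "g' i \<in> {1..5}" "h' i \<in> {1..5}" using permutes_in_image[OF gh'(1)] permutes_in_image[OF gh'(2)] that by blast+
    then show ?thesis using s(2) t(2) that unfolding comp_def by metis
  qed
  then show ?thesis unfolding perm_gal2_iff
    using abs_gal_comp[OF s(1) t(1)] permutes_compose[OF gh'(1) gh(1)] permutes_compose[OF gh'(2) gh(2)] by blast
qed

lemma perm_gal2_inv:
  assumes gh: "(g, h) \<in> carrier (perm_gal2 \<alpha> p \<beta> q)"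
  shows "(inv' g, inv' h) \<in> carrier (perm_gal2 \<alpha> p \<beta> q)"
proof -
  obtain s where s: "s \<in> abs_gal" "\<forall>i\<in>{1..5}. s (\<alpha> i) = \<alpha> (g i) \<and> s (\<beta> i) = \<beta> (h i)"
    and per: "g permutes {1..5}" "h permutes {1..5}"
    using gh unfolding perm_gal2_iff by blast
  have inv_s: "inv' s (s x) = x" for x using abs_gal_inj[OF s(1)] by simp
  have "inv' s (\<alpha> i) = \<alpha> (inv' g i) \<and> inv' s (\<beta> i) = \<beta> (inv' h i)" if i: "i \<in> {1..5}" for i
  proof -
    have "inv' g i \<in> {1..5}" "inv' h i \<in> {1..5}"
      using permutes_in_image[OF permutes_inv[OF per(1)]] permutes_in_image[OF permutes_inv[OF per(2)]] i by blast+
    then have "s (\<alpha> (inv' g i)) = \<alpha> i" "s (\<beta> (inv' h i)) = \<beta> i"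
      using s(2) permutes_inverses(1)[OF per(1)] permutes_inverses(1)[OF per(2)] by metis+
    then show ?thesis using inv_s by metis
  qed
  then show ?thesis unfolding perm_gal2_iff
    by (intro conjI permutes_inv per bexI[OF _ abs_gal_inv[OF s(1)]] ballI) auto
qed

lemma finite_perm_gal2: "finite (carrier (perm_gal2 \<alpha> p \<beta> q))"
proof (rule finite_subset)
  show "carrier (perm_gal2 \<alpha> p \<beta> q) \<subseteq> {g. g permutes {1..5}} \<times> {g. g permutes {1..5}}"
    using perm_gal2_iff by auto
qed (auto intro: finite_permutations)

section \<open>Galois correspondence for the two splitting fields and their intersection\<close>

lemma fixes_Spl_iff:
  assumes s: "s \<in> abs_gal"
  shows "(\<forall>x\<in>Spl p. s x = x) \<longleftrightarrow> (\<forall>i\<in>{1..5}. s (\<alpha> i) = \<alpha> i)"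
    and "(\<forall>x\<in>Spl q. s x = x) \<longleftrightarrow> (\<forall>i\<in>{1..5}. s (\<beta> i) = \<beta> i)"
proof -
  have "s x = x" if "\<forall>i\<in>{1..5}. s (\<alpha> i) = \<alpha> i" "x \<in> Spl p" for x
    using abs_gal_agree_field_hull[OF s abs_gal_id, of "\<alpha> ` {1..5}" x] that unfolding P.Spl_eq by auto
  then show "(\<forall>x\<in>Spl p. s x = x) \<longleftrightarrow> (\<forall>i\<in>{1..5}. s (\<alpha> i) = \<alpha> i)" using P.root_in_Spl by blast
  have "s x = x" if "\<forall>i\<in>{1..5}. s (\<beta> i) = \<beta> i" "x \<in> Spl q" for x
    using abs_gal_agree_field_hull[OF s abs_gal_id, of "\<beta> ` {1..5}" x] that unfolding Q.Spl_eq by auto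
  then show "(\<forall>x\<in>Spl q. s x = x) \<longleftrightarrow> (\<forall>i\<in>{1..5}. s (\<beta> i) = \<beta> i)" using Q.root_in_Spl by blast
qed

text \<open>The descent argument with \<open>Spl q\<close> as ground field: over it,
  \<open>Spl p\<close> is still generated by the separable elements
  \<open>\<alpha> i\<close>.\<close>

lemma in_Spl_if_fixed:
  assumes x: "x \<in> Spl p" and fixed: "\<And>s. s \<in> abs_gal \<Longrightarrow> \<forall>i\<in>{1..5}. s (\<beta> i) = \<beta> i \<Longrightarrow> s x = x"
  shows "x \<in> Spl q"
proof (rule fixed_in_base[of "\<alpha> ` {1..5}"])
  show int: "intermediate (Spl q)" unfolding Spl_eq_field_hull by (rule field_hull_intermediate)
  show "separable_over (Spl q) a" if "a \<in> \<alpha> ` {1..5}" for a using P.separable[OF int that] .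
  show "x \<in> field_hull (Spl q \<union> \<alpha> ` {1..5})"
    using x field_hull_mono[of "\<alpha> ` {1..5}" "Spl q \<union> \<alpha> ` {1..5}"] unfolding P.Spl_eq by blast
  show "s x = x" if "s \<in> abs_gal" "\<And>e. e \<in> Spl q \<Longrightarrow> s e = e" for s
    using fixed[OF that(1)] that(2) Q.root_in_Spl by blast
qed simp

text \<open>Containment means that fixing the roots of \<open>q\<close> forces fixing those of
  \<open>p\<close>, so it is injectivity of the second projection of the joint group.\<close>

lemma Spl_subset_iff:
  "Spl p \<subseteq> Spl q \<longleftrightarrow> (\<forall>g. (g, id) \<in> carrier (perm_gal2 \<alpha> p \<beta> q) \<longrightarrow> g = id)"
proof
  assume sub: "Spl p \<subseteq> Spl q"
  show "\<forall>g. (g, id) \<in> carrier (perm_gal2 \<alpha> p \<beta> q) \<longrightarrow> g = id"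
  proof (intro allI impI)
    fix g assume "(g, id) \<in> carrier (perm_gal2 \<alpha> p \<beta> q)"
    then obtain s where s: "s \<in> abs_gal" "\<forall>i\<in>{1..5}. s (\<alpha> i) = \<alpha> (g i) \<and> s (\<beta> i) = \<beta> i" "g permutes {1..5}"
      unfolding perm_gal2_iff by auto
    then have "\<forall>x\<in>Spl q. s x = x" using fixes_Spl_iff(2) by blast
    then have "\<forall>i\<in>{1..5}. s (\<alpha> i) = \<alpha> i" using sub fixes_Spl_iff(1)[OF s(1)] by blast
    then show "g = id" using P.perm_unique[OF s(3) permutes_id] s(2) by (metis id_apply)
  qed
next
  assume *: "\<forall>g. (g, id) \<in> carrier (perm_gal2 \<alpha> p \<beta> q) \<longrightarrow> g = id"
  show "Spl p \<subseteq> Spl q"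
  proof
    fix x assume x: "x \<in> Spl p"
    show "x \<in> Spl q"
    proof (rule in_Spl_if_fixed[OF x])
      fix s :: "'m alg_closure \<Rightarrow> 'm alg_closure"
      assume s: "s \<in> abs_gal" "\<forall>i\<in>{1..5}. s (\<beta> i) = \<beta> i"
      obtain g where g: "g permutes {1..5}" "\<forall>i\<in>{1..5}. s (\<alpha> i) = \<alpha> (g i)" using P.perm_exists[OF s(1)] by blast
      have "(g, id) \<in> carrier (perm_gal2 \<alpha> p \<beta> q)"
        unfolding perm_gal2_iff by (intro conjI bexI[of _ s] ballI) (use s g in \<open>auto simp: permutes_id\<close>)
      then have "g = id" using * by blast
      then show "s x = x" using fixes_Spl_iff(1)[OF s(1)] g(2) x by auto
    qed
  qed
qed

text \<open>The generator is
  \<open>\<theta> = (\<Sum>i\<in>{1..5}. \<alpha> i * to_ac k ^ i)\<close>. Different permutations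
  of the roots give different coefficient vectors, hence different values unless \<open>k\<close> is
  a root of one of the finitely many polynomials \<open>D g h\<close>.\<close>

lemma root_tuple_generator:
  assumes inf: "infinite (UNIV :: 'm set)"
  shows "\<exists>\<theta>\<in>Spl p. (\<forall>s\<in>abs_gal. \<forall>t\<in>abs_gal. s \<theta> = t \<theta> \<longrightarrow> (\<forall>i\<in>{1..5}. s (\<alpha> i) = t (\<alpha> i))) \<and>
           finite {s \<theta> | s. s \<in> abs_gal}"
proof -
  define D where "D g h = (\<Sum>i\<in>{1..5}. Polynomial.monom (\<alpha> (g i) - \<alpha> (h i)) i)" for g h
  define \<P> where "\<P> = {D g h | g h. g permutes {1..5} \<and> h permutes {1..5} \<and> g \<noteq> h}"
  have coeff_D: "Polynomial.coeff (D g h) i = \<alpha> (g i) - \<alpha> (h i)" if "i \<in> {1..5}" for g h i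
    using that unfolding D_def by (simp add: coeff_sum sum.delta' if_distrib cong: if_cong)
  have "\<P> \<subseteq> (\<lambda>(g, h). D g h) ` ({g. g permutes {1..5}} \<times> {g. g permutes {1..5}})" by (auto simp: \<P>_def)
  then have fin\<P>: "finite \<P>" by (rule finite_subset) (auto intro: finite_permutations)
  have D0: "D g h \<noteq> 0" if "g permutes {1..5}" "h permutes {1..5}" "g \<noteq> h" for g h
  proof
    assume "D g h = 0"
    then have "\<alpha> (g i) = \<alpha> (h i)" if "i \<in> {1..5}" for i using coeff_D[OF that, of g h] by simp
    then show False using P.perm_unique that by blast
  qed
  have "d \<noteq> 0" if "d \<in> \<P>" for d using that D0 by (auto simp: \<P>_def)
  from base_avoids_roots[OF inf fin\<P> this] obtain k :: 'm where k: "\<forall>d\<in>\<P>. poly d (to_ac k) \<noteq> 0" by blast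
  define v where "v g = (\<Sum>i\<in>{1..5}. \<alpha> (g i) * to_ac k ^ i)" for g :: "nat \<Rightarrow> nat"
  define \<theta> where "\<theta> = v id"
  have v: "s \<theta> = v g" if "s \<in> abs_gal" "\<forall>i\<in>{1..5}. s (\<alpha> i) = \<alpha> (g i)" for s g
    unfolding \<theta>_def v_def abs_gal_sum[OF that(1)]
    by (rule sum.cong) (use that in \<open>auto simp: abs_gal_simps(2,3,8)[OF that(1)]\<close>)
  have int: "intermediate (Spl p)" unfolding Spl_eq_field_hull by (rule field_hull_intermediate)
  have "\<theta> \<in> Spl p" unfolding \<theta>_def v_def id_apply
    by (intro intermediate_sum[OF int] intermediateD(1,6,9)[OF int] P.root_in_Spl)
  moreover have "\<forall>i\<in>{1..5}. s (\<alpha> i) = t (\<alpha> i)"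
    if st: "s \<in> abs_gal" "t \<in> abs_gal" "s \<theta> = t \<theta>" for s t
  proof -
    obtain g where g: "g permutes {1..5}" "\<forall>i\<in>{1..5}. s (\<alpha> i) = \<alpha> (g i)" using P.perm_exists[OF st(1)] by blast
    obtain h where h: "h permutes {1..5}" "\<forall>i\<in>{1..5}. t (\<alpha> i) = \<alpha> (h i)" using P.perm_exists[OF st(2)] by blast
    have "v g = v h" using v st g h by metis
    then have "poly (D g h) (to_ac k) = 0"
      unfolding v_def D_def by (simp add: poly_sum poly_monom left_diff_distrib sum_subtractf)
    then have "g = h" using k g h unfolding \<P>_def by blast
    then show ?thesis using g h by simp
  qed
  moreover have "{s \<theta> | s. s \<in> abs_gal} \<subseteq> v ` {g. g permutes {1..5}}"
    using v P.perm_exists by blast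
  then have "finite {s \<theta> | s. s \<in> abs_gal}"
    by (rule finite_subset) (auto intro: finite_permutations)
  ultimately show ?thesis by blast
qed

text \<open>The norm \<open>\<Prod>(u - w \<theta>)\<close> over the automorphisms \<open>w\<close> fixing \<open>Spl q\<close>, with \<open>u\<close> chosen outside
  finitely many roots, generates the fixed field of these automorphisms in \<open>Spl p\<close>.\<close>

lemma intersection_generator:
  assumes inf: "infinite (UNIV :: 'm set)"
  shows "\<exists>\<eta>\<in>Spl p. (\<forall>w\<in>abs_gal. (\<forall>i\<in>{1..5}. w (\<beta> i) = \<beta> i) \<longrightarrow> w \<eta> = \<eta>) \<and>
    (\<forall>s\<in>abs_gal. \<forall>t\<in>abs_gal. s \<eta> = t \<eta> \<longrightarrow>
       (\<exists>w\<in>abs_gal. (\<forall>i\<in>{1..5}. w (\<beta> i) = \<beta> i) \<and> (\<forall>i\<in>{1..5}. s (\<alpha> i) = t (w (\<alpha> i)))))"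
proof -
  obtain \<theta> where \<theta>: "\<theta> \<in> Spl p" and fin: "finite {s \<theta> | s. s \<in> abs_gal}"
    and sep: "\<forall>s\<in>abs_gal. \<forall>t\<in>abs_gal. s \<theta> = t \<theta> \<longrightarrow> (\<forall>i\<in>{1..5}. s (\<alpha> i) = t (\<alpha> i))"
    using root_tuple_generator[OF inf] by (elim bexE conjE)
  note sep = sep[THEN bspec, THEN bspec, THEN mp]
  define W where "W = {w \<in> abs_gal. \<forall>i\<in>{1..5}. w (\<beta> i) = \<beta> i}"
  define Orb where "Orb = (\<lambda>w. w \<theta>) ` W"
  define T where "T = {s \<theta> | s. s \<in> abs_gal}"
  define N where "N A = (\<Prod>z\<in>A. [:- z, 1:])" for A :: "'m alg_closure set"
  have finT: "finite T" using fin by (simp add: T_def)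
  have WG: "w \<in> abs_gal" if "w \<in> W" for w using that by (simp add: W_def)
  have sO: "s ` Orb \<subseteq> T" if "s \<in> abs_gal" for s
  proof
    fix x assume "x \<in> s ` Orb"
    then obtain w where "w \<in> W" "x = (s \<circ> w) \<theta>" by (auto simp: Orb_def)
    then show "x \<in> T" unfolding T_def using abs_gal_comp[OF that WG] by blast
  qed
  have O: "Orb \<subseteq> T" using sO[OF abs_gal_id] by simp
  then have finO: "finite Orb" using finT finite_subset by blast
  have roots_N: "{x. poly (N A) x = 0} = A" if "A \<subseteq> T" for A
    using finite_subset[OF that finT] by (auto simp: N_def poly_prod)
  \<comment> \<open>\<open>N A\<close> has root set \<open>A\<close>, so different subsets of
    \<open>T\<close> give different polynomials, and one base element \<open>u\<close> can separate
    all their values at once.\<close>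
  let ?\<P> = "{N A - N B | A B. A \<subseteq> T \<and> B \<subseteq> T \<and> A \<noteq> B}"
  have "?\<P> \<subseteq> (\<lambda>(A, B). N A - N B) ` (Pow T \<times> Pow T)" by auto
  then have fin\<P>: "finite ?\<P>" by (rule finite_subset) (use finT in auto)
  have N0: "N A - N B \<noteq> 0" if "A \<subseteq> T" "B \<subseteq> T" "A \<noteq> B" for A B
    using roots_N that by (metis eq_iff_diff_eq_0)
  have "d \<noteq> 0" if "d \<in> ?\<P>" for d using that by (elim CollectE exE conjE) (simp only: N0 not_False_eq_True)
  from base_avoids_roots[OF inf fin\<P> this] obtain u :: 'm where u: "\<forall>g\<in>?\<P>. poly g (to_ac u) \<noteq> 0" by blast
  define \<eta> where "\<eta> = poly (N Orb) (to_ac u)"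
  have s\<eta>: "s \<eta> = poly (N (s ` Orb)) (to_ac u)" if s: "s \<in> abs_gal" for s
  proof -
    have "inj_on s Orb" using abs_gal_inj[OF s] by (rule inj_on_subset) auto
    then show ?thesis
      by (simp add: \<eta>_def N_def poly_prod abs_gal_prod[OF s] abs_gal_simps[OF s] prod.reindex)
  qed
  have fixed: "w \<eta> = \<eta>" if w: "w \<in> W" for w
  proof -
    have "w ` Orb \<subseteq> Orb"
    proof
      fix x assume "x \<in> w ` Orb"
      then obtain w' where "w' \<in> W" "x = (w \<circ> w') \<theta>" by (auto simp: Orb_def)
      moreover from this have "w \<circ> w' \<in> W" using w abs_gal_comp by (auto simp: W_def)
      ultimately show "x \<in> Orb" unfolding Orb_def by blast
    qed
    then have "w ` Orb = Orb"
      by (rule endo_inj_surj[OF finO]) (rule inj_on_subset[OF abs_gal_inj[OF WG[OF w]]], simp)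
    then show ?thesis using s\<eta>[OF WG[OF w]] by (simp add: \<eta>_def)
  qed
  have int: "intermediate (Spl p)" unfolding Spl_eq_field_hull by (rule field_hull_intermediate)
  have "\<eta> \<in> Spl p"
  proof -
    have "z \<in> Spl p" if "z \<in> Orb" for z
      using that abs_gal_Spl[OF WG] \<theta> unfolding Orb_def by blast
    then have "(\<Prod>z\<in>Orb. to_ac u - z) \<in> Spl p"
      by (intro intermediate_prod[OF int] intermediateD(1,8)[OF int])
    then show ?thesis by (simp add: \<eta>_def N_def poly_prod)
  qed
  moreover have "\<exists>w\<in>W. \<forall>i\<in>{1..5}. s (\<alpha> i) = t (w (\<alpha> i))"
    if st: "s \<in> abs_gal" "t \<in> abs_gal" "s \<eta> = t \<eta>" for s t
  proof -
    have "s ` Orb = t ` Orb"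
      using u s\<eta>[OF st(1)] s\<eta>[OF st(2)] st(3) sO[OF st(1)] sO[OF st(2)]
      by (smt (verit) mem_Collect_eq poly_diff right_minus_eq)
    \<comment> \<open>As \<open>\<theta>\<close> lies in \<open>Orb\<close>, equality of the two
      image orbits makes \<open>s \<theta>\<close> equal to \<open>t (w \<theta>)\<close> for some
      \<open>w\<close> in \<open>W\<close>; and \<open>\<theta>\<close> determines the action on
      every root.\<close>
    moreover have "id \<in> W" using abs_gal_id by (simp add: W_def)
    then have "\<theta> \<in> Orb" unfolding Orb_def by (metis id_apply imageI)
    ultimately have "s \<theta> \<in> t ` Orb" by blast
    then obtain w where w: "w \<in> W" "s \<theta> = (t \<circ> w) \<theta>" by (auto simp: Orb_def)
    then have "\<forall>i\<in>{1..5}. s (\<alpha> i) = (t \<circ> w) (\<alpha> i)" by (intro sep st(1) abs_gal_comp[OF st(2)] WG) auto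
    then show ?thesis using w by auto
  qed
  ultimately show ?thesis using fixed unfolding W_def by blast
qed

text \<open>The intersection is generated by the norm \<open>\<eta>\<close>, so its degree is the
  number of conjugates of \<open>\<eta>\<close>. That number is the index in the first Galois group
  of the kernel \<open>K\<close> of the second projection, while the joint group has
  \<open>card K\<close> elements over each element of the second Galois group. Eliminating
  \<open>card K\<close> gives the product formula.\<close>

lemma degree_intersection:
  assumes inf: "infinite (UNIV :: 'm set)"
  shows "\<exists>n. ext_degree (Spl p \<inter> Spl q) n \<and>
           n * card (carrier (perm_gal2 \<alpha> p \<beta> q)) = card (carrier (perm_gal \<alpha> p)) * card (carrier (perm_gal \<beta> q)) \<and>
           (n = 1 \<longrightarrow> Spl p \<inter> Spl q = base_field)"
proof -
  obtain \<eta> where \<eta>: "\<eta> \<in> Spl p" and fixed: "\<forall>w\<in>abs_gal. (\<forall>i\<in>{1..5}. w (\<beta> i) = \<beta> i) \<longrightarrow> w \<eta> = \<eta>"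
    and sep: "\<forall>s\<in>abs_gal. \<forall>t\<in>abs_gal. s \<eta> = t \<eta> \<longrightarrow>
       (\<exists>w\<in>abs_gal. (\<forall>i\<in>{1..5}. w (\<beta> i) = \<beta> i) \<and> (\<forall>i\<in>{1..5}. s (\<alpha> i) = t (w (\<alpha> i))))"
    using intersection_generator[OF inf] by (elim bexE conjE)
  note fixed = fixed[THEN bspec, THEN mp] and sep = sep[THEN bspec, THEN bspec, THEN mp]
  note int = field_hull_intermediate
  have intp: "intermediate (Spl p)" and intq: "intermediate (Spl q)"
    unfolding Spl_eq_field_hull by (rule int)+
  have \<eta>q: "\<eta> \<in> Spl q" by (rule in_Spl_if_fixed[OF \<eta>]) (rule fixed)
  note ext = simple_ext(1-3)[OF intermediate_base, of \<eta>]
  have agree: "s x = t x" if "s \<in> abs_gal" "t \<in> abs_gal" "\<forall>i\<in>{1..5}. s (\<alpha> i) = t (\<alpha> i)" "x \<in> Spl p" for s t x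
    using abs_gal_agree_field_hull[OF that(1,2), of "\<alpha> ` {1..5}" x] that(3,4) unfolding P.Spl_eq by auto
  have F: "Spl p \<inter> Spl q = simple_ext base_field \<eta>"
  proof
    show "simple_ext base_field \<eta> \<subseteq> Spl p \<inter> Spl q"
      using simple_ext(4)[OF intermediate_base intp _ \<eta>] simple_ext(4)[OF intermediate_base intq _ \<eta>q]
        intp intq by (auto simp: intermediate_def)
    show "Spl p \<inter> Spl q \<subseteq> simple_ext base_field \<eta>"
    proof
      fix x assume x: "x \<in> Spl p \<inter> Spl q"
      show "x \<in> simple_ext base_field \<eta>"
      proof (rule fixed_in_base[of "\<alpha> ` {1..5}"])
        show "x \<in> field_hull (simple_ext base_field \<eta> \<union> \<alpha> ` {1..5})"
          using x field_hull_mono[of "\<alpha> ` {1..5}" "simple_ext base_field \<eta> \<union> \<alpha> ` {1..5}"] unfolding P.Spl_eq by blast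
        show "separable_over (simple_ext base_field \<eta>) a" if "a \<in> \<alpha> ` {1..5}" for a
          using P.separable[OF ext(1) that] .
        fix s :: "'m alg_closure \<Rightarrow> 'm alg_closure"
        assume s: "s \<in> abs_gal" "\<And>e. e \<in> simple_ext base_field \<eta> \<Longrightarrow> s e = e"
        then have "s \<eta> = id \<eta>" using ext(3) by simp
        from sep[OF s(1) abs_gal_id this] obtain w where
          w: "w \<in> abs_gal" "\<forall>i\<in>{1..5}. w (\<beta> i) = \<beta> i" "\<forall>i\<in>{1..5}. s (\<alpha> i) = w (\<alpha> i)" by auto
        then have "s x = w x" using agree[OF s(1) w(1)] x by blast
        also have "\<dots> = x" using fixes_Spl_iff(2)[OF w(1)] w(2) x by blast
        finally show "s x = x" .
      qed (auto intro: ext)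
    qed
  qed
  \<comment> \<open>The set of conjugates of \<open>\<eta>\<close>, a finite set permuted by every
    automorphism.\<close>
  define C where "C = (\<lambda>s. s \<eta>) ` abs_gal"
  obtain r where r: "r \<noteq> 0" "poly (map_poly to_ac r) \<eta> = 0" using alg_closure_algebraic by blast
  have "C \<subseteq> {x. poly (map_poly to_ac r) x = 0}" using abs_gal_root r unfolding C_def by blast
  then have finC: "finite C"
    by (rule finite_subset) (use r in \<open>auto intro!: poly_roots_finite simp: map_poly_eq_0_iff\<close>)
  have permC: "s ` C = C" if s: "s \<in> abs_gal" for s
  proof (rule endo_inj_surj[OF finC])
    show "inj_on s C" by (rule inj_on_subset[OF abs_gal_inj[OF s]]) simp
    show "s ` C \<subseteq> C"
    proof
      fix x assume "x \<in> s ` C"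
      then obtain t where "t \<in> abs_gal" "x = (s \<circ> t) \<eta>" by (auto simp: C_def)
      then show "x \<in> C" unfolding C_def using abs_gal_comp[OF s] by blast
    qed
  qed
  obtain m where m: "min_poly_over base_field \<eta> m" using min_poly_over_exists[OF intermediate_base] by blast
  \<comment> \<open>The product over the conjugates has base coefficients and vanishes at
    \<open>\<eta>\<close>, which bounds the degree of \<open>m\<close> from above by
    \<open>card C\<close>. Conversely every conjugate is a root of \<open>m\<close>.\<close>
  have "\<exists>c. map_poly to_ac c = (\<Prod>z\<in>C. [:- z, 1:])"
  proof (rule resolvent_descends[OF finC, of "\<alpha> ` {1..5}"])
    show "separable_over base_field a" if "a \<in> \<alpha> ` {1..5}" for a
      using P.separable[OF intermediate_base that] .
    show "z \<in> field_hull (\<alpha> ` {1..5})" if "z \<in> C" for z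
      using that abs_gal_Spl \<eta> unfolding C_def P.Spl_eq[symmetric] by blast
    show "\<exists>\<pi>. bij_betw \<pi> C C \<and> (\<forall>i\<in>C. s i = \<pi> i)" if "s \<in> abs_gal" for s
      using permC[OF that] inj_on_subset[OF abs_gal_inj[OF that]] by (intro exI[of _ s]) (auto simp: bij_betw_def)
  qed simp
  then obtain c where c: "map_poly to_ac c = (\<Prod>z\<in>C. [:- z, 1:])" by blast
  have "\<eta> \<in> C" unfolding C_def using abs_gal_id by (metis id_apply imageI)
  then have "poly (map_poly to_ac c) \<eta> = 0" unfolding c using finC by (auto simp: poly_prod)
  moreover have "(\<Prod>z\<in>C. [:- z, 1:]) \<noteq> 0" using finC by (auto simp: prod_zero_iff)
  ultimately have "Polynomial.degree m \<le> Polynomial.degree (\<Prod>z\<in>C. [:- z, 1:])"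
    using m coeffs_in_map_poly_to_ac[OF intermediate_base, of c] unfolding min_poly_over_def c by blast
  also have "\<dots> = card C" by (subst degree_prod_eq_sum_degree) auto
  finally have le: "Polynomial.degree m \<le> card C" .
  have "C \<subseteq> {x. poly m x = 0}"
  proof
    fix x assume "x \<in> C"
    then obtain s where s: "s \<in> abs_gal" "x = s \<eta>" by (auto simp: C_def)
    have "s (poly m \<eta>) = poly m (s \<eta>)"
      by (rule abs_gal_poly_fixed[OF s(1) min_poly_overD(1)[OF m]]) (auto simp: abs_gal_simps[OF s(1)])
    then show "x \<in> {x. poly m x = 0}" using s min_poly_overD(3)[OF m] abs_gal_simps(4)[OF s(1)] by simp
  qed
  then have "card C \<le> card {x. poly m x = 0}"
    by (intro card_mono poly_roots_finite min_poly_overD(4)[OF m])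
  also have "\<dots> \<le> Polynomial.degree m" by (rule card_poly_roots_bound[OF min_poly_overD(4)[OF m]])
  finally have degm: "Polynomial.degree m = card C" using le by simp
  have dim: "ext_degree (Spl p \<inter> Spl q) (card C)"
    using dimension_simple_ext[OF intermediate_base m] unfolding F degm .
  have one: "Spl p \<inter> Spl q = base_field" if card1: "card C = 1"
  proof -
    have "simple_ext base_field \<eta> = base_field"
    proof
      show "simple_ext base_field \<eta> \<subseteq> base_field"
      proof
        fix x assume "x \<in> simple_ext base_field \<eta>"
        then obtain g where g: "x = poly g \<eta>" "coeffs_in base_field g" "Polynomial.degree g < 1"
          unfolding simple_ext_eq_lower_degree[OF intermediate_base m] degm card1 by blast
        then obtain c where "g = [:c:]" by (metis degree_eq_zeroE less_one)
        then show "x \<in> base_field" using g by (auto simp: coeffs_in_pCons)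
      qed
    qed (rule ext(2))
    then show ?thesis using F by simp
  qed
  let ?G = "carrier (perm_gal2 \<alpha> p \<beta> q)" let ?A = "carrier (perm_gal \<alpha> p)" let ?B = "carrier (perm_gal \<beta> q)"
  \<comment> \<open>Viewed in the first Galois group, this is the group of permutations induced by
    automorphisms fixing \<open>Spl q\<close>. Its left translates are the fibres both of the second
    projection and of evaluation at \<open>\<eta>\<close>.\<close>
  define K where "K = {g. (g, id) \<in> ?G}"
  have KA: "K \<subseteq> ?A" unfolding K_def fst_perm_gal2[symmetric] by force
  have finA: "finite ?A" using finite_perm_gal2 unfolding fst_perm_gal2[symmetric] by simp
  have bijA: "bij g" if "g \<in> ?A" for g using that P.perm_gal_iff permutes_bij by blast
  have inv_ex: "\<exists>g' h'. (g', h') \<in> ?G \<and> g' \<circ> g = id \<and> h' \<circ> h = id \<and> g \<circ> g' = id" if gh: "(g, h) \<in> ?G" for g h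
  proof -
    have per: "g permutes {1..5}" "h permutes {1..5}" using gh unfolding perm_gal2_iff by blast+
    show ?thesis
      by (intro exI[of _ "inv' g"] exI[of _ "inv' h"] conjI perm_gal2_inv[OF gh] permutes_inv_o[OF per(1)] permutes_inv_o[OF per(2)])
  qed
  have cardG: "card ?G = card ?B * card K"
  proof -
    have "card {x \<in> ?G. snd x = snd a} = card K" if a: "a \<in> ?G" for a
    proof -
      obtain g h where gh: "a = (g, h)" by fastforce
      with a have gh_in: "(g, h) \<in> ?G" by simp
      obtain g' h' where g': "(g', h') \<in> ?G" "g' \<circ> g = id" "h' \<circ> h = id" "g \<circ> g' = id" using inv_ex[OF gh_in] by blast
      have "bij_betw (\<lambda>k. (g \<circ> k, h)) K {x \<in> ?G. snd x = snd a}"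
        unfolding bij_betw_def
      proof (intro conjI equalityI subsetI inj_onI)
        fix k l assume "(g \<circ> k, h) = (g \<circ> l, h)"
        then have "(g' \<circ> g) \<circ> k = (g' \<circ> g) \<circ> l" by (simp add: comp_assoc)
        then show "k = l" using g' by simp
      next
        fix x assume "x \<in> (\<lambda>k. (g \<circ> k, h)) ` K"
        then show "x \<in> {x \<in> ?G. snd x = snd a}" using perm_gal2_comp[OF gh_in, of _ id] gh by (auto simp: K_def)
      next
        fix x assume "x \<in> {x \<in> ?G. snd x = snd a}"
        then obtain l where l: "x = (l, h)" "(l, h) \<in> ?G" using gh by (cases x) auto
        then have "g' \<circ> l \<in> K" using perm_gal2_comp[OF g'(1), of l h] g'(3) by (auto simp: K_def)
        moreover have "l = g \<circ> (g' \<circ> l)" using g'(4) by (simp add: comp_assoc[symmetric])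
        ultimately show "x \<in> (\<lambda>k. (g \<circ> k, h)) ` K" unfolding l(1) by (metis imageI)
      qed
      then show ?thesis by (rule bij_betw_same_card[symmetric])
    qed
    from card_eq_card_image_times_fiber[OF finite_perm_gal2 this] show ?thesis by (simp add: snd_perm_gal2)
  qed
  have cardA: "card ?A = card C * card K"
  proof -
    \<comment> \<open>An automorphism realising \<open>g\<close> is chosen arbitrarily; its value at
      \<open>\<eta>\<close> depends only on \<open>g\<close>, since \<open>\<eta>\<close> lies in
      \<open>Spl p\<close>.\<close>
    define lift where "lift g = (SOME s. s \<in> abs_gal \<and> (\<forall>i\<in>{1..5}. s (\<alpha> i) = \<alpha> (g i)))" for g
    have lift: "lift g \<in> abs_gal \<and> (\<forall>i\<in>{1..5}. lift g (\<alpha> i) = \<alpha> (g i))" if "g \<in> ?A" for g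
    proof -
      from that have "\<exists>s. s \<in> abs_gal \<and> (\<forall>i\<in>{1..5}. s (\<alpha> i) = \<alpha> (g i))"
        unfolding P.perm_gal_iff by (elim conjE bexE) (rule exI, rule conjI)
      then show ?thesis unfolding lift_def by (rule someI_ex)
    qed
    have img: "(\<lambda>g. lift g \<eta>) ` ?A = C"
    proof (intro equalityI subsetI)
      fix x assume "x \<in> C"
      then obtain s where s: "s \<in> abs_gal" "x = s \<eta>" by (auto simp: C_def)
      obtain g where g: "g permutes {1..5}" "\<forall>i\<in>{1..5}. s (\<alpha> i) = \<alpha> (g i)" using P.perm_exists[OF s(1)] by blast
      then have gA: "g \<in> ?A" unfolding P.perm_gal_iff by (intro conjI bexI[OF _ s(1)]) auto
      then have "x = lift g \<eta>" using agree[of s "lift g" \<eta>] lift[OF gA] g s \<eta> by metis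
      then show "x \<in> (\<lambda>g. lift g \<eta>) ` ?A" using gA by blast
    qed (use lift in \<open>auto simp: C_def\<close>)
    have "card {x \<in> ?A. lift x \<eta> = lift g \<eta>} = card K" if gA: "g \<in> ?A" for g
    proof -
      have g_per: "g permutes {1..5}" using gA P.perm_gal_iff by blast
      have "bij_betw (\<lambda>k. g \<circ> k) K {x \<in> ?A. lift x \<eta> = lift g \<eta>}"
        unfolding bij_betw_def
      proof (intro conjI equalityI subsetI inj_onI)
        fix k l assume "g \<circ> k = g \<circ> l"
        then show "k = l" using bijA[OF gA] by (metis bij_is_inj fun.inj_map_strong inj_eq comp_apply ext)
      next
        fix x assume "x \<in> (\<lambda>k. g \<circ> k) ` K"
        then obtain k where k: "(k, id) \<in> ?G" "x = g \<circ> k" by (auto simp: K_def)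
        then obtain w where w: "w \<in> abs_gal" "\<forall>i\<in>{1..5}. w (\<alpha> i) = \<alpha> (k i) \<and> w (\<beta> i) = \<beta> i" "k permutes {1..5}"
          unfolding perm_gal2_iff by auto
        have lw: "lift g \<circ> w \<in> abs_gal" using lift[OF gA] w abs_gal_comp by blast
        have lwx: "\<forall>i\<in>{1..5}. (lift g \<circ> w) (\<alpha> i) = \<alpha> (x i)"
        proof
          fix i :: nat assume i: "i \<in> {1..5}"
          then have "k i \<in> {1..5}" using permutes_in_image[OF w(3)] by blast
          then show "(lift g \<circ> w) (\<alpha> i) = \<alpha> (x i)" using lift[OF gA] w(2) i k(2) by (metis comp_apply)
        qed
        have xA: "x \<in> ?A" unfolding P.perm_gal_iff
          by (intro conjI bexI[OF _ lw] lwx) (use permutes_compose[OF w(3) g_per] k(2) in simp)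
        have "lift x \<eta> = (lift g \<circ> w) \<eta>"
          using agree[of "lift x" "lift g \<circ> w" \<eta>] lift[OF xA] lw lwx \<eta> by metis
        also have "\<dots> = lift g \<eta>" using fixed[OF w(1)] w(2) by simp
        finally show "x \<in> {x \<in> ?A. lift x \<eta> = lift g \<eta>}" using xA by simp
      next
        fix x assume "x \<in> {x \<in> ?A. lift x \<eta> = lift g \<eta>}"
        then have xA: "x \<in> ?A" and eq: "lift x \<eta> = lift g \<eta>" by auto
        obtain w where w: "w \<in> abs_gal" "\<forall>i\<in>{1..5}. w (\<beta> i) = \<beta> i" "\<forall>i\<in>{1..5}. lift x (\<alpha> i) = lift g (w (\<alpha> i))"
          using sep[OF conjunct1[OF lift[OF xA]] conjunct1[OF lift[OF gA]] eq] by (elim bexE conjE)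
        obtain k where k: "k permutes {1..5}" "\<forall>i\<in>{1..5}. w (\<alpha> i) = \<alpha> (k i)" using P.perm_exists[OF w(1)] by blast
        have "(k, id) \<in> ?G" unfolding perm_gal2_iff
          by (intro conjI bexI[OF _ w(1)] ballI) (use w k in \<open>auto simp: permutes_id\<close>)
        moreover have "x = g \<circ> k"
        proof (rule P.perm_unique)
          show "x permutes {1..5}" using xA P.perm_gal_iff by blast
          show "g \<circ> k permutes {1..5}" by (rule permutes_compose[OF k(1) g_per])
          fix i :: nat assume i: "i \<in> {1..5}"
          then have "k i \<in> {1..5}" using permutes_in_image[OF k(1)] by blast
          then show "\<alpha> (x i) = \<alpha> ((g \<circ> k) i)" using lift[OF xA] lift[OF gA] w(3) k(2) i by (metis comp_apply)
        qed
        ultimately show "x \<in> (\<lambda>k. g \<circ> k) ` K" by (auto simp: K_def)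
      qed
      then show ?thesis by (rule bij_betw_same_card[symmetric])
    qed
    from card_eq_card_image_times_fiber[OF finA this] show ?thesis by (simp only: img)
  qed
  have "card C * card ?G = card ?A * card ?B" unfolding cardA cardG by simp
  then show ?thesis using dim one by blast
qed

end

section \<open>Affine permutations of five points\<close>

text \<open>Representative of a residue class modulo 5 in the range 1 to 5, so that the point 5
  plays the role of 0.\<close>

definition res5 :: "int \<Rightarrow> nat" where "res5 a = nat ((a - 1) mod 5) + 1"

definition aff :: "int \<Rightarrow> int \<Rightarrow> nat \<Rightarrow> nat" where
  "aff u b x = (if 1 \<le> x \<and> x \<le> 5 then res5 (u * int x + b) else x)"

lemma res5_bounds: "1 \<le> res5 a" "res5 a \<le> 5"
proof -
  have "(a - 1) mod 5 < 5" by simp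
  then show "1 \<le> res5 a" "res5 a \<le> 5" by (auto simp: res5_def)
qed

lemma res5_mod: "int (res5 a) mod 5 = a mod 5"
proof -
  have "int (res5 a) = (a - 1) mod 5 + 1" by (simp add: res5_def)
  then show ?thesis by (simp add: mod_simps)
qed

lemma res5_eq_iff: "res5 a = res5 b \<longleftrightarrow> a mod 5 = b mod 5"
proof
  assume "res5 a = res5 b" then show "a mod 5 = b mod 5" using res5_mod by metis
next
  assume "a mod 5 = b mod 5"
  then have "(a - 1) mod 5 = (b - 1) mod 5" by (metis mod_diff_left_eq)
  then show "res5 a = res5 b" by (simp add: res5_def)
qed

lemma aff_comp: "aff u b \<circ> aff v c = aff (u * v) (b + u * c)"
proof
  fix x
  show "(aff u b \<circ> aff v c) x = aff (u * v) (b + u * c) x"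
  proof (cases "1 \<le> x \<and> x \<le> 5")
    case True
    let ?y = "res5 (v * int x + c)"
    have "(u * int ?y + b) mod 5 = (u * (v * int x + c) + b) mod 5"
      using res5_mod[of "v * int x + c"] by (metis mod_add_left_eq mod_mult_right_eq)
    also have "u * (v * int x + c) + b = u * v * int x + (b + u * c)" by (simp add: algebra_simps)
    finally show ?thesis using True res5_bounds[of "v * int x + c"] by (simp add: aff_def res5_eq_iff)
  qed (auto simp: aff_def)
qed

lemma aff_eq_iff: "aff u b = aff v c \<longleftrightarrow> u mod 5 = v mod 5 \<and> b mod 5 = c mod 5"
proof
  assume eq: "aff u b = aff v c"
  \<comment> \<open>The point 5 stands for 0 and isolates the offset; the point 1 yields the
    scaling.\<close>
  have "aff u b 5 = aff v c 5" using eq by simp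
  then have "(u * 5 + b) mod 5 = (v * 5 + c) mod 5" by (simp add: aff_def res5_eq_iff)
  then have b: "b mod 5 = c mod 5" by simp
  have "aff u b 1 = aff v c 1" using eq by simp
  then have "(u + b) mod 5 = (v + c) mod 5" by (simp add: aff_def res5_eq_iff)
  then have "(u + b - b) mod 5 = (v + c - c) mod 5" using b by (rule mod_diff_cong)
  then show "u mod 5 = v mod 5 \<and> b mod 5 = c mod 5" using b by simp
next
  assume *: "u mod 5 = v mod 5 \<and> b mod 5 = c mod 5"
  then have "(u * int x + b) mod 5 = (v * int x + c) mod 5" for x
    by (metis mod_add_cong mod_mult_cong)
  then show "aff u b = aff v c" by (auto simp: aff_def fun_eq_iff res5_eq_iff)
qed

lemma aff_mod [simp]: "aff (u mod 5) b = aff u b" "aff u (b mod 5) = aff u b"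
  by (simp_all add: aff_eq_iff)

lemma aff_id: "aff 1 0 = id"
proof
  fix x show "aff 1 0 x = id x"
  proof (cases "1 \<le> x \<and> x \<le> 5")
    case True
    then have "x \<in> {1, 2, 3, 4, 5}" by auto
    then show ?thesis by (auto simp: aff_def res5_def)
  qed (auto simp: aff_def)
qed

lemma aff_apply: "1 \<le> x \<Longrightarrow> x \<le> 5 \<Longrightarrow> aff u b x = res5 (u * int x + b)"
  by (simp add: aff_def)

abbreviation units5 :: "int set" where "units5 \<equiv> {1, 2, 3, 4}"

lemma units5_fourth_power: "u \<in> units5 \<Longrightarrow> u ^ 3 * u mod 5 = 1"
  by auto

lemma units5_mod: assumes "u mod 5 \<noteq> (0 :: int)" shows "u mod 5 \<in> units5"
proof -
  have "0 \<le> u mod 5" "u mod 5 < 5" by simp_all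
  then have "u mod 5 \<in> {0, 1, 2, 3, 4}" by auto
  then show ?thesis using assms by auto
qed

lemma units5_mult: "u \<in> units5 \<Longrightarrow> v \<in> units5 \<Longrightarrow> u * v mod 5 \<in> units5"
  by auto

text \<open>Units satisfy \<open>u ^ 4 mod 5 = 1\<close>, so \<open>u ^ 3\<close> serves as the
  inverse of \<open>u\<close> throughout, without any division.\<close>

lemma aff_inverse:
  assumes "u \<in> units5"
  shows "aff (u ^ 3) (- (u ^ 3) * b) \<circ> aff u b = id" "aff u b \<circ> aff (u ^ 3) (- (u ^ 3) * b) = id"
proof -
  have "(b + u * (- (u ^ 3) * b)) = b * (1 - u ^ 3 * u)" by (simp add: algebra_simps)
  moreover have "(1 - u ^ 3 * u) mod 5 = 0" using assms by auto
  ultimately have "(b + u * (- (u ^ 3) * b)) mod 5 = 0 mod 5" by (metis mod_0 mod_mult_right_eq mult_zero_right)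
  then show "aff u b \<circ> aff (u ^ 3) (- (u ^ 3) * b) = id"
    using units5_fourth_power[OF assms] by (simp add: aff_comp aff_eq_iff mult.commute flip: aff_id)
  show "aff (u ^ 3) (- (u ^ 3) * b) \<circ> aff u b = id"
    using units5_fourth_power[OF assms] by (simp add: aff_comp aff_eq_iff flip: aff_id)
qed

lemma aff_permutes: assumes "u \<in> units5" shows "aff u b permutes {1..5}"
proof -
  have "bij (aff u b)" using aff_inverse[OF assms] by (metis o_bij)
  then show ?thesis unfolding permutes_def by (auto simp: aff_def bij_iff)
qed

lemma inv_aff: "u \<in> units5 \<Longrightarrow> inv' (aff u b) = aff (u ^ 3) (- (u ^ 3) * b)"
  by (metis aff_inverse inv_unique_comp)

definition Aff :: "int set \<Rightarrow> (nat \<Rightarrow> nat) set" where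
  "Aff P = {aff u b | u b. u \<in> P}"

lemma Aff_iff: "P \<subseteq> units5 \<Longrightarrow> u \<in> units5 \<Longrightarrow> aff u b \<in> Aff P \<longleftrightarrow> u \<in> P"
  unfolding Aff_def aff_eq_iff by (auto simp: aff_eq_iff)

text \<open>All subgroups of the cyclic group of units modulo 5, listed outright so that questions
  about them become finite evaluations. Their affine groups are C5, D5 and F20.\<close>

definition unit_subgroup :: "int set \<Rightarrow> bool" where
  "unit_subgroup P \<longleftrightarrow> P = {1} \<or> P = {1, 4} \<or> P = {1, 2, 3, 4}"

lemma unit_subgroupD:
  assumes "unit_subgroup P"
  shows "P \<subseteq> units5" "1 \<in> P" "u \<in> P \<Longrightarrow> v \<in> P \<Longrightarrow> u * v mod 5 \<in> P" "u \<in> P \<Longrightarrow> u ^ 3 mod 5 \<in> P"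
  using assms by (auto simp: unit_subgroup_def)

lemma S5_simps [simp]:
  "carrier S5 = {g. g permutes {1..5}}" "g \<otimes>\<^bsub>S5\<^esub> h = g \<circ> h" "\<one>\<^bsub>S5\<^esub> = id"
  by (simp_all add: sym_group_def)

lemma group_S5: "group S5" by (rule sym_group_is_group)

lemma inv_S5: assumes "g permutes {1..5}" shows "inv\<^bsub>S5\<^esub> g = inv' g"
proof -
  interpret group S5 by (rule group_S5)
  show ?thesis
    by (rule inv_equality) (use assms permutes_inv permutes_inv_o[OF assms] in auto)
qed

lemma subgroup_Aff: assumes P: "unit_subgroup P" shows "subgroup (Aff P) S5"
proof -
  interpret group S5 by (rule group_S5)
  note PD = unit_subgroupD[OF P]
  show ?thesis
  proof (rule subgroupI)
    show "Aff P \<subseteq> carrier S5" using PD aff_permutes by (auto simp: Aff_def)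
    show "Aff P \<noteq> {}" using PD by (auto simp: Aff_def)
    fix g assume "g \<in> Aff P"
    then obtain u b where g: "g = aff u b" "u \<in> P" by (auto simp: Aff_def)
    then have u: "u \<in> units5" using PD by blast
    have "inv\<^bsub>S5\<^esub> g = aff (u ^ 3 mod 5) (- (u ^ 3) * b)"
      using inv_S5[OF aff_permutes[OF u]] inv_aff[OF u] g by simp
    then show "inv\<^bsub>S5\<^esub> g \<in> Aff P" using PD(4)[OF g(2)] unfolding Aff_def by blast
  next
    fix g h assume "g \<in> Aff P" "h \<in> Aff P"
    then obtain u b v c where "g = aff u b" "h = aff v c" "u \<in> P" "v \<in> P" by (auto simp: Aff_def)
    then have "g \<otimes>\<^bsub>S5\<^esub> h = aff (u * v mod 5) (b + u * c)" "u * v mod 5 \<in> P" using PD by (auto simp: aff_comp)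
    then show "g \<otimes>\<^bsub>S5\<^esub> h \<in> Aff P" unfolding Aff_def by blast
  qed
qed

lemma sigma5_eq_aff: "sigma5 = aff 1 1"
proof
  fix x
  show "sigma5 x = aff 1 1 x"
  proof (cases "x \<in> {1, 2, 3, 4, 5}")
    case True
    then show ?thesis by (auto simp: sigma5_def aff_def res5_def Transposition.transpose_def)
  next
    case False
    then have "sigma5 x = x" unfolding sigma5_def by (intro id_outside_supp) auto
    then show ?thesis using False by (auto simp: aff_def)
  qed
qed

lemma rho5_eq_aff: "rho5 = aff 2 0"
proof
  fix x
  show "rho5 x = aff 2 0 x"
  proof (cases "x \<in> {1, 2, 3, 4, 5}")
    case True
    then show ?thesis by (auto simp: rho5_def aff_def res5_def Transposition.transpose_def)
  next
    case False
    then have "rho5 x = x" unfolding rho5_def by (intro id_outside_supp) auto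
    then show ?thesis using False by (auto simp: aff_def)
  qed
qed

lemma tau5_eq_aff: "tau5 = aff 4 0"
  by (simp add: tau5_def rho5_eq_aff aff_comp)

text \<open>An affine map is a translation after a scaling; the translations are powers of
  \<open>aff 1 1\<close>, and the scalings in question are powers of \<open>aff u 0\<close> because
  \<open>u\<close> generates \<open>P\<close>.\<close>

lemma generate_aff:
  assumes P: "unit_subgroup P" and u: "u \<in> P" and gen: "\<And>v. v \<in> P \<Longrightarrow> \<exists>n::nat. u ^ n mod 5 = v"
  shows "generate S5 {aff 1 1, aff u 0} = Aff P"
proof -
  interpret group S5 by (rule group_S5)
  note PD = unit_subgroupD[OF P]
  have 1: "aff 1 1 \<in> Aff P" "aff u 0 \<in> Aff P" using PD(2) u by (auto simp: Aff_def)
  then have sub: "generate S5 {aff 1 1, aff u 0} \<subseteq> Aff P"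
    by (intro generate_subgroup_incl subgroup_Aff P) auto
  have id_gen: "id \<in> generate S5 {aff 1 1, aff u 0}"
    using generate.one[of S5 "{aff 1 1, aff u 0}"] by (simp only: S5_simps)
  have tr: "aff 1 (int n) \<in> generate S5 {aff 1 1, aff u 0}" for n
  proof (induction n)
    case 0
    show ?case using id_gen by (simp only: of_nat_0 power_0 aff_id)
  next
    case (Suc n)
    have "aff 1 1 \<otimes>\<^bsub>S5\<^esub> aff 1 (int n) \<in> generate S5 {aff 1 1, aff u 0}"
      by (intro generate.eng Suc generate.incl) simp
    then show ?case by (simp add: aff_comp add.commute)
  qed
  have sc: "aff (u ^ n) 0 \<in> generate S5 {aff 1 1, aff u 0}" for n
  proof (induction n)
    case 0
    show ?case using id_gen by (simp only: of_nat_0 power_0 aff_id)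
  next
    case (Suc n)
    have "aff u 0 \<otimes>\<^bsub>S5\<^esub> aff (u ^ n) 0 \<in> generate S5 {aff 1 1, aff u 0}"
      by (intro generate.eng Suc generate.incl) simp
    then show ?case by (simp add: aff_comp)
  qed
  have "Aff P \<subseteq> generate S5 {aff 1 1, aff u 0}"
  proof
    fix g assume "g \<in> Aff P"
    then obtain v b where g: "g = aff v b" "v \<in> P" by (auto simp: Aff_def)
    obtain n where n: "u ^ n mod 5 = v" using gen g by blast
    have "aff 1 (int (nat (b mod 5))) \<otimes>\<^bsub>S5\<^esub> aff (u ^ n) 0 \<in> generate S5 {aff 1 1, aff u 0}"
      by (intro generate.eng tr sc)
    moreover have "aff 1 (int (nat (b mod 5))) \<otimes>\<^bsub>S5\<^esub> aff (u ^ n) 0 = g"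
      using n g by (auto simp: aff_comp aff_eq_iff)
    ultimately show "g \<in> generate S5 {aff 1 1, aff u 0}" by simp
  qed
  with sub show ?thesis by blast
qed

lemma F20_eq: "F20 = S5\<lparr>carrier := Aff {1, 2, 3, 4}\<rparr>"
proof -
  have "generate S5 {aff 1 1, aff 2 0} = Aff {1, 2, 3, 4}"
  proof (rule generate_aff)
    show "\<exists>n::nat. 2 ^ n mod 5 = v" if "v \<in> units5" for v
    proof -
      have "2 ^ 0 mod 5 = (1::int)" "2 ^ 1 mod 5 = (2::int)" "2 ^ 3 mod 5 = (3::int)" "2 ^ 2 mod 5 = (4::int)"
        by simp_all
      then show ?thesis using that by blast
    qed
  qed (auto simp: unit_subgroup_def)
  then show ?thesis by (simp add: F20_def sigma5_eq_aff rho5_eq_aff)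
qed

lemma D5_eq: "D5 = S5\<lparr>carrier := Aff {1, 4}\<rparr>"
proof -
  have "generate S5 {aff 1 1, aff 4 0} = Aff {1, 4}"
  proof (rule generate_aff)
    show "\<exists>n::nat. 4 ^ n mod 5 = v" if "v \<in> {1, 4}" for v :: int
    proof -
      have "4 ^ 0 mod 5 = (1::int)" "4 ^ 1 mod 5 = (4::int)" by simp_all
      then show ?thesis using that by blast
    qed
  qed (auto simp: unit_subgroup_def)
  then show ?thesis by (simp add: D5_def sigma5_eq_aff tau5_eq_aff)
qed

lemma C5_eq: "C5 = S5\<lparr>carrier := Aff {1}\<rparr>"
proof -
  interpret group S5 by (rule group_S5)
  \<comment> \<open>The identity is added as a second generator to bring this case under the same
    lemma.\<close>
  have "generate S5 {aff 1 1, aff 1 0} = Aff {1}"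
    by (rule generate_aff) (simp_all add: unit_subgroup_def)
  moreover have "generate S5 {aff 1 1, aff 1 0} = generate S5 {aff 1 1}"
  proof
    show "generate S5 {aff 1 1, aff 1 0} \<subseteq> generate S5 {aff 1 1}"
    proof (rule generate_subgroup_incl)
      show "subgroup (generate S5 {aff 1 1}) S5"
        by (rule generate_is_subgroup) (use aff_permutes[of 1 1] in simp)
      show "{aff 1 1, aff 1 0} \<subseteq> generate S5 {aff 1 1}"
        using generate.one[of S5 "{aff 1 1}"] generate.incl[of "aff 1 1" "{aff 1 1}" S5] by (simp add: aff_id)
    qed
  qed (rule mono_generate, simp)
  ultimately show ?thesis by (simp add: C5_def sigma5_eq_aff)
qed

lemma bij_betw_Aff: assumes "P \<subseteq> units5" shows "bij_betw (\<lambda>(u, b). aff u b) (P \<times> {0..4}) (Aff P)"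
proof -
  have "inj_on (\<lambda>(u, b). aff u b) (P \<times> {0..4})"
  proof (rule inj_onI, clarify)
    fix u b v c :: int
    assume "u \<in> P" "v \<in> P" and b: "b \<in> {0..4}" "c \<in> {0..4}" and eq: "aff u b = aff v c"
    then have "u \<in> units5" "v \<in> units5" using assms by auto
    then have "u mod 5 = u" "v mod 5 = v" "b mod 5 = b" "c mod 5 = c" using b by auto
    then show "u = v \<and> b = c" using eq by (metis aff_eq_iff)
  qed
  moreover have "(\<lambda>(u, b). aff u b) ` (P \<times> {0..4}) = Aff P"
  proof (intro equalityI subsetI)
    fix g assume "g \<in> Aff P"
    then obtain u b where g: "g = aff u (b mod 5)" "u \<in> P" by (auto simp: Aff_def)
    have "b mod 5 \<in> {0..4}" using pos_mod_bound[of 5 b] by auto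
    then show "g \<in> (\<lambda>(u, b). aff u b) ` (P \<times> {0..4})"
      by (intro image_eqI[of _ _ "(u, b mod 5)"]) (use g in simp_all)
  qed (auto simp: Aff_def)
  ultimately show ?thesis by (simp add: bij_betw_def)
qed

lemma card_Aff: "P \<subseteq> units5 \<Longrightarrow> card (Aff P) = 5 * card P"
  using bij_betw_same_card[OF bij_betw_Aff] by (simp add: card_cartesian_product mult.commute)

section \<open>Subdirect products of affine groups\<close>

lemma unit_subgroup_if_closed:
  assumes "W \<subseteq> units5" "1 \<in> W" "\<And>u v. u \<in> W \<Longrightarrow> v \<in> W \<Longrightarrow> u * v mod 5 \<in> W"
  shows "unit_subgroup W"
proof -
  have "2 \<in> W \<Longrightarrow> 4 \<in> W" "2 \<in> W \<Longrightarrow> 4 \<in> W \<Longrightarrow> 3 \<in> W" "3 \<in> W \<Longrightarrow> 4 \<in> W" "3 \<in> W \<Longrightarrow> 4 \<in> W \<Longrightarrow> 2 \<in> W"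
    using assms(3)[of 2 2] assms(3)[of 2 4] assms(3)[of 3 3] assms(3)[of 3 4] by simp_all
  moreover have "W = (if 1 \<in> W then {1} else {}) \<union> (if 2 \<in> W then {2} else {}) \<union> (if 3 \<in> W then {3} else {}) \<union> (if 4 \<in> W then {4} else {})"
    using assms(1) by auto
  ultimately show ?thesis using assms(2) unfolding unit_subgroup_def
    by (cases "2 \<in> W"; cases "3 \<in> W"; cases "4 \<in> W") auto
qed

text \<open>The fixed point 1 / (1 - u) of x \<mapsto> u x + 1 modulo 5 for \<open>u\<close> equal
  to 2, 3 or 4; the last branch is meant for 4.\<close>

definition fixed_pt :: "int \<Rightarrow> int" where
  "fixed_pt u = (if u = 2 then 4 else if u = 3 then 2 else 3)"

text \<open>With g(x) = u x + 1 and h(x) = v x + c, the number in the conclusion is the offset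
  between h g and g h. If it vanished, h would commute with g and preserve its only fixed point,
  whereas here h moves that point by 1.\<close>

lemma displaced_commutator:
  "\<forall>u\<in>{2, 3, 4}. \<forall>v\<in>units5. \<forall>c\<in>{0, 1, 2, 3, 4}.
     (v * fixed_pt u + c) mod 5 = (fixed_pt u + 1) mod 5 \<longrightarrow> (v - 1 + c * (1 - u)) mod 5 \<noteq> 0"
  by code_simp

text \<open>A nonzero residue generates the additive group modulo 5. Stated for a predicate so that
  it applies to either component of a pair of translations.\<close>

lemma translation_generates:
  assumes t: "t mod 5 \<noteq> (0 :: int)" "Pred t" and add: "\<And>a b. Pred a \<Longrightarrow> Pred b \<Longrightarrow> Pred (a + b)"
    and cong: "\<And>a b. a mod 5 = b mod 5 \<Longrightarrow> Pred a \<Longrightarrow> Pred b"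
  shows "Pred b"
proof -
  have mult: "Pred (int (Suc n) * t)" for n
  proof (induction n)
    case (Suc n)
    have "int (Suc (Suc n)) * t = t + int (Suc n) * t" by (simp add: algebra_simps)
    then show ?case using add[OF t(2) Suc] by simp
  qed (use t in simp)
  define u where "u = t mod 5"
  have u: "u \<in> units5" unfolding u_def by (rule units5_mod[OF t(1)])
  \<comment> \<open>Subtracting 1 here makes \<open>Suc n\<close> a positive multiplier congruent to
    \<open>u ^ 3 * b\<close>; only sums of copies of \<open>t\<close> occur, and
    \<open>Pred 0\<close> need not be known beforehand.\<close>
  define n where "n = nat ((u ^ 3 * b - 1) mod 5)"
  have "int (Suc n) = (u ^ 3 * b - 1) mod 5 + 1" by (simp add: n_def)
  then have "int (Suc n) mod 5 = u ^ 3 * b mod 5" by (simp add: mod_simps)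
  then have "(int (Suc n) * t) mod 5 = (u ^ 3 * b * u) mod 5" unfolding u_def by (metis mod_mult_cong mod_mod_trivial)
  also have "u ^ 3 * b * u = (u ^ 3 * u) * b" by simp
  also have "(u ^ 3 * u) * b mod 5 = (u ^ 3 * u) mod 5 * b mod 5" by (rule mod_mult_left_eq[symmetric])
  also have "\<dots> = b mod 5" using units5_fourth_power[OF u] by simp
  finally show ?thesis using cong mult by blast
qed

text \<open>A transitive group of affine maps contains a nontrivial translation: if \<open>g\<close> fixes exactly
  the point \<open>f\<close> and \<open>h\<close> moves \<open>f\<close>, then \<open>h g h\<inverse> g\<inverse>\<close> is one.\<close>

lemma transitive_affine_group:
  assumes sub: "A \<subseteq> Aff units5"
    and comp: "\<And>g h. g \<in> A \<Longrightarrow> h \<in> A \<Longrightarrow> g \<circ> h \<in> A" and inv: "\<And>g. g \<in> A \<Longrightarrow> inv' g \<in> A"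
    and trans: "\<And>i j. i \<in> {1..5} \<Longrightarrow> j \<in> {1..5} \<Longrightarrow> \<exists>g\<in>A. g i = j"
  shows "\<exists>P. unit_subgroup P \<and> A = Aff P"
proof -
  have tr: "\<exists>u\<in>units5. \<exists>b\<in>{0, 1, 2, 3, 4}. aff u b \<in> A \<and> (u * x + b) mod 5 = y mod 5" for x y
  proof -
    obtain g where g: "g \<in> A" "g (res5 x) = res5 y"
      using trans[of "res5 x" "res5 y"] res5_bounds by auto
    then obtain u b where ub: "g = aff u (b mod 5)" "u \<in> units5" using sub by (auto simp: Aff_def)
    then have "(u * int (res5 x) + b mod 5) mod 5 = y mod 5"
      using g(2) res5_bounds by (metis aff_apply res5_eq_iff)
    then have "(u * x + b mod 5) mod 5 = y mod 5" using res5_mod[of x] by (metis mod_add_left_eq mod_mult_right_eq)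
    moreover have "b mod 5 \<in> {0, 1, 2, 3, 4}" using pos_mod_bound[of 5 b] pos_mod_sign[of 5 b] by (auto simp del: pos_mod_bound pos_mod_sign)
    ultimately show ?thesis
      by (intro bexI[of _ u] bexI[of _ "b mod 5"] conjI) (use ub g(1) in simp_all)
  qed
  have add: "aff 1 (a + b) \<in> A" if "aff 1 a \<in> A" "aff 1 b \<in> A" for a b
    using comp[OF that] by (simp add: aff_comp)
  have cong: "aff 1 b \<in> A" if "a mod 5 = b mod 5" "aff 1 a \<in> A" for a b
    using that by (metis aff_eq_iff)
  have "\<exists>t. t mod 5 \<noteq> 0 \<and> aff 1 t \<in> A"
  proof -
    \<comment> \<open>An element moving 0 to 1 has offset 1. Either it is already a translation, or
      it has the fixed point that \<open>fixed_pt\<close> computes.\<close>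
    obtain u b where u: "u \<in> units5" "aff u b \<in> A" "(u * 0 + b) mod 5 = 1 mod 5" using tr[of 0 1] by blast
    then have g: "aff u 1 \<in> A" by (simp add: aff_eq_iff[of u 1 u b, THEN iffD2])
    show ?thesis
    proof (cases "u = 1")
      case True then show ?thesis using g by (intro exI[of _ 1]) auto
    next
      case False
      obtain v c where v: "v \<in> units5" "c \<in> {0, 1, 2, 3, 4}" "aff v c \<in> A"
        "(v * fixed_pt u + c) mod 5 = (fixed_pt u + 1) mod 5" using tr[of "fixed_pt u" "fixed_pt u + 1"] by blast
      let ?t = "v - 1 + c * (1 - u)"
      have "?t mod 5 \<noteq> 0" 
        by (rule displaced_commutator[rule_format, of u v c]) (use u(1) False v(1,2,4) in auto)
      moreover have "aff 1 ?t = (aff v c \<circ> aff u 1) \<circ> inv' (aff u 1 \<circ> aff v c)"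
      proof -
        have "aff 1 ?t \<circ> (aff u 1 \<circ> aff v c) = aff v c \<circ> aff u 1"
          by (simp add: aff_comp mult.commute) (simp add: algebra_simps)
        moreover have "bij (aff u 1 \<circ> aff v c)"
          using aff_permutes[OF u(1)] aff_permutes[OF v(1)] permutes_bij bij_comp by blast
        then have "(aff u 1 \<circ> aff v c) \<circ> inv' (aff u 1 \<circ> aff v c) = id" using bij_is_surj surj_iff by blast
        ultimately show ?thesis by (metis comp_assoc comp_id)
      qed
      ultimately show ?thesis using comp inv g v(3) by metis
    qed
  qed
  then obtain t where "t mod 5 \<noteq> 0" "aff 1 t \<in> A" by blast
  then have all: "aff 1 b \<in> A" for b using translation_generates[of t "\<lambda>b. aff 1 b \<in> A" b] add cong by blast
  \<comment> \<open>With all translations available, membership depends on the scaling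
    alone.\<close>
  have shift: "aff u b \<in> A \<longleftrightarrow> aff u 0 \<in> A" for u b
    using comp[OF all[of b], of "aff u 0"] comp[OF all[of "- b"], of "aff u b"] by (auto simp: aff_comp)
  define P where "P = {u \<in> units5. aff u 0 \<in> A}"
  have "unit_subgroup P"
  proof (rule unit_subgroup_if_closed)
    show "1 \<in> P" using all[of 0] by (simp add: P_def)
    fix u v assume "u \<in> P" "v \<in> P"
    then have "aff (u * v) 0 \<in> A" "u * v mod 5 \<in> units5"
      using comp[of "aff u 0" "aff v 0"] units5_mult[of u v] by (auto simp: P_def aff_comp simp del: insert_iff)
    then show "u * v mod 5 \<in> P" by (simp add: P_def)
  qed (auto simp: P_def)
  moreover have "A = Aff P"
  proof (intro equalityI subsetI)
    fix g assume g: "g \<in> A"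
    then obtain u b where ub: "g = aff u b" "u \<in> units5" using sub by (auto simp: Aff_def)
    then have "u \<in> P" using shift[of u b] g by (simp add: P_def)
    then show "g \<in> Aff P" using ub by (auto simp: Aff_def)
  next
    fix g assume "g \<in> Aff P"
    then obtain u b where ub: "g = aff u b" "u \<in> P" by (auto simp: Aff_def)
    then show "g \<in> A" using shift[of u b] by (simp add: P_def)
  qed
  ultimately show ?thesis by blast
qed

definition Aff2 :: "(int \<times> int) set \<Rightarrow> ((nat \<Rightarrow> nat) \<times> (nat \<Rightarrow> nat)) set" where
  "Aff2 Q = {(aff u b, aff v c) | u b v c. (u, v) \<in> Q}"

text \<open>The graph of conjugation by \<open>k = aff d f\<close>: the second component is
  \<open>k \<circ> aff u b \<circ> inv' k\<close>, written out, for units \<open>d\<close>.\<close>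

definition twisted_diag :: "int set \<Rightarrow> int \<Rightarrow> int \<Rightarrow> ((nat \<Rightarrow> nat) \<times> (nat \<Rightarrow> nat)) set" where
  "twisted_diag P d f = {(aff u b, aff u (d * b + (1 - u) * f)) | u b. u \<in> P}"

text \<open>A subdirect product of two affine groups. The laws are stated for plain composition and
  inversion of functions, the form in which automorphisms deliver them.\<close>

locale affine_pair_group =
  fixes G :: "((nat \<Rightarrow> nat) \<times> (nat \<Rightarrow> nat)) set" and P R :: "int set"
  assumes P: "unit_subgroup P" and R: "unit_subgroup R" and RP: "R \<subseteq> P"
    and fst_G: "fst ` G = Aff P" and snd_G: "snd ` G = Aff R"
    and comp: "(g, h) \<in> G \<Longrightarrow> (g', h') \<in> G \<Longrightarrow> (g \<circ> g', h \<circ> h') \<in> G"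
    and inv: "(g, h) \<in> G \<Longrightarrow> (inv' g, inv' h) \<in> G"
begin

lemmas PD = unit_subgroupD[OF P] and RD = unit_subgroupD[OF R]

definition T :: "int \<Rightarrow> int \<Rightarrow> int \<Rightarrow> int \<Rightarrow> bool" where
  "T u b v c \<longleftrightarrow> (aff u b, aff v c) \<in> G"

lemma T_comp: "T u b v c \<Longrightarrow> T u' b' v' c' \<Longrightarrow> T (u * u') (b + u * b') (v * v') (c + v * c')"
  using comp[of "aff u b" "aff v c" "aff u' b'" "aff v' c'"] by (simp add: T_def aff_comp)

lemma T_cong: "T u b v c \<Longrightarrow> u mod 5 = u' mod 5 \<Longrightarrow> b mod 5 = b' mod 5 \<Longrightarrow> v mod 5 = v' mod 5 \<Longrightarrow>
    c mod 5 = c' mod 5 \<Longrightarrow> T u' b' v' c'"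
  unfolding T_def by (metis aff_eq_iff)

lemma T_fst: assumes "u \<in> P" shows "\<exists>v\<in>R. \<exists>c. T u b v c"
proof -
  have "aff u b \<in> fst ` G" unfolding fst_G Aff_def using assms by blast
  then obtain h where h: "(aff u b, h) \<in> G" by force
  then have "h \<in> Aff R" using snd_G by force
  then show ?thesis using h by (auto simp: T_def Aff_def)
qed

lemma T_snd: assumes "v \<in> R" shows "\<exists>u\<in>P. \<exists>b. T u b v c"
proof -
  have "aff v c \<in> snd ` G" unfolding snd_G Aff_def using assms by blast
  then obtain g where g: "(g, aff v c) \<in> G" by force
  then have "g \<in> Aff P" using fst_G by force
  then show ?thesis using g by (auto simp: T_def Aff_def)
qed

lemma T_mem: assumes "u \<in> units5" "v \<in> units5" "T u b v c" shows "u \<in> P" "v \<in> R"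
proof -
  have "aff u b \<in> Aff P" "aff v c \<in> Aff R" using assms fst_G snd_G unfolding T_def by force+
  then show "u \<in> P" "v \<in> R" using Aff_iff PD(1) RD(1) assms(1,2) by auto
qed

lemma G_elem: assumes "x \<in> G" obtains u b v c where "x = (aff u b, aff v c)" "u \<in> P" "v \<in> R" "T u b v c"
proof -
  have "fst x \<in> Aff P" "snd x \<in> Aff R" using assms fst_G snd_G by blast+
  then obtain u b v c where "x = (aff u b, aff v c)" "u \<in> P" "v \<in> R"
    by (cases x) (auto simp: Aff_def)
  then show ?thesis using that assms by (auto simp: T_def)
qed

text \<open>The fourth power kills both scalings. The geometric sum vanishes modulo 5 unless the
  scaling is 1, when it equals 4; this extracts pure translations from mixed elements.\<close>

lemma T_fourth_power:
  assumes "u \<in> units5" "v \<in> units5" "T u b v c"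
  shows "T 1 (b * (1 + u + u ^ 2 + u ^ 3)) 1 (c * (1 + v + v ^ 2 + v ^ 3))"
proof -
  have "T (u * (u * (u * u))) (b + u * (b + u * (b + u * b))) (v * (v * (v * v))) (c + v * (c + v * (c + v * c)))"
    by (intro T_comp assms(3))
  moreover have "u * (u * (u * u)) mod 5 = 1 mod 5" "v * (v * (v * v)) mod 5 = 1 mod 5" using assms by auto
  moreover have "b + u * (b + u * (b + u * b)) = b * (1 + u + u ^ 2 + u ^ 3)" for b u :: int
    by (simp add: algebra_simps power2_eq_square power3_eq_cube)
  ultimately show ?thesis by (elim T_cong) simp_all
qed

lemma T_inverse:
  assumes "u \<in> units5" "v \<in> units5" "T u b v c"
  shows "T (u ^ 3) (- (u ^ 3) * b) (v ^ 3) (- (v ^ 3) * c)"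
  using inv[of "aff u b" "aff v c"] assms(3) by (simp add: T_def inv_aff[OF assms(1)] inv_aff[OF assms(2)])

text \<open>Dividing the two pairs leaves an element (1, h). If h is a translation, the hypothesis
  makes it trivial; otherwise a commutator produces a forbidden translation. Hence the group is the
  graph of a map.\<close>

lemma T_unique_snd:
  assumes no: "\<And>d. T 1 0 1 d \<Longrightarrow> d mod 5 = 0"
    and u: "u \<in> units5" and v: "v \<in> units5" "v' \<in> units5" and T: "T u b v c" "T u b v' c'"
  shows "v = v' \<and> c mod 5 = c' mod 5"
proof -
  have *: "T (u ^ 3 * u) (- (u ^ 3) * b + u ^ 3 * b) (v ^ 3 * v') (- (v ^ 3) * c + v ^ 3 * c')"
    by (rule T_comp[OF T_inverse[OF u v(1) T(1)] T(2)])
  let ?w = "v ^ 3 * v' mod 5"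
  have w: "?w \<in> units5" using v by auto
  have T1: "T 1 0 ?w (v ^ 3 * (c' - c))"
    by (rule T_cong[OF *]) (use units5_fourth_power[OF u] in \<open>auto simp: algebra_simps\<close>)
  have "?w = 1"
  proof (rule ccontr)
    assume "?w \<noteq> 1"
    obtain x y where xy: "T x y 1 1" "x \<in> units5" using T_snd[OF RD(2), of 1] PD(1) by blast
    \<comment> \<open>The commutator of an element \<open>(1, h)\<close>, \<open>h\<close> not a translation, with a translation is \<open>(1, t)\<close>, \<open>t \<noteq> 1\<close>.\<close>
    let ?e = "v ^ 3 * (c' - c)"
    have a: "T (1 * x) (0 + 1 * y) (?w * 1) (?e + ?w * 1)" by (rule T_comp[OF T1 xy(1)])
    have b: "T (x * 1) (y + x * 0) (1 * ?w) (1 + 1 * ?e)" by (rule T_comp[OF xy(1) T1])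
    have "T x y ?w (?e + ?w)" "T x y ?w (?e + 1)" using a b by (simp_all add: add.commute)
    from T_comp[OF T_inverse[OF xy(2) w this(1)] this(2)]
    have "T (x ^ 3 * x) (- (x ^ 3) * y + x ^ 3 * y) (?w ^ 3 * ?w) (- (?w ^ 3) * (?e + ?w) + ?w ^ 3 * (?e + 1))" .
    then have "T 1 0 1 (?w ^ 3 * (1 - ?w))"
      by (rule T_cong) (use units5_fourth_power[OF xy(2)] units5_fourth_power[OF w] in \<open>auto simp: algebra_simps\<close>)
    then have "(?w ^ 3 * (1 - ?w)) mod 5 = 0" by (rule no)
    then show False using w \<open>?w \<noteq> 1\<close> by auto
  qed
  then have "(v ^ 3 * (c' - c)) mod 5 = 0" using T1 no by simp
  moreover have "v = v'" using v \<open>?w = 1\<close> by auto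
  ultimately have "(v ^ 3 * v * (c' - c)) mod 5 = 0" by (metis mod_mult_right_eq mod_0 mult.commute mult.left_commute mult_zero_right)
  then have "(c' - c) mod 5 = 0" using units5_fourth_power[OF v(1)] by (metis mod_mult_left_eq mult_1)
  then show ?thesis using \<open>v = v'\<close> by (metis diff_add_cancel mod_add_left_eq add_0)
qed

text \<open>The element (1, t) generates all translations in the second component; these can be used
  to clear the second component of a pair over a translation in the first.\<close>

lemma contains_translations:
  assumes d: "T 1 0 1 d" "d mod 5 \<noteq> 0"
  shows "T 1 b 1 c"
proof -
  have t2: "T 1 0 1 c" for c
  proof (rule translation_generates[where Pred = "\<lambda>c. T 1 0 1 c", OF d(2,1)])
    show "T 1 0 1 (a + b)" if "T 1 0 1 a" "T 1 0 1 b" for a b using T_comp[OF that] by simp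
    show "T 1 0 1 b" if "a mod 5 = b mod 5" "T 1 0 1 a" for a b by (rule T_cong[OF that(2)]) (simp_all add: that(1))
  qed
  \<comment> \<open>The fourth power of a pair lying over the translation by 1 consists of
    translations, and its first component is the translation by 1 + 1 + 1 + 1 = 4.\<close>
  obtain v c' where v: "v \<in> R" "T 1 1 v c'" using T_fst[OF PD(2), of 1] by blast
  then have "T 1 (1 * (1 + 1 + 1 ^ 2 + 1 ^ 3)) 1 (c' * (1 + v + v ^ 2 + v ^ 3))"
    by (intro T_fourth_power) (use RD in auto)
  from T_comp[OF this t2[of "- (c' * (1 + v + v ^ 2 + v ^ 3))"]] have "T 1 4 1 0" by simp
  have t1: "T 1 b 1 0" for b
  proof (rule translation_generates[where Pred = "\<lambda>b. T 1 b 1 0", OF _ \<open>T 1 4 1 0\<close>])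
    show "T 1 (a + b) 1 0" if "T 1 a 1 0" "T 1 b 1 0" for a b using T_comp[OF that] by simp
    show "T 1 b 1 0" if "a mod 5 = b mod 5" "T 1 a 1 0" for a b by (rule T_cong[OF that(2)]) (simp_all add: that(1))
  qed simp
  show ?thesis using T_comp[OF t1[of b] t2[of c]] by simp
qed

text \<open>As all pairs of translations belong to the group, offsets are irrelevant for membership,
  and only the set of pairs of scalings remains to be determined.\<close>

lemma full_case:
  assumes d: "T 1 0 1 d" "d mod 5 \<noteq> 0"
  shows "\<exists>Q. Q \<subseteq> units5 \<times> units5 \<and> fst ` Q = P \<and> snd ` Q = R \<and> G = Aff2 Q \<and>
    (\<forall>u v u' v'. (u, v) \<in> Q \<longrightarrow> (u', v') \<in> Q \<longrightarrow> (u * u' mod 5, v * v' mod 5) \<in> Q)"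
proof -
  define Q where "Q = {(u, v). u \<in> units5 \<and> v \<in> units5 \<and> T u 0 v 0}"
  have shift: "T u b v c \<longleftrightarrow> T u 0 v 0" for u b v c
    using T_comp[OF contains_translations[OF d, of b c], of u 0 v 0]
      T_comp[OF contains_translations[OF d, of "- b" "- c"], of u b v c] by auto
  have G: "G = Aff2 Q"
  proof (intro equalityI subsetI)
    fix x assume "x \<in> G"
    then obtain u b v c where x: "x = (aff u b, aff v c)" "u \<in> P" "v \<in> R" "T u b v c" by (rule G_elem)
    then have "(u, v) \<in> Q"
      unfolding Q_def by (intro CollectI case_prodI conjI PD(1)[THEN subsetD] RD(1)[THEN subsetD] shift[THEN iffD1])
    then show "x \<in> Aff2 Q" using x unfolding Aff2_def by blast
  next
    fix x assume "x \<in> Aff2 Q"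
    then obtain u b v c where x: "x = (aff u b, aff v c)" "(u, v) \<in> Q" unfolding Aff2_def by blast
    then have "T u b v c" using shift[of u b v c] by (simp add: Q_def)
    then show "x \<in> G" using x by (simp add: T_def)
  qed
  have "fst ` Q = P"
  proof (intro equalityI subsetI)
    fix u assume "u \<in> fst ` Q"
    then obtain v where "(u, v) \<in> Q" by force
    then show "u \<in> P" unfolding Q_def using T_mem(1)[of u v 0 0] by blast
  next
    fix u assume "u \<in> P"
    then obtain v c where "v \<in> R" "T u 0 v c" using T_fst by blast
    with \<open>u \<in> P\<close> have "(u, v) \<in> Q"
      unfolding Q_def by (intro CollectI case_prodI conjI PD(1)[THEN subsetD] RD(1)[THEN subsetD] shift[THEN iffD1])
    then show "u \<in> fst ` Q" by (rule image_eqI[rotated]) simp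
  qed
  moreover have "snd ` Q = R"
  proof (intro equalityI subsetI)
    fix v assume "v \<in> snd ` Q"
    then obtain u where "(u, v) \<in> Q" by force
    then show "v \<in> R" unfolding Q_def using T_mem(2)[of u v 0 0] by blast
  next
    fix v assume "v \<in> R"
    then obtain u b where "u \<in> P" "T u b v 0" using T_snd by blast
    with \<open>v \<in> R\<close> have "(u, v) \<in> Q"
      unfolding Q_def by (intro CollectI case_prodI conjI PD(1)[THEN subsetD] RD(1)[THEN subsetD] shift[THEN iffD1])
    then show "v \<in> snd ` Q" by (rule image_eqI[rotated]) simp
  qed
  moreover have "(u * u' mod 5, v * v' mod 5) \<in> Q" if "(u, v) \<in> Q" "(u', v') \<in> Q" for u v u' v'
  proof -
    have "T (u * u' mod 5) 0 (v * v' mod 5) 0"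
      by (rule T_cong[OF T_comp[of u 0 v 0 u' 0 v' 0]]) (use that in \<open>auto simp: Q_def\<close>)
    then show ?thesis using that units5_mult unfolding Q_def by blast
  qed
  moreover have "Q \<subseteq> units5 \<times> units5" unfolding Q_def by blast
  ultimately show ?thesis using G by blast
qed

text \<open>The group is the graph of a map. Translations go to translations, with slope
  \<open>d\<close>; compatibility with conjugation forces equal scalings; and the image of a scaling
  that generates \<open>P\<close> fixes the remaining parameter \<open>f\<close>.\<close>

lemma diag_case:
  assumes no: "\<And>d. T 1 0 1 d \<Longrightarrow> d mod 5 = 0"
  shows "P = R \<and> (\<exists>d\<in>units5. \<exists>f. G = twisted_diag P d f)"
proof -
  have uniq: "v = v' \<and> c mod 5 = c' mod 5"
    if "u \<in> units5" "v \<in> units5" "v' \<in> units5" "T u b v c" "T u b v' c'" for u b v c v' c'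
    by (rule T_unique_snd[OF _ that]) (rule no)
  obtain x y where xy: "x \<in> P" "T x y 1 1" using T_snd[OF RD(2), of 1] by blast
  then have x5: "x \<in> units5" using PD(1) by blast
  \<comment> \<open>Fourth power of a pair whose second component is the translation by 1: a pair of
    translations with second amount 4. Were its first amount zero, it would be an excluded pair (1,
    t).\<close>
  let ?e = "y * (1 + x + x ^ 2 + x ^ 3)"
  have e: "T 1 ?e 1 4" using T_fourth_power[OF x5 _ xy(2)] by simp
  have "?e mod 5 \<noteq> 0"
  proof
    assume "?e mod 5 = 0"
    then have "T 1 0 1 4" by (intro T_cong[OF e]) auto
    then show False using no by fastforce
  qed
  then have "\<exists>d. T 1 1 1 d"
  proof (rule translation_generates[where Pred = "\<lambda>b. \<exists>d. T 1 b 1 d"])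
    show "\<exists>d. T 1 ?e 1 d" using e by blast
    show "\<exists>d. T 1 (a + b) 1 d" if ab: "\<exists>d. T 1 a 1 d" "\<exists>d. T 1 b 1 d" for a b
    proof -
      obtain c c' where "T 1 a 1 c" "T 1 b 1 c'" using ab by blast
      from T_comp[OF this] have "T 1 (a + b) 1 (c + c')" by simp
      then show ?thesis by blast
    qed
    show "\<exists>d. T 1 b 1 d" if ab: "a mod 5 = b mod 5" "\<exists>d. T 1 a 1 d" for a b
    proof -
      obtain c where "T 1 a 1 c" using ab(2) by blast
      then have "T 1 b 1 c" by (rule T_cong) (simp_all add: ab(1))
      then show ?thesis by blast
    qed
  qed
  then obtain d0 where "T 1 1 1 d0" by blast
  define d where "d = d0 mod 5"
  have d1: "T 1 1 1 d" by (rule T_cong[OF \<open>T 1 1 1 d0\<close>]) (auto simp: d_def)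
  have dn: "T 1 (int n) 1 (d * int n)" for n
  proof (induction n)
    case 0
    have "T 1 1 1 d" by (rule d1)
    from T_comp[OF T_inverse[OF _ _ this] this] show ?case by simp
  next
    case (Suc n) show ?case using T_comp[OF d1 Suc] by (simp add: algebra_simps)
  qed
  have db: "T 1 b 1 (d * b)" for b
    by (rule T_cong[OF dn[of "nat (b mod 5)"]]) (auto simp: mod_simps)
  have d5: "d \<in> units5"
  proof -
    have "d \<noteq> 0"
    proof
      assume "d = 0"
      then have t: "T 1 b 1 0" for b using db[of b] by simp
      have "T 1 (- ?e + ?e) 1 4" using T_comp[OF t[of "- ?e"] e] by simp
      then show False using no[of 4] by simp
    qed
    then show ?thesis using units5_mod[of d] by (simp add: d_def)
  qed
  \<comment> \<open>Conjugation by the pair multiplies the first translation by \<open>u\<close> and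
    its image by \<open>v\<close>. Since the image of a translation is \<open>d\<close> times that
    translation, \<open>d * u\<close> and \<open>d * v\<close> agree modulo 5.\<close>
  have same: "u = v" if "u \<in> units5" "v \<in> units5" "T u b v c" for u b v c
  proof -
    have "T u (- u + (b + u)) v (- (d * u) + (c + v * d))"
      using T_comp[OF db[of "- u"] T_comp[OF that(3) d1]] by simp
    then have "T u b v (- (d * u) + (c + v * d))" by simp
    from conjunct2[OF uniq[OF that(1,2,2,3) this]] have "c mod 5 = (- (d * u) + (c + v * d)) mod 5" .
    then have "(- (d * u) + (c + v * d) - c) mod 5 = 0" by (metis mod_diff_cong diff_self mod_0)
    then have "(d * (v - u)) mod 5 = 0" by (simp add: algebra_simps)
    then show ?thesis using d5 that(1,2) by auto
  qed
  have PR: "P = R"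
  proof
    show "P \<subseteq> R"
    proof
      fix u assume u: "u \<in> P"
      obtain v c where v: "v \<in> R" "T u 0 v c" using T_fst[OF u] by blast
      have "u = v" by (rule same[OF PD(1)[THEN subsetD, OF u] RD(1)[THEN subsetD, OF v(1)] v(2)])
      then show "u \<in> R" using v by simp
    qed
  qed (rule RP)
  \<comment> \<open>A scaling about 0 must correspond to a scaling about a point \<open>f\<close>.
    The point is solved for at a generator of \<open>P\<close>: from second offset \<open>c\<close>
    one gets \<open>3 * c\<close> for the generator 4 and \<open>- c\<close> for the generator 2,
    and powers settle the other units.\<close>
  have "\<exists>f. \<forall>u\<in>P. T u 0 u ((1 - u) * f)"
  proof -
    have T1: "T 1 0 1 0" using db[of 0] by simp
    consider "P = {1}" | "P = {1, 4}" | "P = {1, 2, 3, 4}" using P by (auto simp: unit_subgroup_def)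
    then show ?thesis
    proof cases
      case 1 then show ?thesis using T1 by auto
    next
      case 2
      obtain v c where "v \<in> R" "T 4 0 v c" using T_fst[of 4 0] 2 by blast
      moreover have "4 = v" by (rule same[OF _ RD(1)[THEN subsetD, OF \<open>v \<in> R\<close>] \<open>T 4 0 v c\<close>]) simp
      ultimately have "T 4 0 4 c" by simp
      moreover have "c mod 5 = ((1 - 4) * (3 * c)) mod 5"
        using mod_mult_self1[of c "- 2 * c" 5] by simp
      ultimately have "T 4 0 4 ((1 - 4) * (3 * c))" by (elim T_cong) simp_all
      then show ?thesis using T1 2 by (intro exI[of _ "3 * c"]) auto
    next
      case 3
      obtain v c where "v \<in> R" "T 2 0 v c" using T_fst[of 2 0] 3 by blast
      moreover have "2 = v" by (rule same[OF _ RD(1)[THEN subsetD, OF \<open>v \<in> R\<close>] \<open>T 2 0 v c\<close>]) simp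
      ultimately have c: "T 2 0 2 c" by simp
      have c2: "T 4 0 4 (3 * c)" using T_comp[OF c c] by simp
      have c3: "T 8 0 8 (7 * c)" using T_comp[OF c c2] by simp
      have "T 2 0 2 ((1 - 2) * (- c))" "T 4 0 4 ((1 - 4) * (- c))" using c c2 by simp_all
      moreover have "7 * c mod 5 = ((1 - 3) * (- c)) mod 5"
        using mod_mult_self1[of "2 * c" c 5] by simp
      then have "T 3 0 3 ((1 - 3) * (- c))" by (intro T_cong[OF c3]) simp_all
      ultimately show ?thesis using T1 3 by (intro exI[of _ "- c"]) auto
    qed
  qed
  then obtain f where f: "\<And>u. u \<in> P \<Longrightarrow> T u 0 u ((1 - u) * f)" by blast
  have f': "T u b u (d * b + (1 - u) * f)" if "u \<in> P" for u b
    using T_comp[OF db[of b] f[OF that]] by simp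
  have "G = twisted_diag P d f"
  proof (intro equalityI subsetI)
    fix x assume "x \<in> G"
    then obtain u b v c where x: "x = (aff u b, aff v c)" "u \<in> P" "v \<in> R" "T u b v c" by (rule G_elem)
    then have u5: "u \<in> units5" "v \<in> units5" using PD(1) RD(1) by (simp_all only: subset_iff)
    have "v = u" by (rule same[OF u5 x(4), symmetric])
    have "c mod 5 = (d * b + (1 - u) * f) mod 5" by (rule conjunct2[OF uniq[OF u5(1) u5(2) u5(1) x(4) f'[OF x(2)]]])
    then have "x = (aff u b, aff u (d * b + (1 - u) * f))" using x \<open>v = u\<close> by (simp add: aff_eq_iff)
    then show "x \<in> twisted_diag P d f" using x(2) unfolding twisted_diag_def by blast
  next
    fix x assume "x \<in> twisted_diag P d f"
    then show "x \<in> G" using f' by (auto simp: twisted_diag_def T_def)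
  qed
  then show ?thesis using PR d5 by blast
qed

end

text \<open>The ways of gluing scalings that are not direct products: equal quadratic character
  (\<open>Q_I2\<close>), the graphs of identity (\<open>Q_I3\<close>), inversion
  (\<open>Q_I4\<close>) and squaring (\<open>Q_I7\<close>) on all units, and the identity on 1 and 4
  (\<open>Q_II2\<close>).\<close>

abbreviation Q_I2 :: "(int \<times> int) set" where
  "Q_I2 \<equiv> {(1, 1), (4, 1), (2, 2), (3, 2), (3, 3), (2, 3), (4, 4), (1, 4)}"
abbreviation Q_I3 :: "(int \<times> int) set" where "Q_I3 \<equiv> {(1, 1), (2, 2), (3, 3), (4, 4)}"
abbreviation Q_I4 :: "(int \<times> int) set" where "Q_I4 \<equiv> {(1, 1), (2, 3), (3, 2), (4, 4)}"
abbreviation Q_I7 :: "(int \<times> int) set" where "Q_I7 \<equiv> {(1, 1), (2, 4), (3, 4), (4, 1)}"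
abbreviation Q_II2 :: "(int \<times> int) set" where "Q_II2 \<equiv> {(1, 1), (4, 4)}"

lemma units5_self_mod: "u \<in> units5 \<Longrightarrow> u mod 5 = u"
  by auto

text \<open>The first projection is cyclic, so \<open>Q\<close> is generated by one lift
  \<open>(g, v0)\<close> of a generator and the fibre over 1. Exponents 0 to 3 are always enough;
  for \<open>g\<close> of smaller order the parametrisation merely repeats elements.\<close>

lemma pair_subgroup_form:
  assumes Q: "Q \<subseteq> units5 \<times> units5"
    and closed: "\<forall>u v u' v'. (u, v) \<in> Q \<longrightarrow> (u', v') \<in> Q \<longrightarrow> (u * u' mod 5, v * v' mod 5) \<in> Q"
    and g: "(g, v0) \<in> Q" and gen: "\<forall>u\<in>fst ` Q. \<exists>i\<in>{0, 1, 2, 3::nat}. u = g ^ i mod 5"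
  shows "Q = (\<lambda>(i, w). (g ^ i mod 5, v0 ^ i * w mod 5)) ` ({0, 1, 2, 3} \<times> {w. (1, w) \<in> Q})"
    and "unit_subgroup {w. (1, w) \<in> Q}"
proof -
  note closed = closed[rule_format]
  have gv: "g \<in> units5" "v0 \<in> units5" using subsetD[OF Q g] by (simp_all only: mem_Sigma_iff)
  have pow: "(u ^ Suc n mod 5, v ^ Suc n mod 5) \<in> Q" if uv: "(u, v) \<in> Q" for u v n
  proof (induction n)
    case 0
    have "u mod 5 = u" "v mod 5 = v" using subsetD[OF Q uv] by (simp_all only: mem_Sigma_iff units5_self_mod)
    then show ?case using uv by simp
  next
    case (Suc n)
    from closed[OF uv Suc] show ?case by (simp add: mod_simps)
  qed
  have fp: "u ^ 4 mod 5 = 1" if "u \<in> units5" for u :: int using that by auto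
  have one: "(1, 1) \<in> Q" using pow[OF g, of 3] fp[OF gv(1)] fp[OF gv(2)] by (simp add: numeral_eq_Suc)
  have pow': "(u ^ n mod 5, v ^ n mod 5) \<in> Q" if "(u, v) \<in> Q" for u v n
    using pow[OF that, of "n - 1"] one by (cases n) auto
  have fpn: "u ^ (4 * n) mod 5 = 1" if "u \<in> units5" for u :: int and n
    using fp[OF that] by (metis power_mult power_mod power_one mod_mod_trivial)
  show "unit_subgroup {w. (1, w) \<in> Q}"
  proof (rule unit_subgroup_if_closed)
    show "u * v mod 5 \<in> {w. (1, w) \<in> Q}" if "u \<in> {w. (1, w) \<in> Q}" "v \<in> {w. (1, w) \<in> Q}" for u v
      using closed[of 1 u 1 v] that by simp
  qed (use Q one in auto)
  show "Q = (\<lambda>(i, w). (g ^ i mod 5, v0 ^ i * w mod 5)) ` ({0, 1, 2, 3} \<times> {w. (1, w) \<in> Q})"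
  proof (intro equalityI subsetI)
    fix x assume x: "x \<in> Q"
    obtain u v where uv: "x = (u, v)" by fastforce
    have "u \<in> fst ` Q" using x uv by (intro image_eqI[of _ fst x]) simp_all
    from bspec[OF gen this] obtain i :: nat where i: "i \<in> {0, 1, 2, 3}" "u = g ^ i mod 5" by (elim bexE)
    \<comment> \<open>The exponent \<open>3 * i\<close> inverts \<open>v0 ^ i\<close>, so this is
      what remains of \<open>v\<close> after removing the contribution of the lift.\<close>
    let ?w = "v0 ^ (3 * i) mod 5 * v mod 5"
    have "(g ^ (3 * i) mod 5 * u mod 5, ?w) \<in> Q" using closed[OF pow'[OF g] x[unfolded uv]] .
    moreover have "g ^ (3 * i) mod 5 * u mod 5 = g ^ (3 * i) * g ^ i mod 5" unfolding i(2) by (simp add: mod_simps)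
    moreover have "g ^ (3 * i) * g ^ i = g ^ (4 * i)" by (simp flip: power_add)
    ultimately have w: "(1, ?w) \<in> Q" using fpn[OF gv(1)] by simp
    have "v0 ^ i * ?w mod 5 = v0 ^ (4 * i) mod 5 * v mod 5"
    proof -
      have "v0 ^ i * ?w mod 5 = v0 ^ i * (v0 ^ (3 * i) * v) mod 5" by (simp add: mod_simps)
      also have "v0 ^ i * (v0 ^ (3 * i) * v) = v0 ^ (4 * i) * v" by (simp flip: power_add mult.assoc)
      finally show ?thesis by (simp add: mod_simps)
    qed
    also have "\<dots> = v mod 5" using fpn[OF gv(2)] by simp
    also have "\<dots> = v" using subsetD[OF Q x] unfolding uv by (simp only: mem_Sigma_iff units5_self_mod)
    finally have v: "v0 ^ i * ?w mod 5 = v" .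
    show "x \<in> (\<lambda>(i, w). (g ^ i mod 5, v0 ^ i * w mod 5)) ` ({0, 1, 2, 3} \<times> {w. (1, w) \<in> Q})"
      by (rule image_eqI[of _ _ "(i, ?w)"])
        (use i(1) w in \<open>simp_all only: uv i(2)[symmetric] v split_conv mem_Sigma_iff mem_Collect_eq simp_thms\<close>)
  next
    fix x assume "x \<in> (\<lambda>(i, w). (g ^ i mod 5, v0 ^ i * w mod 5)) ` ({0, 1, 2, 3} \<times> {w. (1, w) \<in> Q})"
    then obtain i w where x: "x = (g ^ i mod 5, v0 ^ i * w mod 5)" "(1, w) \<in> Q" by auto
    have "(g ^ i mod 5 * 1 mod 5, v0 ^ i mod 5 * w mod 5) \<in> Q" by (rule closed[OF pow'[OF g] x(2)])
    then show "x \<in> Q" unfolding x(1) by (simp add: mod_simps)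
  qed
qed

lemma pair_images:
  fixes W :: "int set" and g v0 :: int
  defines "F \<equiv> \<lambda>g v0 W. (\<lambda>(i, w). (g ^ i mod 5, v0 ^ i * w mod 5)) ` ({0, 1, 2, 3 :: nat} \<times> W)"
  shows
    "v0 \<in> units5 \<Longrightarrow> F 2 v0 {1, 2, 3, 4} = units5 \<times> units5"
    "F 2 1 {1, 4} = units5 \<times> {1, 4}" "F 2 4 {1, 4} = units5 \<times> {1, 4}"
    "F 2 2 {1, 4} = Q_I2" "F 2 3 {1, 4} = Q_I2"
    "F 2 1 {1} = units5 \<times> {1}" "F 2 2 {1} = Q_I3" "F 2 3 {1} = Q_I4" "F 2 4 {1} = Q_I7"
    "F 4 1 {1, 4} = {1, 4} \<times> {1, 4}" "F 4 4 {1, 4} = {1, 4} \<times> {1, 4}"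
    "F 4 1 {1} = {1, 4} \<times> {1}" "F 4 4 {1} = Q_II2" "F 1 1 {1} = {1} \<times> {1}"
proof -
  have "F 2 1 {1, 2, 3, 4} = units5 \<times> units5" "F 2 2 {1, 2, 3, 4} = units5 \<times> units5"
    "F 2 3 {1, 2, 3, 4} = units5 \<times> units5" "F 2 4 {1, 2, 3, 4} = units5 \<times> units5"
    unfolding F_def by (simp add: Sigma_def, auto)+
  then show "F 2 v0 {1, 2, 3, 4} = units5 \<times> units5" if "v0 \<in> units5"
    using that by (elim insertE emptyE) (simp_all only:)
qed (unfold F_def, (simp add: Sigma_def; auto; fail)+)

text \<open>At most four lifts of a generator and three fibres have to be tried. Each combination
  gives either a product, which must then be \<open>P \<times> R\<close>, or one of the listed
  gluings.\<close>

lemma pair_subgroup_cases: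
  assumes P: "unit_subgroup P" and R: "unit_subgroup R" and RP: "R \<subseteq> P"
    and Q: "Q \<subseteq> units5 \<times> units5" "fst ` Q = P" "snd ` Q = R"
    and closed: "\<forall>u v u' v'. (u, v) \<in> Q \<longrightarrow> (u', v') \<in> Q \<longrightarrow> (u * u' mod 5, v * v' mod 5) \<in> Q"
  shows "Q = P \<times> R \<or> P = units5 \<and> R = units5 \<and> Q \<in> {Q_I2, Q_I3, Q_I4} \<or>
    P = units5 \<and> R = {1, 4} \<and> Q = Q_I7 \<or> P = {1, 4} \<and> R = {1, 4} \<and> Q = Q_II2"
proof -
  let ?W = "{w. (1, w) \<in> Q}"
  note form = pair_subgroup_form[OF Q(1) closed] and RD = unit_subgroupD[OF R]
  have snd: "snd ` (A \<times> B) = B" if "A \<noteq> {}" for A B :: "int set" using that by (simp only: snd_image_times if_False)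
  have snd_Times: "snd ` (units5 \<times> B) = B" "snd ` ({1 :: int, 4} \<times> B) = B" for B :: "int set"
    by (rule snd, simp)+
  have "snd ` Q_I2 = units5" "snd ` Q_I3 = units5" "snd ` Q_I4 = units5" "snd ` Q_I7 = {1, 4}" "snd ` Q_II2 = {1, 4}"
    by (simp_all only: image_insert image_empty snd_conv) auto
  note snd = this snd_Times
  have full: ?thesis if q: "Q = A \<times> B" and AB: "snd ` (A \<times> B) = B" for A B
  proof -
    have "R = B" using Q(3) q AB by (simp only:)
    moreover have "P = A"
    proof (cases "B = {}")
      case False
      then have "fst ` (A \<times> B) = A" by (simp only: fst_image_times if_False)
      then show ?thesis using Q(2) q by (simp only:)
    qed (use \<open>R = B\<close> RD(2) in blast)
    ultimately have "Q = P \<times> R" using q by (simp only:)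
    then show ?thesis by (rule disjI1)
  qed
  consider "P = units5" | "P = {1, 4}" | "P = {1}" using P by (auto simp: unit_subgroup_def)
  then show ?thesis
  proof cases
    case 1
    then have "2 \<in> fst ` Q" using Q(2) by simp
    then obtain v0 where v0: "(2, v0) \<in> Q" by (elim imageE) (metis prod.collapse)
    have v0': "v0 \<in> units5" using subsetD[OF Q(1) v0] by (simp only: mem_Sigma_iff)
    have gen: "\<forall>u\<in>fst ` Q. \<exists>i\<in>{0, 1, 2, 3::nat}. u = 2 ^ i mod 5"
      unfolding Q(2) 1 by simp
    note form = form[OF v0 gen]
    have "unit_subgroup ?W" using form(2) by blast
    then consider "?W = units5" | "?W = {1, 4}" | "?W = {1}" unfolding unit_subgroup_def by blast
    then show ?thesis
    proof cases
      case w: 1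
      have "Q = units5 \<times> units5" using form(1) unfolding w pair_images(1)[OF v0'] .
      then show ?thesis by (rule full[OF _ snd(6)])
    next
      case w: 2
      note form = form(1)[unfolded w]
      have "Q = units5 \<times> {1, 4} \<or> Q = Q_I2"
        using v0' form pair_images(2-5) by (elim insertE emptyE) (simp_all only: simp_thms)
      then show ?thesis
      proof
        assume q: "Q = Q_I2"
        then have "R = units5" using Q(3) snd(1) by (simp only:)
        then show ?thesis using 1 q by (simp only: insert_iff simp_thms)
      qed (rule full[OF _ snd(6)])
    next
      case w: 3
      note form = form(1)[unfolded w]
      have "Q = units5 \<times> {1} \<or> Q = Q_I3 \<or> Q = Q_I4 \<or> Q = Q_I7"
        using v0' form pair_images(6-9) by (elim insertE emptyE) (simp_all only: simp_thms)
      then show ?thesis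
      proof (elim disjE)
        assume q: "Q = Q_I3"
        then have "R = units5" using Q(3) snd(2) by (simp only:)
        then show ?thesis using 1 q by (simp only: insert_iff simp_thms)
      next
        assume q: "Q = Q_I4"
        then have "R = units5" using Q(3) snd(3) by (simp only:)
        then show ?thesis using 1 q by (simp only: insert_iff simp_thms)
      next
        assume q: "Q = Q_I7"
        then have "R = {1, 4}" using Q(3) snd(4) by (simp only:)
        then show ?thesis using 1 q by (simp only: simp_thms)
      qed (rule full[OF _ snd(6)])
    qed
  next
    case 2
    then have "4 \<in> fst ` Q" using Q(2) by simp
    then obtain v0 where v0: "(4, v0) \<in> Q" by (elim imageE) (metis prod.collapse)
    have gen: "\<forall>u\<in>fst ` Q. \<exists>i\<in>{0, 1, 2, 3::nat}. u = 4 ^ i mod 5"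
      unfolding Q(2) 2 by simp
    note form = form[OF v0 gen]
    have "v0 \<in> R" unfolding Q(3)[symmetric] using v0 by (rule image_eqI[rotated]) simp
    then have v0': "v0 \<in> {1, 4}" using RP 2 by blast
    have "?W \<subseteq> R" unfolding Q(3)[symmetric] by (auto intro: image_eqI[rotated])
    then have W: "?W \<subseteq> {1, 4}" using RP 2 by blast
    have "unit_subgroup ?W" using form(2) by blast
    then have "?W = {1, 4} \<or> ?W = {1}" using W unfolding unit_subgroup_def by auto
    then show ?thesis
    proof
      assume w: "?W = {1, 4}"
      note form = form(1)[unfolded w]
      have "Q = {1, 4} \<times> {1, 4}"
        using v0' form pair_images(10,11) by (elim insertE emptyE) (simp_all only: simp_thms)
      then show ?thesis by (rule full[OF _ snd(7)])
    next
      assume w: "?W = {1}"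
      note form = form(1)[unfolded w]
      have "Q = {1, 4} \<times> {1} \<or> Q = Q_II2"
        using v0' form pair_images(12,13) by (elim insertE emptyE) (simp_all only: simp_thms)
      then show ?thesis
      proof
        assume q: "Q = Q_II2"
        then have "R = {1, 4}" using Q(3) snd(5) by (simp only:)
        then show ?thesis using 2 q by (simp only: simp_thms)
      qed (rule full[OF _ snd(7)])
    qed
  next
    case 3
    have "R = {1}" using RP R 3 by (auto simp: unit_subgroup_def)
    then have "Q \<subseteq> {1} \<times> {1}" using Q(2,3) 3 subset_fst_snd[of Q] by simp
    moreover have "Q \<noteq> {}" using Q(2) 3 by auto
    ultimately show ?thesis using 3 \<open>R = {1}\<close> by auto
  qed
qed

section \<open>Identification with the abstract groups of the table, by maps from the model to the
  permutation group\<close>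

lemma is_iso_if_inverse:
  assumes bij: "bij_betw \<phi> (carrier H) (carrier G)"
    and closed: "\<And>x y. x \<in> carrier H \<Longrightarrow> y \<in> carrier H \<Longrightarrow> x \<otimes>\<^bsub>H\<^esub> y \<in> carrier H"
    and hom: "\<And>x y. x \<in> carrier H \<Longrightarrow> y \<in> carrier H \<Longrightarrow> \<phi> (x \<otimes>\<^bsub>H\<^esub> y) = \<phi> x \<otimes>\<^bsub>G\<^esub> \<phi> y"
  shows "G \<cong> H"
proof -
  let ?\<psi> = "inv_into (carrier H) \<phi>"
  have b: "bij_betw ?\<psi> (carrier G) (carrier H)" by (rule bij_betw_inv_into[OF bij])
  have "?\<psi> (a \<otimes>\<^bsub>G\<^esub> b) = ?\<psi> a \<otimes>\<^bsub>H\<^esub> ?\<psi> b" if "a \<in> carrier G" "b \<in> carrier G" for a b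
  proof -
    have ab: "?\<psi> a \<in> carrier H" "?\<psi> b \<in> carrier H" using b that by (auto simp: bij_betw_def)
    then have "\<phi> (?\<psi> a \<otimes>\<^bsub>H\<^esub> ?\<psi> b) = a \<otimes>\<^bsub>G\<^esub> b"
      using hom that bij by (simp add: bij_betw_inv_into_right)
    then show ?thesis using closed[OF ab] bij by (metis bij_betw_inv_into_left)
  qed
  then have "?\<psi> \<in> iso G H" using b by (auto simp: iso_def hom_def bij_betw_def)
  then show ?thesis by (auto simp: is_iso_def)
qed

abbreviation S5S5_on :: "((nat \<Rightarrow> nat) \<times> (nat \<Rightarrow> nat)) set \<Rightarrow> ((nat \<Rightarrow> nat) \<times> (nat \<Rightarrow> nat)) monoid" where
  "S5S5_on A \<equiv> (S5 \<times>\<times> S5)\<lparr>carrier := A\<rparr>"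

lemma Aff2_Times: "Aff2 (P \<times> R) = Aff P \<times> Aff R"
  by (auto simp: Aff2_def Aff_def)

lemma S5S5_on_Times: "S5S5_on (A \<times> B) = S5\<lparr>carrier := A\<rparr> \<times>\<times> S5\<lparr>carrier := B\<rparr>"
  by (simp add: DirProd_def sym_group_def)

lemma bij_betw_Aff2:
  assumes "Q \<subseteq> units5 \<times> units5"
  shows "bij_betw (\<lambda>((u, v), b, c). (aff u b, aff v c)) (Q \<times> {0..4} \<times> {0..4}) (Aff2 Q)"
proof -
  have "inj_on (\<lambda>((u, v), b, c). (aff u b, aff v c)) (Q \<times> {0..4} \<times> {0..4})"
  proof (rule inj_onI)
    fix x y :: "(int \<times> int) \<times> int \<times> int"
    assume xy: "x \<in> Q \<times> {0..4} \<times> {0..4}" "y \<in> Q \<times> {0..4} \<times> {0..4}"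
      "(\<lambda>((u, v), b, c). (aff u b, aff v c)) x = (\<lambda>((u, v), b, c). (aff u b, aff v c)) y"
    obtain u v b c u' v' b' c' where x: "x = ((u, v), b, c)" and y: "y = ((u', v'), b', c')"
      by (metis surj_pair)
    have "(u, v) \<in> Q" "(u', v') \<in> Q" and b: "b \<in> {0..4}" "c \<in> {0..4}" "b' \<in> {0..4}" "c' \<in> {0..4}"
      and eq: "aff u b = aff u' b'" "aff v c = aff v' c'"
      using xy unfolding x y by simp_all
    then have "(u, v) \<in> units5 \<times> units5" "(u', v') \<in> units5 \<times> units5" using assms by blast+
    then have "u mod 5 = u" "v mod 5 = v" "u' mod 5 = u'" "v' mod 5 = v'"
      by (simp_all only: mem_Sigma_iff units5_self_mod)
    moreover have "b mod 5 = b" "c mod 5 = c" "b' mod 5 = b'" "c' mod 5 = c'" using b by auto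
    ultimately show "x = y" using eq unfolding x y by (metis aff_eq_iff)
  qed
  moreover have "(\<lambda>((u, v), b, c). (aff u b, aff v c)) ` (Q \<times> {0..4} \<times> {0..4}) = Aff2 Q"
  proof (intro equalityI subsetI)
    fix g assume "g \<in> Aff2 Q"
    then obtain u b v c where g: "g = (aff u (b mod 5), aff v (c mod 5))" "(u, v) \<in> Q" by (auto simp: Aff2_def)
    have "b mod 5 \<in> {0..4}" "c mod 5 \<in> {0..4}" using pos_mod_bound[of 5 b] pos_mod_bound[of 5 c] by auto
    then show "g \<in> (\<lambda>((u, v), b, c). (aff u b, aff v c)) ` (Q \<times> {0..4} \<times> {0..4})"
      by (intro image_eqI[of _ _ "((u, v), b mod 5, c mod 5)"]) (use g in simp_all)
  qed (auto simp: Aff2_def)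
  ultimately show ?thesis by (simp add: bij_betw_def)
qed

lemma card_Aff2: "Q \<subseteq> units5 \<times> units5 \<Longrightarrow> card (Aff2 Q) = 25 * card Q"
  by (drule bij_betw_Aff2[THEN bij_betw_same_card]) (simp only: card_cartesian_product card_atLeastAtMost_int, simp)

text \<open>The complement acts through two characters \<open>\<mu>\<close> and \<open>\<nu>\<close>
  modulo 5; the pair of translations by \<open>x\<close> and \<open>y\<close> together with
  \<open>r\<close> becomes the pair of affine maps with these offsets and the scalings
  \<open>\<mu> r\<close> and \<open>\<nu> r\<close>.\<close>

lemma Aff2_iso_semidirect:
  fixes K :: "'q monoid" and \<mu> \<nu> :: "'q \<Rightarrow> int"
  assumes Q: "bij_betw (\<lambda>r. (\<mu> r mod 5, \<nu> r mod 5)) (carrier K) Q"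
    and closed: "\<And>r s. r \<in> carrier K \<Longrightarrow> s \<in> carrier K \<Longrightarrow> r \<otimes>\<^bsub>K\<^esub> s \<in> carrier K"
    and mult: "\<And>r s. r \<in> carrier K \<Longrightarrow> s \<in> carrier K \<Longrightarrow>
      \<mu> (r \<otimes>\<^bsub>K\<^esub> s) mod 5 = \<mu> r * \<mu> s mod 5 \<and> \<nu> (r \<otimes>\<^bsub>K\<^esub> s) mod 5 = \<nu> r * \<nu> s mod 5"
    and act: "\<And>r x y. act r (x, y) = (\<mu> r * x mod 5, \<nu> r * y mod 5)"
  shows "S5S5_on (Aff2 Q) \<cong> semidirect (Z 5 \<times>\<times> Z 5) K act"
proof (rule is_iso_if_inverse)
  let ?\<phi> = "\<lambda>((x, y), r). (aff (\<mu> r) x, aff (\<nu> r) y)"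
  let ?H = "semidirect (Z 5 \<times>\<times> Z 5) K act"
  have carr: "carrier ?H = ({0..<5} \<times> {0..<5}) \<times> carrier K"
    by (simp add: semidirect_def DirProd_def carrier_integer_mod_group)
  have m: "((x, y), r) \<otimes>\<^bsub>?H\<^esub> ((x', y'), s) =
      (((x + \<mu> r * x' mod 5) mod 5, (y + \<nu> r * y' mod 5) mod 5), r \<otimes>\<^bsub>K\<^esub> s)" for x y r x' y' s
    by (simp add: semidirect_def DirProd_def act)
  show "a \<otimes>\<^bsub>?H\<^esub> b \<in> carrier ?H" if "a \<in> carrier ?H" "b \<in> carrier ?H" for a b
  proof -
    obtain x y r x' y' s where ab: "a = ((x, y), r)" "b = ((x', y'), s)" "r \<in> carrier K" "s \<in> carrier K"
      using \<open>a \<in> carrier ?H\<close> \<open>b \<in> carrier ?H\<close> unfolding carr by (elim SigmaE) simp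
    show ?thesis unfolding ab(1,2) m carr using closed[OF ab(3,4)] by simp
  qed
  show "?\<phi> (a \<otimes>\<^bsub>?H\<^esub> b) = ?\<phi> a \<otimes>\<^bsub>S5S5_on (Aff2 Q)\<^esub> ?\<phi> b" if "a \<in> carrier ?H" "b \<in> carrier ?H" for a b
  proof -
    obtain x y r x' y' s where ab: "a = ((x, y), r)" "b = ((x', y'), s)" "r \<in> carrier K" "s \<in> carrier K"
      using \<open>a \<in> carrier ?H\<close> \<open>b \<in> carrier ?H\<close> unfolding carr by (elim SigmaE) simp
    show ?thesis unfolding ab(1,2) m
      using mult[OF ab(3,4)] by (simp add: aff_comp aff_eq_iff mod_simps)
  qed
  show "bij_betw ?\<phi> (carrier ?H) (carrier (S5S5_on (Aff2 Q)))"
    unfolding carr bij_betw_def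
  proof (intro conjI)
    show "inj_on ?\<phi> (({0..<5} \<times> {0..<5}) \<times> carrier K)"
    proof (rule inj_onI)
      fix a b
      assume ab: "a \<in> ({0..<5} \<times> {0..<5}) \<times> carrier K" "b \<in> ({0..<5} \<times> {0..<5}) \<times> carrier K" "?\<phi> a = ?\<phi> b"
      obtain x y r x' y' s where a: "a = ((x, y), r)" and b: "b = ((x', y'), s)" by (metis surj_pair)
      have "r = s"
        by (rule inj_onD[OF bij_betw_imp_inj_on[OF Q]]) (use ab in \<open>simp_all add: a b aff_eq_iff\<close>)
      then show "a = b" using ab by (simp add: a b aff_eq_iff)
    qed
    show "?\<phi> ` (({0..<5} \<times> {0..<5}) \<times> carrier K) = carrier (S5S5_on (Aff2 Q))"
    proof (intro equalityI subsetI)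
      fix z assume "z \<in> ?\<phi> ` (({0..<5} \<times> {0..<5}) \<times> carrier K)"
      then obtain x y r where z: "z = (aff (\<mu> r mod 5) x, aff (\<nu> r mod 5) y)" "r \<in> carrier K" by auto
      have "(\<mu> r mod 5, \<nu> r mod 5) \<in> Q" using Q z(2) by (auto simp: bij_betw_def)
      then have "z \<in> Aff2 Q" using z unfolding Aff2_def by blast
      then show "z \<in> carrier (S5S5_on (Aff2 Q))" by simp
    next
      fix z assume "z \<in> carrier (S5S5_on (Aff2 Q))"
      then obtain u b v c where z: "z = (aff u b, aff v c)" "(u, v) \<in> Q" by (auto simp: Aff2_def)
      then obtain r where r: "r \<in> carrier K" "(u, v) = (\<mu> r mod 5, \<nu> r mod 5)" using Q by (auto simp: bij_betw_def)
      then have "z = ?\<phi> ((b mod 5, c mod 5), r)" using z by simp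
      moreover have "((b mod 5, c mod 5), r) \<in> ({0..<5} \<times> {0..<5}) \<times> carrier K" using r by simp
      ultimately show "z \<in> ?\<phi> ` (({0..<5} \<times> {0..<5}) \<times> carrier K)" by (rule image_eqI)
    qed
  qed
qed

lemma atLeastLessThan_int_numerals: "{0..<4} = {0, 1, 2, 3 :: int}" "{0..<2} = {0, 1 :: int}" by auto

text \<open>The set \<open>Q\<close> is the cyclic group generated by \<open>(2, u)\<close>, as 1,
  2, 4, 3 are the successive powers of 2 modulo 5.\<close>

lemma Aff2_iso_C5xC5_C4:
  assumes u: "u \<in> {2, 3, 4}" and Q: "Q = {(1, 1), (2, u), (4, u ^ 2 mod 5), (3, u ^ 3 mod 5)}"
  shows "S5S5_on (Aff2 Q) \<cong> C5xC5_C4 u"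
  unfolding C5xC5_C4_def
proof (rule Aff2_iso_semidirect[where \<mu> = "\<lambda>i. 2 ^ nat i" and \<nu> = "\<lambda>i. u ^ nat i"])
  have carr: "carrier (Z 4) = {0, 1, 2, 3}"
    by (simp add: carrier_integer_mod_group atLeastLessThan_int_numerals)
  show "bij_betw (\<lambda>r. (2 ^ nat r mod 5, u ^ nat r mod 5)) (carrier (Z 4)) Q"
    unfolding carr bij_betw_def using u unfolding Q by (auto simp: inj_on_def)
  show "r \<otimes>\<^bsub>Z 4\<^esub> s \<in> carrier (Z 4)" if "r \<in> carrier (Z 4)" "s \<in> carrier (Z 4)" for r s
    using that by (simp add: carrier_integer_mod_group)
  show "2 ^ nat (r \<otimes>\<^bsub>Z 4\<^esub> s) mod 5 = 2 ^ nat r * 2 ^ nat s mod (5::int) \<and>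
        u ^ nat (r \<otimes>\<^bsub>Z 4\<^esub> s) mod 5 = u ^ nat r * u ^ nat s mod 5"
    if "r \<in> carrier (Z 4)" "s \<in> carrier (Z 4)" for r s
    using that u unfolding carr by (elim insertE emptyE) simp_all
qed simp

lemma Aff2_iso_50_4: "S5S5_on (Aff2 Q_II2) \<cong> SmallGroup_50_4"
  unfolding SmallGroup_50_4_def
proof (rule Aff2_iso_semidirect[where \<mu> = "\<lambda>i. (- 1) ^ nat i" and \<nu> = "\<lambda>i. (- 1) ^ nat i"])
  have carr: "carrier (Z 2) = {0, 1}"
    by (simp add: carrier_integer_mod_group atLeastLessThan_int_numerals)
  show "bij_betw (\<lambda>r. ((- 1) ^ nat r mod 5, (- 1) ^ nat r mod 5)) (carrier (Z 2)) Q_II2"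
    unfolding carr bij_betw_def by (auto simp: inj_on_def)
  show "r \<otimes>\<^bsub>Z 2\<^esub> s \<in> carrier (Z 2)" if "r \<in> carrier (Z 2)" "s \<in> carrier (Z 2)" for r s
    using that by (simp add: carrier_integer_mod_group)
  show "(- 1) ^ nat (r \<otimes>\<^bsub>Z 2\<^esub> s) mod 5 = (- 1) ^ nat r * (- 1) ^ nat s mod (5::int) \<and>
        (- 1) ^ nat (r \<otimes>\<^bsub>Z 2\<^esub> s) mod 5 = (- 1) ^ nat r * (- 1) ^ nat s mod (5::int)"
    if "r \<in> carrier (Z 2)" "s \<in> carrier (Z 2)" for r s
    using that unfolding carr by (elim SigmaE insertE emptyE) simp_all
qed simp

text \<open>The characters 2^i (-1)^j and 2^i differ by a sign, and -1 generates the squares modulo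
  5; so their joint values are the pairs of equal quadratic character.\<close>

lemma Aff2_iso_200_42: "S5S5_on (Aff2 Q_I2) \<cong> SmallGroup_200_42"
  unfolding SmallGroup_200_42_def
proof (rule Aff2_iso_semidirect[where \<mu> = "\<lambda>(i, j). 2 ^ nat i * (- 1) ^ nat j" and \<nu> = "\<lambda>(i, j). 2 ^ nat i"])
  have carr: "carrier (Z 4 \<times>\<times> Z 2) = {0, 1, 2, 3} \<times> {0, 1}"
    by (simp add: carrier_integer_mod_group DirProd_def atLeastLessThan_int_numerals)
  let ?f = "\<lambda>r :: int \<times> int. ((case r of (i, j) \<Rightarrow> 2 ^ nat i * (- 1) ^ nat j) mod 5, (case r of (i, j) \<Rightarrow> 2 ^ nat i) mod 5) :: int \<times> int"
  have img: "?f ` ({0, 1, 2, 3} \<times> {0, 1}) = Q_I2"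
    by (simp add: Sigma_def) auto
  \<comment> \<open>Eight arguments are mapped onto eight pairs.\<close>
  have "inj_on ?f ({0, 1, 2, 3} \<times> {0, 1})"
    by (rule eq_card_imp_inj_on) (simp, simp only: img card_cartesian_product, simp)
  then show "bij_betw ?f (carrier (Z 4 \<times>\<times> Z 2)) Q_I2"
    unfolding carr bij_betw_def using img by blast
  show "r \<otimes>\<^bsub>Z 4 \<times>\<times> Z 2\<^esub> s \<in> carrier (Z 4 \<times>\<times> Z 2)"
    if "r \<in> carrier (Z 4 \<times>\<times> Z 2)" "s \<in> carrier (Z 4 \<times>\<times> Z 2)" for r s
    using that by (cases r; cases s) (simp add: carrier_integer_mod_group)
  show "(case r \<otimes>\<^bsub>Z 4 \<times>\<times> Z 2\<^esub> s of (i, j) \<Rightarrow> 2 ^ nat i * (- 1) ^ nat j) mod 5 =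
        (case r of (i, j) \<Rightarrow> 2 ^ nat i * (- 1) ^ nat j) * (case s of (i, j) \<Rightarrow> 2 ^ nat i * (- 1) ^ nat j) mod (5::int) \<and>
        (case r \<otimes>\<^bsub>Z 4 \<times>\<times> Z 2\<^esub> s of (i, j) \<Rightarrow> 2 ^ nat i) mod 5 =
        (case r of (i, j) \<Rightarrow> 2 ^ nat i) * (case s of (i, j) \<Rightarrow> 2 ^ nat i) mod (5::int)"
    if "r \<in> carrier (Z 4 \<times>\<times> Z 2)" "s \<in> carrier (Z 4 \<times>\<times> Z 2)" for r s
  proof -
    obtain i j i' j' where rs: "r = (i, j)" "s = (i', j')" by (metis surj_pair)
    have ij: "i \<in> {0, 1, 2, 3}" "i' \<in> {0, 1, 2, 3}" "j \<in> {0, 1}" "j' \<in> {0, 1}"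
      using that unfolding carr rs by (simp_all only: mem_Sigma_iff)
    have 1: "2 ^ nat ((i + i') mod 4) mod 5 = 2 ^ nat i * 2 ^ nat i' mod (5::int)"
      using ij(1,2) by (elim insertE emptyE) simp_all
    have 2: "(- 1) ^ nat ((j + j') mod 2) mod 5 = (- 1) ^ nat j * (- 1) ^ nat j' mod (5::int)"
      using ij(3,4) by (elim insertE emptyE) simp_all
    have "2 ^ nat ((i + i') mod 4) * (- 1) ^ nat ((j + j') mod 2) mod 5 =
        (2 ^ nat i * (- 1) ^ nat j) * (2 ^ nat i' * (- 1) ^ nat j') mod (5::int)"
      using mod_mult_cong[OF 1 2] by (simp only: mult.assoc mult.left_commute)
    then show ?thesis unfolding rs mult_DirProd mult_integer_mod_group split_conv of_nat_numeral
      using 1 by (rule conjI)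
  qed
qed auto

section \<open>Orbits on cosets of the diagonal\<close>

text \<open>Modulo 5 this is x \<mapsto> - x^3: it exchanges 1 and -1 and fixes 0 and the two square
  roots of -1.\<close>

definition swap14 :: "nat \<Rightarrow> nat" where
  "swap14 x = (if x = 1 then 4 else if x = 4 then 1 else x)"

text \<open>The map w t(x + c) + b, with the sum \<open>s = b + c\<close> as coordinate in place of
  \<open>c\<close>. Conjugation by a translation shifts \<open>b\<close> and leaves \<open>s\<close>
  unchanged, which makes orbits under conjugation visible.\<close>

definition outer :: "int \<Rightarrow> int \<Rightarrow> int \<Rightarrow> nat \<Rightarrow> nat" where
  "outer w s b = aff w b \<circ> swap14 \<circ> aff 1 (s - b)"

lemma swap14_swap14: "swap14 \<circ> swap14 = id"
  by (auto simp: swap14_def fun_eq_iff)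

lemma swap14_permutes: "swap14 permutes {1..5}"
proof -
  have "bij swap14" using swap14_swap14 o_bij by blast
  then show ?thesis unfolding permutes_def by (auto simp: swap14_def bij_iff)
qed

lemma swap14_aff: assumes "u \<in> units5" shows "swap14 \<circ> aff u 0 = aff (u ^ 3) 0 \<circ> swap14"
proof
  fix x
  show "(swap14 \<circ> aff u 0) x = (aff (u ^ 3) 0 \<circ> swap14) x"
  proof (cases "x \<in> {1, 2, 3, 4, 5}")
    case True
    then show ?thesis using assms
      by (elim insertE emptyE) (simp_all add: swap14_def aff_def res5_def)
  next
    case False
    then have "\<not> (1 \<le> x \<and> x \<le> 5)" by auto
    then show ?thesis by (auto simp: swap14_def aff_def)
  qed
qed

text \<open>Uniqueness of the parameters reduces to this finite check: one full factor F20 on the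
  left and translations on the right act without stabiliser on the transposition.\<close>

lemma swap14_rigid:
  "\<forall>v\<in>units5. \<forall>a\<in>{0, 1, 2, 3, 4}. \<forall>d\<in>{0, 1, 2, 3, 4}.
     (\<forall>x\<in>{1, 2, 3, 4, 5}. aff v a (swap14 (aff 1 d x)) = swap14 x) \<longrightarrow> v = 1 \<and> a = 0 \<and> d = 0"
  by code_simp

text \<open>A nontrivial affine map has at most one fixed point, the transposition has
  three.\<close>

lemma swap14_not_aff:
  "\<forall>v\<in>units5. \<forall>a\<in>{0, 1, 2, 3, 4}. \<not> (\<forall>x\<in>{1, 2, 3, 4, 5}. aff v a x = swap14 x)"
  by code_simp

lemma residue_cases: "(a :: int) mod 5 \<in> {0, 1, 2, 3, 4}"
proof -
  have "0 \<le> a mod 5" "a mod 5 < 5" by simp_all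
  then show ?thesis by auto
qed

lemma outer_permutes: "w \<in> units5 \<Longrightarrow> outer w s b permutes {1..5}"
  unfolding outer_def by (intro permutes_compose aff_permutes swap14_permutes) auto

text \<open>Multiplying by the inverses of the outer factors of one side turns the equation into a
  relation fixing the transposition, to which rigidity applies.\<close>

lemma outer_eqD:
  assumes w: "w \<in> units5" "w' \<in> units5" and eq: "outer w s b = outer w' s' b'"
  shows "w = w' \<and> s mod 5 = s' mod 5 \<and> b mod 5 = b' mod 5"
proof -
  let ?v = "w' ^ 3 * w" and ?a = "- (w' ^ 3) * b' + w' ^ 3 * b" and ?d = "(s - b) - (s' - b')"
  have "aff ?v ?a \<circ> swap14 \<circ> aff 1 ?d =
      aff (w' ^ 3) (- (w' ^ 3) * b') \<circ> outer w s b \<circ> aff 1 (- (s' - b'))"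
  proof -
    have "aff ?v ?a = aff (w' ^ 3) (- (w' ^ 3) * b') \<circ> aff w b" by (simp add: aff_comp)
    moreover have "aff 1 ?d = aff 1 (s - b) \<circ> aff 1 (- (s' - b'))"
      by (simp add: aff_comp algebra_simps)
    ultimately show ?thesis by (simp only: outer_def comp_assoc)
  qed
  also have "\<dots> = (aff (w' ^ 3) (- (w' ^ 3) * b') \<circ> aff w' b') \<circ> swap14 \<circ> (aff 1 (s' - b') \<circ> aff 1 (- (s' - b')))"
    unfolding eq by (simp only: outer_def comp_assoc)
  also have "aff 1 (s' - b') \<circ> aff 1 (- (s' - b')) = id" by (simp add: aff_comp aff_id)
  also have "(aff (w' ^ 3) (- (w' ^ 3) * b') \<circ> aff w' b') \<circ> swap14 \<circ> id = swap14"
    by (simp only: aff_inverse[OF w(2)] id_comp comp_id)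
  finally have *: "aff (?v mod 5) (?a mod 5) \<circ> swap14 \<circ> aff 1 (?d mod 5) = swap14" by (simp only: aff_mod)
  have v: "?v mod 5 \<in> units5" using w by auto
  have "?v mod 5 = 1 \<and> ?a mod 5 = 0 \<and> ?d mod 5 = 0"
  proof (rule swap14_rigid[rule_format])
    show "aff (?v mod 5) (?a mod 5) (swap14 (aff 1 (?d mod 5) x)) = swap14 x" for x
      using fun_cong[OF *, of x] by (simp only: comp_apply)
  qed (rule v residue_cases)+
  then have v1: "?v mod 5 = 1" and a0: "?a mod 5 = 0" and d0: "?d mod 5 = 0" by blast+
  have "aff (w' ^ 3) (- (w' ^ 3) * b') \<circ> aff w b = id"
    using v1 a0 by (simp add: aff_comp aff_eq_iff flip: aff_id)
  then have "aff w' b' \<circ> aff (w' ^ 3) (- (w' ^ 3) * b') \<circ> aff w b = aff w' b'" by (simp add: comp_assoc)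
  then have ab: "w mod 5 = w' mod 5" "b mod 5 = b' mod 5" by (simp_all only: aff_inverse[OF w(2)] id_comp aff_eq_iff)
  then have "(?d + b - b') mod 5 = 0 mod 5" using d0 by (metis mod_add_cong mod_diff_cong mod_0 add_0 diff_self)
  then have "(s - s') mod 5 = 0" by (simp add: algebra_simps)
  then have "s mod 5 = s' mod 5" by (metis diff_add_cancel mod_add_left_eq add_0)
  then show ?thesis using ab units5_self_mod[OF w(1)] units5_self_mod[OF w(2)] by simp
qed

lemma outer_not_Aff: assumes w: "w \<in> units5" shows "outer w s b \<notin> Aff units5"
proof
  assume "outer w s b \<in> Aff units5"
  then obtain v e where v: "v \<in> units5" and eq: "outer w s b = aff v e" by (auto simp: Aff_def)
  have "swap14 = aff (w ^ 3) (- (w ^ 3) * b) \<circ> outer w s b \<circ> aff 1 (- (s - b))"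
  proof -
    have "aff (w ^ 3) (- (w ^ 3) * b) \<circ> outer w s b \<circ> aff 1 (- (s - b)) =
      (aff (w ^ 3) (- (w ^ 3) * b) \<circ> aff w b) \<circ> swap14 \<circ> (aff 1 (s - b) \<circ> aff 1 (- (s - b)))"
      by (simp only: outer_def comp_assoc)
    moreover have "aff 1 (s - b) \<circ> aff 1 (- (s - b)) = id" by (simp add: aff_comp aff_id)
    ultimately show ?thesis by (simp only: aff_inverse[OF w] id_comp comp_id)
  qed
  then obtain v' e' where "swap14 = aff (v' mod 5) (e' mod 5)" and v': "v' = w ^ 3 * v"
    unfolding eq by (simp add: aff_comp)
  moreover have "v' mod 5 \<in> units5" unfolding v' using w v by auto
  ultimately show False using swap14_not_aff residue_cases[of e'] by fastforce
qed

lemma outer_mod: "outer (w mod 5) s b = outer w s b" "outer w (s mod 5) b = outer w s b" "outer w s (b mod 5) = outer w s b"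
proof -
  show "outer (w mod 5) s b = outer w s b" by (simp add: outer_def)
  have "aff 1 (s mod 5 - b) = aff 1 (s - b)" "aff 1 (s - b mod 5) = aff 1 (s - b)" by (simp_all add: aff_eq_iff mod_simps)
  then show "outer w (s mod 5) b = outer w s b" "outer w s (b mod 5) = outer w s b" by (simp_all add: outer_def)
qed

text \<open>Since \<open>u t u = t\<close> for the transposition \<open>t\<close> and every scaling \<open>u\<close>, the pair of scalings
  \<open>(u, v)\<close> multiplies the class \<open>w\<close> of \<open>outer w s b\<close> by \<open>u v\<close>, while it multiplies that of
  \<open>aff w e\<close> by \<open>u / v\<close>.\<close>

lemma outer_act:
  assumes v: "v \<in> units5"
  shows "aff u b0 \<circ> outer w s b \<circ> inv' (aff v c0) = outer (u * v * w) (b0 + u * b - c0 + v * (s - b)) (b0 + u * b)"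
proof -
  let ?z = "- (v ^ 3) * c0 + (s - b)"
  have v4: "v ^ 3 * v mod 5 = 1" by (rule units5_fourth_power[OF v])
  have "aff 1 (s - b) \<circ> inv' (aff v c0) = aff (v ^ 3) (s - b + - (v ^ 3) * c0)"
    unfolding inv_aff[OF v] by (simp add: aff_comp)
  \<comment> \<open>The scaling \<open>v ^ 3\<close>, inverse to \<open>v\<close>, is pulled to the
    left of the translation; passing through the transposition it is inverted once more and becomes
    \<open>v\<close>.\<close>
  also have "\<dots> = aff (v ^ 3) 0 \<circ> aff 1 (v * ?z)"
  proof -
    have "v ^ 3 * (v * ?z) mod 5 = (v ^ 3 * v mod 5) * ?z mod 5" by (simp only: mult.assoc mod_mult_left_eq)
    then have "v ^ 3 * (v * ?z) mod 5 = ?z mod 5" unfolding v4 by simp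
    then show ?thesis unfolding aff_comp aff_eq_iff by (simp add: add.commute)
  qed
  finally have 1: "aff 1 (s - b) \<circ> inv' (aff v c0) = aff (v ^ 3) 0 \<circ> aff 1 (v * ?z)" .
  have v3: "v ^ 3 mod 5 \<in> units5" using v by auto
  have "swap14 \<circ> aff (v ^ 3) 0 = aff ((v ^ 3 mod 5) ^ 3) 0 \<circ> swap14"
    using swap14_aff[OF v3] by simp
  moreover have "(v ^ 3 mod 5) ^ 3 mod 5 = v mod 5" using v by auto
  ultimately have 2: "swap14 \<circ> aff (v ^ 3) 0 = aff v 0 \<circ> swap14" by (metis aff_eq_iff)
  have "aff u b0 \<circ> outer w s b \<circ> inv' (aff v c0) = (aff u b0 \<circ> aff w b) \<circ> swap14 \<circ> (aff 1 (s - b) \<circ> inv' (aff v c0))"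
    by (simp only: outer_def comp_assoc)
  also have "\<dots> = (aff u b0 \<circ> aff w b) \<circ> (swap14 \<circ> aff (v ^ 3) 0) \<circ> aff 1 (v * ?z)"
    unfolding 1 by (simp only: comp_assoc)
  also have "\<dots> = (aff u b0 \<circ> aff w b \<circ> aff v 0) \<circ> swap14 \<circ> aff 1 (v * ?z)"
    unfolding 2 by (simp only: comp_assoc)
  also have "aff u b0 \<circ> aff w b \<circ> aff v 0 = aff (u * v * w) (b0 + u * b)" by (simp add: aff_comp ac_simps)
  also have "aff 1 (v * ?z) = aff 1 ((b0 + u * b - c0 + v * (s - b)) - (b0 + u * b))"
  proof -
    have "v * ?z = - (v ^ 3 * v * c0) + v * (s - b)" by (simp add: algebra_simps)
    moreover have "v ^ 3 * v * c0 mod 5 = c0 mod 5" using v4 by (metis mod_mult_left_eq mult_1)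
    ultimately have "v * ?z mod 5 = (- c0 + v * (s - b)) mod 5" by (metis mod_add_left_eq mod_minus_eq)
    then show ?thesis by (simp add: aff_eq_iff)
  qed
  finally show ?thesis by (simp only: outer_def)
qed

lemma aff_act:
  assumes v: "v \<in> units5"
  shows "aff u b \<circ> aff w e \<circ> inv' (aff v c) = aff (u * w * v ^ 3) (b + u * e - u * w * v ^ 3 * c)"
  unfolding inv_aff[OF v] by (simp add: aff_comp algebra_simps)

text \<open>Surjectivity by counting: 4 * 5 * 5 distinct maps outside F20 fill the 120 - 20
  remaining permutations.\<close>

lemma outer_image: "(\<lambda>(w, s, b). outer w s b) ` (units5 \<times> {0..4} \<times> {0..4}) = carrier S5 - Aff units5"
  and inj_outer: "inj_on (\<lambda>(w, s, b). outer w s b) (units5 \<times> {0..4} \<times> {0..4})"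
proof -
  let ?f = "\<lambda>(w, s, b). outer w s b" and ?Y = "units5 \<times> {0..4 :: int} \<times> {0..4 :: int}"
  show inj: "inj_on ?f ?Y"
  proof (rule inj_onI)
    fix x y assume xy: "x \<in> ?Y" "y \<in> ?Y" "?f x = ?f y"
    obtain w s b w' s' b' where x: "x = (w, s, b)" and y: "y = (w', s', b')" by (metis surj_pair)
    have w: "w \<in> units5" "w' \<in> units5" and b: "s \<in> {0..4}" "b \<in> {0..4}" "s' \<in> {0..4}" "b' \<in> {0..4}"
      using xy(1,2) unfolding x y mem_Sigma_iff by blast+
    have "w = w' \<and> s mod 5 = s' mod 5 \<and> b mod 5 = b' mod 5"
      by (rule outer_eqD[OF w]) (use xy(3) in \<open>simp add: x y\<close>)
    then show "x = y" using b unfolding x y by auto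
  qed
  have sub: "?f ` ?Y \<subseteq> carrier S5 - Aff units5"
  proof
    fix g assume "g \<in> ?f ` ?Y"
    then obtain w s b where "g = outer w s b" "w \<in> units5" by (elim imageE SigmaE) simp
    then show "g \<in> carrier S5 - Aff units5" using outer_permutes outer_not_Aff by simp
  qed
  have fin: "finite (carrier S5)" by (simp add: finite_permutations)
  have A: "Aff units5 \<subseteq> carrier S5" using aff_permutes by (auto simp: Aff_def simp del: insert_iff)
  have "card (carrier S5 - Aff units5) = card (carrier S5) - card (Aff units5)"
    by (rule card_Diff_subset[OF finite_subset[OF A fin] A])
  also have "card (carrier S5) = 120"
    using card_permutations[of "{1..5::nat}" 5] by (simp add: fact_numeral)
  also have "card (Aff units5) = 20" using card_Aff[of units5] by simp
  finally have "card (carrier S5 - Aff units5) = 100" by simp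
  moreover have "card (?f ` ?Y) = 100" using card_image[OF inj] by (simp only: card_cartesian_product) simp
  ultimately show "?f ` ?Y = carrier S5 - Aff units5"
    using card_subset_eq[OF _ sub] fin by simp
qed

text \<open>The coordinate in \<open>T\<close> can be moved freely within each orbit, so an orbit is
  a class in \<open>Y\<close> times all of \<open>T\<close>. Counting orbits becomes counting
  classes, with one representative of each in \<open>rs\<close>.\<close>

lemma orbit_count:
  assumes inj: "inj_on \<phi> (Y \<times> T)" and T: "T \<noteq> {}"
    and orb: "\<And>y b. y \<in> Y \<Longrightarrow> b \<in> T \<Longrightarrow> orb (\<phi> (y, b)) = \<phi> ` (c y \<times> T)"
    and c: "\<And>y. y \<in> Y \<Longrightarrow> c y \<subseteq> Y"
    and reps: "set rs \<subseteq> Y" "c ` Y = c ` set rs" "distinct (map c rs)"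
  shows "image_mset card (mset_set (orb ` \<phi> ` (Y \<times> T))) = mset (map (\<lambda>r. card (c r) * card T) rs)"
proof -
  let ?o = "\<lambda>A. \<phi> ` (A \<times> T)"
  have "orb ` \<phi> ` (Y \<times> T) = (\<lambda>y. ?o (c y)) ` Y"
  proof (intro equalityI subsetI)
    fix A assume "A \<in> orb ` \<phi> ` (Y \<times> T)"
    then obtain y b where "y \<in> Y" "b \<in> T" "A = orb (\<phi> (y, b))" by (elim imageE SigmaE) simp
    then show "A \<in> (\<lambda>y. ?o (c y)) ` Y" using orb by (intro image_eqI[of _ _ y]) simp_all
  next
    fix A assume "A \<in> (\<lambda>y. ?o (c y)) ` Y"
    then obtain y where y: "y \<in> Y" "A = ?o (c y)" by (rule imageE)
    obtain b where "b \<in> T" using T by blast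
    then show "A \<in> orb ` \<phi> ` (Y \<times> T)" unfolding y(2) orb[OF y(1) \<open>b \<in> T\<close>, symmetric] using y(1) by (intro imageI) simp
  qed
  also have "\<dots> = ?o ` c ` set rs" unfolding reps(2)[symmetric] by (simp add: image_image)
  finally have eq: "orb ` \<phi> ` (Y \<times> T) = ?o ` c ` set rs" .
  have inj_o: "inj_on ?o (c ` set rs)"
  proof (rule inj_onI)
    fix A B assume AB: "A \<in> c ` set rs" "B \<in> c ` set rs" "?o A = ?o B"
    then have "A \<times> T \<subseteq> Y \<times> T" "B \<times> T \<subseteq> Y \<times> T" using c reps(1) by blast+
    then have "A \<times> T = B \<times> T" using inj_on_image_eq_iff[OF inj] AB(3) by (simp only:)
    then show "A = B" using T by (simp only: times_eq_iff simp_thms) auto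
  qed
  have "mset_set (c ` set rs) = mset (map c rs)" using mset_set_set[OF reps(3)] by simp
  moreover have "mset_set (?o ` c ` set rs) = image_mset ?o (mset_set (c ` set rs))"
    by (rule image_mset_mset_set[OF inj_o, symmetric])
  ultimately have "image_mset card (mset_set (orb ` \<phi> ` (Y \<times> T))) = image_mset (\<lambda>r. card (?o (c r))) (mset rs)"
    unfolding eq by (simp add: image_mset.compositionality comp_def)
  also have "\<dots> = image_mset (\<lambda>r. card (c r) * card T) (mset rs)"
  proof (rule image_mset_cong)
    fix r assume "r \<in># mset rs"
    then have "c r \<times> T \<subseteq> Y \<times> T" using c reps(1) by auto
    then show "card (?o (c r)) = card (c r) * card T"
      using card_image[OF inj_on_subset[OF inj]] by (simp add: card_cartesian_product)
  qed
  finally show ?thesis by simp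
qed

lemma diagonal_subgroup:
  assumes "U = diagonal F20 \<or> U = diagonal S5"
  obtains V where "U = {(f, f) | f. f \<in> V}" "subgroup V S5" "Aff units5 \<subseteq> V"
proof -
  interpret group S5 by (rule group_S5)
  have A: "subgroup (Aff units5) S5" by (rule subgroup_Aff) (simp add: unit_subgroup_def)
  from assms show ?thesis
  proof
    assume "U = diagonal F20"
    then have "U = {(f, f) | f. f \<in> Aff units5}" by (simp add: diagonal_def F20_eq)
    then show ?thesis using that[OF _ A] by blast
  next
    assume "U = diagonal S5"
    then have "U = {(f, f) | f. f \<in> carrier S5}" by (simp add: diagonal_def)
    then show ?thesis using that[OF _ subgroup_self] subgroup.subset[OF A] by blast
  qed
qed

text \<open>Covers both admissible stabilisers: all that matters is that \<open>U\<close> is the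
  diagonal of a subgroup containing F20.\<close>

locale diagonal_cosets =
  fixes U V
  assumes U: "U = {(f, f) | f. f \<in> V}" and V: "subgroup V S5" and F20_V: "Aff units5 \<subseteq> V"
begin

definition coset :: "(nat \<Rightarrow> nat) \<Rightarrow> ((nat \<Rightarrow> nat) \<times> (nat \<Rightarrow> nat)) set" where
  "coset x = {(x \<circ> f, f) | f. f \<in> V}"

lemma V_facts: "id \<in> V" "f \<in> V \<Longrightarrow> g \<in> V \<Longrightarrow> f \<circ> g \<in> V" "f \<in> V \<Longrightarrow> inv' f \<in> V"
  "f \<in> V \<Longrightarrow> f \<circ> inv' f = id" "f \<in> V \<Longrightarrow> inv' f \<circ> f = id"
proof -
  have per: "f permutes {1..5}" if "f \<in> V" for f using subgroup.subset[OF V] that by auto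
  show "id \<in> V" using subgroup.one_closed[OF V] by (simp only: S5_simps)
  show "f \<circ> g \<in> V" if "f \<in> V" "g \<in> V" using subgroup.m_closed[OF V that] by (simp only: S5_simps)
  show "inv' f \<in> V" if "f \<in> V" using subgroup.m_inv_closed[OF V that] inv_S5[OF per[OF that]] by (simp only:)
  show "f \<circ> inv' f = id" "inv' f \<circ> f = id" if "f \<in> V" using permutes_inv_o[OF per[OF that]] by blast+
qed

lemma inj_coset: "inj coset"
proof (rule injI)
  fix x y assume "coset x = coset y"
  moreover have "(x, id) \<in> coset x" unfolding coset_def using V_facts(1) by force
  ultimately show "x = y" unfolding coset_def by auto
qed

text \<open>Right multiplication by a diagonal element normalises the second component to the
  identity, so the coset is labelled by the quotient \<open>g \<circ> inv' h\<close>.\<close>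

lemma l_coset_U: assumes "h \<in> V" shows "(g, h) <#\<^bsub>S5 \<times>\<times> S5\<^esub> U = coset (g \<circ> inv' h)"
proof (intro equalityI subsetI)
  fix z assume "z \<in> (g, h) <#\<^bsub>S5 \<times>\<times> S5\<^esub> U"
  then obtain f where f: "f \<in> V" "z = (g \<circ> f, h \<circ> f)" by (auto simp: l_coset_def U)
  have "g \<circ> inv' h \<circ> (h \<circ> f) = g \<circ> (inv' h \<circ> h) \<circ> f" by (simp only: comp_assoc)
  then have "z = (g \<circ> inv' h \<circ> (h \<circ> f), h \<circ> f)" using f(2) V_facts(5)[OF assms] by simp
  then show "z \<in> coset (g \<circ> inv' h)" unfolding coset_def using V_facts(2)[OF assms f(1)] by blast
next
  fix z assume "z \<in> coset (g \<circ> inv' h)"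
  then obtain f where f: "f \<in> V" "z = (g \<circ> inv' h \<circ> f, f)" unfolding coset_def by blast
  have "f = (h \<circ> inv' h) \<circ> f" using V_facts(4)[OF assms] by simp
  then have "z = (g \<circ> (inv' h \<circ> f), h \<circ> (inv' h \<circ> f))" using f(2) by (simp add: comp_assoc)
  moreover have "inv' h \<circ> f \<in> V" by (intro V_facts assms f)
  ultimately show "z \<in> (g, h) <#\<^bsub>S5 \<times>\<times> S5\<^esub> U" unfolding l_coset_def U by auto
qed

lemma l_coset_coset:
  assumes h: "h \<in> V" shows "(g, h) <#\<^bsub>S5 \<times>\<times> S5\<^esub> coset x = coset (g \<circ> x \<circ> inv' h)"
proof -
  have "(g, h) <#\<^bsub>S5 \<times>\<times> S5\<^esub> coset x = (g \<circ> x, h) <#\<^bsub>S5 \<times>\<times> S5\<^esub> U"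
    unfolding l_coset_def coset_def U by (fastforce simp: comp_assoc)
  then show ?thesis using l_coset_U[OF h] by simp
qed

lemma index_R1_eq: "index_R1 U = coset ` Aff units5"
proof (intro equalityI subsetI)
  have A: "subgroup (Aff units5) S5" by (rule subgroup_Aff) (simp add: unit_subgroup_def)
  fix C assume "C \<in> index_R1 U"
  then obtain g h where gh: "g \<in> Aff units5" "h \<in> Aff units5" "C = (g, h) <#\<^bsub>S5 \<times>\<times> S5\<^esub> U"
    unfolding index_R1_def cosets_in_def F20_eq by auto
  then have "C = coset (g \<circ> inv' h)" using l_coset_U F20_V by blast
  moreover have "h permutes {1..5}" using gh(2) subgroup.subset[OF A] by auto
  then have "g \<circ> inv' h \<in> Aff units5"
    using subgroup.m_closed[OF A gh(1) subgroup.m_inv_closed[OF A gh(2)]] by (simp only: inv_S5 S5_simps)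
  ultimately show "C \<in> coset ` Aff units5" by blast
next
  fix C assume "C \<in> coset ` Aff units5"
  then obtain g where g: "g \<in> Aff units5" "C = coset g" by blast
  have i: "id \<in> Aff units5" unfolding aff_id[symmetric] Aff_def by blast
  have "C = (g, id) <#\<^bsub>S5 \<times>\<times> S5\<^esub> U" using l_coset_U[OF V_facts(1), of g] g by (simp add: inv_id)
  moreover have "(g, id) \<in> carrier (F20 \<times>\<times> F20)" using g i by (simp add: F20_eq)
  ultimately show "C \<in> index_R1 U" unfolding index_R1_def cosets_in_def by blast
qed

text \<open>Already with trivial second component the labels exhaust all of S5, so the 120 cosets
  are the same label set for either stabiliser; removing the affine labels leaves the nontrivial
  double coset.\<close>

lemma index_R2_eq: "index_R2 U = coset ` (carrier S5 - Aff units5)"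
proof -
  have A: "subgroup (Aff units5) S5" by (rule subgroup_Aff) (simp add: unit_subgroup_def)
  have "index_R U = coset ` carrier S5"
  proof (intro equalityI subsetI)
    fix C assume "C \<in> index_R U"
    then obtain g h where gh: "g permutes {1..5}" "h \<in> Aff units5" "C = (g, h) <#\<^bsub>S5 \<times>\<times> S5\<^esub> U"
      unfolding index_R_def cosets_in_def F20_eq by auto
    then have "C = coset (g \<circ> inv' h)" using l_coset_U F20_V by blast
    moreover have "h permutes {1..5}" using gh(2) subgroup.subset[OF A] by auto
    then have "g \<circ> inv' h permutes {1..5}" using gh(1) permutes_compose permutes_inv by blast
    ultimately show "C \<in> coset ` carrier S5" by simp
  next
    fix C assume "C \<in> coset ` carrier S5"
    then obtain g where g: "g permutes {1..5}" "C = coset g" by auto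
    have i: "id \<in> Aff units5" unfolding aff_id[symmetric] Aff_def by blast
    have "C = (g, id) <#\<^bsub>S5 \<times>\<times> S5\<^esub> U" using l_coset_U[OF V_facts(1), of g] g by (simp add: inv_id)
    moreover have "(g, id) \<in> carrier (S5 \<times>\<times> F20)" using g i by (simp add: F20_eq)
    ultimately show "C \<in> index_R U" unfolding index_R_def cosets_in_def by blast
  qed
  then show ?thesis unfolding index_R2_def index_R1_eq by (simp only: image_set_diff[OF inj_coset])
qed

end

text \<open>Orbit of a unit \<open>w\<close> under multiplication by u / v; the inverse of
  \<open>v\<close> is spelled out as a triple product to suit evaluation.\<close>

definition class1 :: "(int \<times> int) set \<Rightarrow> int \<Rightarrow> int set" where
  "class1 Q w = (\<lambda>(u, v). u * w * (v * v * v) mod 5) ` Q"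

definition class2 :: "(int \<times> int) set \<Rightarrow> int \<Rightarrow> int set" where
  "class2 Q w = (\<lambda>(u, v). u * v * w mod 5) ` Q"

text \<open>Conjugacy of x \<mapsto> w x + e: for w = 1 translations act trivially and only scalings
  change \<open>e\<close>; for any other \<open>w\<close> the offset can be moved anywhere, as 1 - w
  is invertible.\<close>

definition conj_class1 :: "int set \<Rightarrow> int \<times> int \<Rightarrow> (int \<times> int) set" where
  "conj_class1 P = (\<lambda>(w, e). if w = 1 then (\<lambda>u. (1, u * e mod 5)) ` P else {w} \<times> {0, 1, 2, 3, 4})"

text \<open>Conjugation by \<open>aff u b\<close> multiplies \<open>w\<close> by the square of
  \<open>u\<close> and \<open>s\<close> by \<open>u\<close>; the third coordinate of
  \<open>outer\<close> is free and is left out.\<close>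

definition conj_class2 :: "int set \<Rightarrow> int \<times> int \<Rightarrow> (int \<times> int) set" where
  "conj_class2 P = (\<lambda>(w, s). (\<lambda>u. (u * u * w mod 5, u * s mod 5)) ` P)"

lemma residue_interval: "(a :: int) mod 5 \<in> {0..4}"
  using pos_mod_bound[of 5 a] by auto

context diagonal_cosets
begin

lemma decomp_type_eq:
  "decomp_type G I = image_mset card (mset_set ((\<lambda>C. {\<gamma> <#\<^bsub>S5 \<times>\<times> S5\<^esub> C | \<gamma>. \<gamma> \<in> carrier G}) ` I))"
proof -
  have "orbits G I (\<lambda>\<gamma> C. \<gamma> <#\<^bsub>S5 \<times>\<times> S5\<^esub> C) = (\<lambda>C. {\<gamma> <#\<^bsub>S5 \<times>\<times> S5\<^esub> C | \<gamma>. \<gamma> \<in> carrier G}) ` I"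
    unfolding orbits_def orbit_def by blast
  then show ?thesis by (simp only: decomp_type_def)
qed

lemma orbit_coset:
  assumes "\<And>g h. (g, h) \<in> A \<Longrightarrow> h \<in> V"
  shows "{\<gamma> <#\<^bsub>S5 \<times>\<times> S5\<^esub> coset x | \<gamma>. \<gamma> \<in> carrier (S5S5_on A)} = coset ` {g \<circ> x \<circ> inv' h | g h. (g, h) \<in> A}"
proof (intro equalityI subsetI)
  fix C assume "C \<in> {\<gamma> <#\<^bsub>S5 \<times>\<times> S5\<^esub> coset x | \<gamma>. \<gamma> \<in> carrier (S5S5_on A)}"
  then obtain g h where "(g, h) \<in> A" "C = (g, h) <#\<^bsub>S5 \<times>\<times> S5\<^esub> coset x" by auto
  then show "C \<in> coset ` {g \<circ> x \<circ> inv' h | g h. (g, h) \<in> A}" using l_coset_coset[OF assms] by blast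
next
  fix C assume "C \<in> coset ` {g \<circ> x \<circ> inv' h | g h. (g, h) \<in> A}"
  then obtain g h where gh: "(g, h) \<in> A" "C = coset (g \<circ> x \<circ> inv' h)" by blast
  then have "C = (g, h) <#\<^bsub>S5 \<times>\<times> S5\<^esub> coset x" using l_coset_coset[OF assms[OF gh(1)]] by simp
  then show "C \<in> {\<gamma> <#\<^bsub>S5 \<times>\<times> S5\<^esub> coset x | \<gamma>. \<gamma> \<in> carrier (S5S5_on A)}" using gh(1) by auto
qed

lemma Aff2_in_V:
  assumes "Q \<subseteq> units5 \<times> units5" "(g, h) \<in> Aff2 Q" shows "h \<in> V"
proof -
  obtain u b v c where "(u, v) \<in> Q" "h = aff v c" using assms(2) unfolding Aff2_def by blast
  then have "h \<in> Aff units5" using assms(1) unfolding Aff_def by blast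
  then show ?thesis using F20_V by blast
qed

text \<open>Translations on both sides make the offset free, which accounts for the factor 5; only
  the class of the scaling is an invariant.\<close>

lemma decomp_type_Aff2_R1:
  assumes Q: "Q \<subseteq> units5 \<times> units5" and reps: "set rs \<subseteq> units5" "class1 Q ` units5 = class1 Q ` set rs" "distinct (map (class1 Q) rs)"
  shows "decomp_type (S5S5_on (Aff2 Q)) (index_R1 U) = mset (map (\<lambda>r. card (class1 Q r) * 5) rs)"
proof -
  let ?\<phi> = "\<lambda>(w, e). coset (aff w e)"
  let ?orb = "\<lambda>C. {\<gamma> <#\<^bsub>S5 \<times>\<times> S5\<^esub> C | \<gamma>. \<gamma> \<in> carrier (S5S5_on (Aff2 Q))}"
  have I: "index_R1 U = ?\<phi> ` (units5 \<times> {0..4})"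
    unfolding index_R1_eq bij_betw_imp_surj_on[OF bij_betw_Aff, OF order_refl, symmetric] image_image
    by (simp only: split_def)
  have "image_mset card (mset_set (?orb ` ?\<phi> ` (units5 \<times> {0..4}))) = mset (map (\<lambda>r. card (class1 Q r) * card {0..4::int}) rs)"
  proof (rule orbit_count[OF _ _ _ _ reps])
    show "inj_on ?\<phi> (units5 \<times> {0..4})"
      using comp_inj_on[OF bij_betw_imp_inj_on[OF bij_betw_Aff, OF order_refl] inj_on_subset[OF inj_coset]]
      by (simp add: comp_def split_def)
    show "class1 Q y \<subseteq> units5" if y: "y \<in> units5" for y
    proof
      fix x assume "x \<in> class1 Q y"
      then obtain u v where uv: "(u, v) \<in> Q" "x = u * y * (v * v * v) mod 5" unfolding class1_def by auto
      then have "u \<in> units5" "v \<in> units5" using Q by blast+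
      then have "(u * y mod 5) * ((v * v mod 5) * v mod 5) mod 5 \<in> units5" by (intro units5_mult y)
      then show "x \<in> units5" unfolding uv by (simp only: mod_simps)
    qed
    fix w e :: int assume w: "w \<in> units5" and e: "e \<in> {0..4}"
    have "{g \<circ> aff w e \<circ> inv' h | g h. (g, h) \<in> Aff2 Q} = (\<lambda>(w, e). aff w e) ` (class1 Q w \<times> {0..4})"
    proof (intro equalityI subsetI)
      fix x assume "x \<in> {g \<circ> aff w e \<circ> inv' h | g h. (g, h) \<in> Aff2 Q}"
      then obtain u b v c where uv: "(u, v) \<in> Q" "x = aff u b \<circ> aff w e \<circ> inv' (aff v c)" unfolding Aff2_def by blast
      then have v: "v \<in> units5" using Q by blast
      let ?w = "u * w * (v * v * v)" and ?e = "b + u * e - u * w * (v * v * v) * c"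
      have "x = aff (?w mod 5) (?e mod 5)" unfolding uv(2) aff_act[OF v] by (simp add: power3_eq_cube)
      moreover have "?w mod 5 \<in> class1 Q w" unfolding class1_def using uv(1) by (intro image_eqI[of _ _ "(u, v)"]) auto
      ultimately show "x \<in> (\<lambda>(w, e). aff w e) ` (class1 Q w \<times> {0..4})"
        by (intro image_eqI[of _ _ "(?w mod 5, ?e mod 5)"]) (simp_all only: split_conv mem_Sigma_iff residue_interval simp_thms)
    next
      fix x assume "x \<in> (\<lambda>(w, e). aff w e) ` (class1 Q w \<times> {0..4})"
      then obtain w' e' where x: "x = aff w' e'" "w' \<in> class1 Q w" by auto
      then obtain u v where uv: "(u, v) \<in> Q" "w' = u * w * (v * v * v) mod 5" unfolding class1_def by auto
      then have v: "v \<in> units5" using Q by blast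
      \<comment> \<open>The left offset alone can be tuned to reach any prescribed
        \<open>e'\<close>.\<close>
      have "x = aff u (e' - u * e) \<circ> aff w e \<circ> inv' (aff v 0)"
        unfolding aff_act[OF v] x uv(2) by (simp add: power3_eq_cube)
      then show "x \<in> {g \<circ> aff w e \<circ> inv' h | g h. (g, h) \<in> Aff2 Q}" unfolding Aff2_def using uv(1) by blast
    qed
    moreover have "?orb (coset (aff w e)) = coset ` {g \<circ> aff w e \<circ> inv' h | g h. (g, h) \<in> Aff2 Q}"
      by (rule orbit_coset) (rule Aff2_in_V[OF Q])
    ultimately show "?orb (?\<phi> (w, e)) = ?\<phi> ` (class1 Q w \<times> {0..4})"
      by (simp only: split_conv image_image) (simp only: split_def)
  qed simp
  then show ?thesis unfolding decomp_type_eq I by simp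
qed

text \<open>Left and right translations now move two independent offsets, hence the factor
  25.\<close>

lemma decomp_type_Aff2_R2:
  assumes Q: "Q \<subseteq> units5 \<times> units5" and reps: "set rs \<subseteq> units5" "class2 Q ` units5 = class2 Q ` set rs" "distinct (map (class2 Q) rs)"
  shows "decomp_type (S5S5_on (Aff2 Q)) (index_R2 U) = mset (map (\<lambda>r. card (class2 Q r) * 25) rs)"
proof -
  let ?\<phi> = "\<lambda>(w, s, b). coset (outer w s b)" and ?T = "{0..4::int} \<times> {0..4::int}"
  let ?orb = "\<lambda>C. {\<gamma> <#\<^bsub>S5 \<times>\<times> S5\<^esub> C | \<gamma>. \<gamma> \<in> carrier (S5S5_on (Aff2 Q))}"
  have I: "index_R2 U = ?\<phi> ` (units5 \<times> ?T)"
    unfolding index_R2_eq outer_image[symmetric] image_image by (simp only: split_def)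
  have "image_mset card (mset_set (?orb ` ?\<phi> ` (units5 \<times> ?T))) = mset (map (\<lambda>r. card (class2 Q r) * card ?T) rs)"
  proof (rule orbit_count[OF _ _ _ _ reps])
    show "inj_on ?\<phi> (units5 \<times> ?T)"
      using comp_inj_on[OF inj_outer inj_on_subset[OF inj_coset]] by (simp add: comp_def split_def)
    show "class2 Q y \<subseteq> units5" if y: "y \<in> units5" for y
    proof
      fix x assume "x \<in> class2 Q y"
      then obtain u v where uv: "(u, v) \<in> Q" "x = u * v * y mod 5" unfolding class2_def by auto
      then have "u \<in> units5" "v \<in> units5" using Q by blast+
      then have "(u * v mod 5) * y mod 5 \<in> units5" by (intro units5_mult y)
      then show "x \<in> units5" unfolding uv by (simp only: mod_simps)
    qed
    fix w :: int and sb :: "int \<times> int" assume w: "w \<in> units5" and sb: "sb \<in> ?T"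
    obtain s b where sb: "sb = (s, b)" by fastforce
    have "{g \<circ> outer w s b \<circ> inv' h | g h. (g, h) \<in> Aff2 Q} = (\<lambda>(w, s, b). outer w s b) ` (class2 Q w \<times> ?T)"
    proof (intro equalityI subsetI)
      fix x assume "x \<in> {g \<circ> outer w s b \<circ> inv' h | g h. (g, h) \<in> Aff2 Q}"
      then obtain u b0 v c0 where uv: "(u, v) \<in> Q" "x = aff u b0 \<circ> outer w s b \<circ> inv' (aff v c0)" unfolding Aff2_def by blast
      then have v: "v \<in> units5" using Q by blast
      let ?w = "u * v * w" and ?s = "b0 + u * b - c0 + v * (s - b)" and ?b = "b0 + u * b"
      have "x = outer (?w mod 5) (?s mod 5) (?b mod 5)" unfolding uv(2) outer_act[OF v] outer_mod ..
      moreover have "?w mod 5 \<in> class2 Q w" unfolding class2_def using uv(1) by (intro image_eqI[of _ _ "(u, v)"]) auto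
      ultimately show "x \<in> (\<lambda>(w, s, b). outer w s b) ` (class2 Q w \<times> ?T)"
        by (intro image_eqI[of _ _ "(?w mod 5, ?s mod 5, ?b mod 5)"]) (simp_all only: split_conv mem_Sigma_iff residue_interval simp_thms)
    next
      fix x assume "x \<in> (\<lambda>(w, s, b). outer w s b) ` (class2 Q w \<times> ?T)"
      then obtain w' s' b' where x: "x = outer w' s' b'" "w' \<in> class2 Q w" by auto
      then obtain u v where uv: "(u, v) \<in> Q" "w' = u * v * w mod 5" unfolding class2_def by auto
      then have v: "v \<in> units5" using Q by blast
      \<comment> \<open>The left offset is solved from \<open>b'\<close>; with it fixed, the right
        offset is solved from \<open>s'\<close>.\<close>
      have "x = aff u (b' - u * b) \<circ> outer w s b \<circ> inv' (aff v (b' + v * (s - b) - s'))"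
        unfolding outer_act[OF v] x uv(2) outer_mod by (simp add: algebra_simps)
      then show "x \<in> {g \<circ> outer w s b \<circ> inv' h | g h. (g, h) \<in> Aff2 Q}" unfolding Aff2_def using uv(1) by blast
    qed
    moreover have "?orb (coset (outer w s b)) = coset ` {g \<circ> outer w s b \<circ> inv' h | g h. (g, h) \<in> Aff2 Q}"
      by (rule orbit_coset) (rule Aff2_in_V[OF Q])
    ultimately show "?orb (?\<phi> (w, sb)) = ?\<phi> ` (class2 Q w \<times> ?T)"
      by (simp only: sb split_conv image_image) (simp only: split_def)
  qed simp
  then show ?thesis unfolding decomp_type_eq I by simp
qed

text \<open>The pair satisfies \<open>h \<circ> k = k \<circ> g\<close> with
  \<open>k = aff d f\<close>, so after relabelling cosets by right multiplication with
  \<open>inv' k\<close> the action is plain conjugation by \<open>g\<close>.\<close>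

lemma twisted_diag_conj:
  assumes d: "d \<in> units5" and P: "P \<subseteq> units5" and gh: "(g, h) \<in> twisted_diag P d f"
  shows "h \<in> V" "g \<circ> (x \<circ> inv' (aff d f)) \<circ> inv' h = g \<circ> x \<circ> inv' g \<circ> inv' (aff d f)"
proof -
  let ?k = "aff d f"
  obtain u b where u: "u \<in> P" "g = aff u b" "h = aff u (d * b + (1 - u) * f)" using gh unfolding twisted_diag_def by blast
  have u5: "u \<in> units5" using u P by blast
  have hV: "h \<in> Aff units5" using u u5 unfolding Aff_def by blast
  then show "h \<in> V" using F20_V by blast
  have bij: "bij g" "bij h" "bij ?k" using u u5 d aff_permutes permutes_bij by metis+
  have "h \<circ> ?k = ?k \<circ> g" unfolding u by (simp add: aff_comp algebra_simps)
  then have "inv' ?k \<circ> inv' h = inv' g \<circ> inv' ?k" using bij by (metis o_inv_distrib)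
  then show "g \<circ> (x \<circ> inv' ?k) \<circ> inv' h = g \<circ> x \<circ> inv' g \<circ> inv' ?k" by (simp add: comp_assoc)
qed

lemma orbit_twisted_diag:
  assumes d: "d \<in> units5" and P: "P \<subseteq> units5"
  shows "{\<gamma> <#\<^bsub>S5 \<times>\<times> S5\<^esub> coset (x \<circ> inv' (aff d f)) | \<gamma>. \<gamma> \<in> carrier (S5S5_on (twisted_diag P d f))} =
    (\<lambda>z. coset (z \<circ> inv' (aff d f))) ` {aff u b \<circ> x \<circ> inv' (aff u b) | u b. u \<in> P}"
proof -
  note tw = twisted_diag_conj[OF d P]
  have "{g \<circ> (x \<circ> inv' (aff d f)) \<circ> inv' h | g h. (g, h) \<in> twisted_diag P d f} =
      (\<lambda>z. z \<circ> inv' (aff d f)) ` {aff u b \<circ> x \<circ> inv' (aff u b) | u b. u \<in> P}"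
  proof (intro equalityI subsetI)
    fix y assume "y \<in> {g \<circ> (x \<circ> inv' (aff d f)) \<circ> inv' h | g h. (g, h) \<in> twisted_diag P d f}"
    then obtain g h where gh: "(g, h) \<in> twisted_diag P d f" "y = g \<circ> x \<circ> inv' g \<circ> inv' (aff d f)" using tw(2) by blast
    then obtain u b where "g = aff u b" "u \<in> P" unfolding twisted_diag_def by blast
    then show "y \<in> (\<lambda>z. z \<circ> inv' (aff d f)) ` {aff u b \<circ> x \<circ> inv' (aff u b) | u b. u \<in> P}" using gh(2) by blast
  next
    fix y assume "y \<in> (\<lambda>z. z \<circ> inv' (aff d f)) ` {aff u b \<circ> x \<circ> inv' (aff u b) | u b. u \<in> P}"
    then obtain u b where u: "u \<in> P" "y = aff u b \<circ> x \<circ> inv' (aff u b) \<circ> inv' (aff d f)" by blast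
    then have m: "(aff u b, aff u (d * b + (1 - u) * f)) \<in> twisted_diag P d f" unfolding twisted_diag_def by blast
    show "y \<in> {g \<circ> (x \<circ> inv' (aff d f)) \<circ> inv' h | g h. (g, h) \<in> twisted_diag P d f}"
      using m tw(2)[OF m, of x] u(2) by (intro CollectI exI conjI) (rule trans, assumption, rule sym)
  qed
  moreover have "{\<gamma> <#\<^bsub>S5 \<times>\<times> S5\<^esub> coset (x \<circ> inv' (aff d f)) | \<gamma>. \<gamma> \<in> carrier (S5S5_on (twisted_diag P d f))} =
      coset ` {g \<circ> (x \<circ> inv' (aff d f)) \<circ> inv' h | g h. (g, h) \<in> twisted_diag P d f}"
    by (rule orbit_coset) (rule tw(1))
  ultimately show ?thesis by (simp only: image_image)
qed

lemma Aff_shift: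
  assumes k: "k \<in> Aff units5"
  shows "(\<lambda>x. x \<circ> inv' k) ` Aff units5 = Aff units5" "(\<lambda>x. x \<circ> inv' k) ` (carrier S5 - Aff units5) = carrier S5 - Aff units5"
    "inj (\<lambda>x. x \<circ> inv' k)"
proof -
  have A: "subgroup (Aff units5) S5" by (rule subgroup_Aff) (simp add: unit_subgroup_def)
  have per: "k permutes {1..5}" using k subgroup.subset[OF A] by auto
  have ik: "inv' k \<in> Aff units5" using subgroup.m_inv_closed[OF A k] inv_S5[OF per] by (simp only:)
  have clA: "x \<circ> y \<in> Aff units5" if "x \<in> Aff units5" "y \<in> Aff units5" for x y
    using subgroup.m_closed[OF A that] by (simp only: S5_simps)
  have canc: "x \<circ> inv' k \<circ> k = x" "x \<circ> k \<circ> inv' k = x" for x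
    using permutes_inv_o[OF per] by (simp_all add: comp_assoc)
  show inj: "inj (\<lambda>x. x \<circ> inv' k)" by (rule injI) (metis canc(1))
  show 1: "(\<lambda>x. x \<circ> inv' k) ` Aff units5 = Aff units5"
  proof (intro equalityI subsetI)
    fix x assume "x \<in> Aff units5"
    then have "x \<circ> k \<in> Aff units5" by (rule clA[OF _ k])
    then show "x \<in> (\<lambda>x. x \<circ> inv' k) ` Aff units5" using canc(2) by (metis imageI)
  qed (use clA[OF _ ik] in blast)
  have 2: "(\<lambda>x. x \<circ> inv' k) ` carrier S5 = carrier S5"
  proof (intro equalityI subsetI)
    fix x assume "x \<in> carrier S5"
    then have "x \<circ> k \<in> carrier S5" using per permutes_compose by auto
    then show "x \<in> (\<lambda>x. x \<circ> inv' k) ` carrier S5" using canc(2) by (metis imageI)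
  qed (use permutes_compose[OF permutes_inv[OF per]] in auto)
  show "(\<lambda>x. x \<circ> inv' k) ` (carrier S5 - Aff units5) = carrier S5 - Aff units5"
    unfolding image_set_diff[OF inj] 1 2 ..
qed

text \<open>Orbits are conjugacy classes under \<open>Aff P\<close> in F20. No coordinate is free in
  all of them, so the second factor in the counting is a one-point type.\<close>

lemma decomp_type_twisted_R1:
  assumes d: "d \<in> units5" and P: "unit_subgroup P" and reps: "set rs \<subseteq> units5 \<times> {0, 1, 2, 3, 4}"
    "conj_class1 P ` (units5 \<times> {0, 1, 2, 3, 4}) = conj_class1 P ` set rs" "distinct (map (conj_class1 P) rs)"
  shows "decomp_type (S5S5_on (twisted_diag P d f)) (index_R1 U) = mset (map (\<lambda>r. card (conj_class1 P r) * 1) rs)"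
proof -
  note PD = unit_subgroupD[OF P]
  let ?k = "aff d f" let ?Y = "units5 \<times> {0, 1, 2, 3, 4 :: int}"
  let ?\<phi> = "\<lambda>((w, e), _ :: unit). coset (aff w e \<circ> inv' ?k)"
  let ?orb = "\<lambda>C. {\<gamma> <#\<^bsub>S5 \<times>\<times> S5\<^esub> C | \<gamma>. \<gamma> \<in> carrier (S5S5_on (twisted_diag P d f))}"
  have k: "?k \<in> Aff units5" using d unfolding Aff_def by blast
  have T: "{0..4} = {0, 1, 2, 3, 4 :: int}" by auto
  note affY = bij_betw_Aff[OF order_refl, unfolded T]
  have "index_R1 U = (\<lambda>x. coset (x \<circ> inv' ?k)) ` Aff units5"
    unfolding index_R1_eq using Aff_shift(1)[OF k] by (metis image_image)
  also have "\<dots> = ?\<phi> ` (?Y \<times> {()})"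
    unfolding bij_betw_imp_surj_on[OF affY, symmetric] by force
  finally have I: "index_R1 U = ?\<phi> ` (?Y \<times> {()})" .
  have "image_mset card (mset_set (?orb ` ?\<phi> ` (?Y \<times> {()}))) = mset (map (\<lambda>r. card (conj_class1 P r) * card {()}) rs)"
  proof (rule orbit_count[OF _ _ _ _ reps])
    have "inj_on (\<lambda>y. coset ((case y of (w, e) \<Rightarrow> aff w e) \<circ> inv' ?k)) ?Y"
      by (rule inj_onI) (metis bij_betw_imp_inj_on[OF affY] inj_coset Aff_shift(3)[OF k] injD inj_onD)
    then show "inj_on ?\<phi> (?Y \<times> {()})" by (auto simp: inj_on_def)
    fix y :: "int \<times> int" and b :: unit assume y: "y \<in> ?Y"
    obtain w e where we: "y = (w, e)" by fastforce
    have w: "w \<in> units5" and e: "e \<in> {0, 1, 2, 3, 4}" using y unfolding we by (simp_all only: mem_Sigma_iff)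
    show "conj_class1 P y \<subseteq> ?Y"
    proof (cases "w = 1")
      case True
      then have eq: "conj_class1 P y = (\<lambda>u. (1, u * e mod 5)) ` P" unfolding conj_class1_def we by (simp only: split_conv simp_thms if_True)
      have "(1, u * e mod 5) \<in> ?Y" for u using residue_cases by (simp only: mem_Sigma_iff insert_iff simp_thms)
      then show ?thesis unfolding eq by (intro image_subsetI)
    next
      case False
      then have "conj_class1 P y = {w} \<times> {0, 1, 2, 3, 4}" unfolding conj_class1_def we by (simp only: split_conv if_False)
      then show ?thesis using w by (simp only: Sigma_mono empty_subsetI insert_subset order_refl simp_thms)
    qed
    have act: "aff u b \<circ> aff w e \<circ> inv' (aff u b) = aff w ((1 - w) * b + u * e)" if "u \<in> P" for u b
    proof -
      have u: "u \<in> units5" using that PD(1) by blast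
      have "aff u b \<circ> aff w e = aff w ((1 - w) * b + u * e) \<circ> aff u b" by (simp add: aff_comp algebra_simps)
      then have "aff u b \<circ> aff w e \<circ> inv' (aff u b) = aff w ((1 - w) * b + u * e) \<circ> (aff u b \<circ> inv' (aff u b))"
        by (simp add: comp_assoc)
      then show ?thesis using permutes_inv_o(1)[OF aff_permutes[OF u]] by simp
    qed
    have "{aff u b \<circ> aff w e \<circ> inv' (aff u b) | u b. u \<in> P} = (\<lambda>(w, e). aff w e) ` conj_class1 P y"
    proof (cases "w = 1")
      case True
      have "{aff u b \<circ> aff w e \<circ> inv' (aff u b) | u b. u \<in> P} = {aff 1 (u * e mod 5) | u. u \<in> P}"
        using act True by (auto simp: set_eq_iff) (metis mult_zero_left)+
      then show ?thesis unfolding conj_class1_def we using True by (auto simp: image_image simp del: aff_mod)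
    next
      case False
      have "{aff u b \<circ> aff w e \<circ> inv' (aff u b) | u b. u \<in> P} = {aff w e' | e'. e' \<in> {0, 1, 2, 3, 4}}"
      proof (intro equalityI subsetI)
        fix x assume "x \<in> {aff u b \<circ> aff w e \<circ> inv' (aff u b) | u b. u \<in> P}"
        then obtain u b where "u \<in> P" "x = aff u b \<circ> aff w e \<circ> inv' (aff u b)" by blast
        then have "x = aff w (((1 - w) * b + u * e) mod 5)" using act by simp
        then show "x \<in> {aff w e' | e'. e' \<in> {0, 1, 2, 3, 4}}" using residue_cases by blast
      next
        fix x assume "x \<in> {aff w e' | e'. e' \<in> {0, 1, 2, 3, 4}}"
        then obtain e' where x: "x = aff w e'" by blast
        \<comment> \<open>Solves \<open>(1 - w) * b = e' - e\<close> modulo 5, the cube being the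
          inverse of the unit \<open>1 - w\<close>.\<close>
        let ?b = "(1 - w) ^ 3 * (e' - e)"
        have "((1 - w) * ?b + 1 * e) mod 5 = e' mod 5"
        proof -
          have "(1 - w) ^ 4 mod 5 = 1" using w False by auto
          then have "(1 - w) ^ 4 * (e' - e) mod 5 = (e' - e) mod 5" by (metis mod_mult_left_eq mult_1)
          moreover have "(1 - w) * ?b = (1 - w) ^ 4 * (e' - e)" by (simp add: numeral_eq_Suc mult.assoc)
          ultimately show ?thesis by (metis diff_add_cancel mod_add_left_eq mult_1)
        qed
        then have "x = aff 1 ?b \<circ> aff w e \<circ> inv' (aff 1 ?b)" using act[OF PD(2)] x by (simp add: aff_eq_iff)
        then show "x \<in> {aff u b \<circ> aff w e \<circ> inv' (aff u b) | u b. u \<in> P}" using PD(2) by blast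
      qed
      also have "{aff w e' | e'. e' \<in> S} = (\<lambda>(w, e). aff w e) ` ({w} \<times> S)" for S by force
      finally show ?thesis unfolding conj_class1_def we using False by (simp only: split_conv if_False)
    qed
    then have "?orb (?\<phi> (y, b)) = (\<lambda>z. coset (z \<circ> inv' ?k)) ` (\<lambda>(w, e). aff w e) ` conj_class1 P y"
      unfolding we split_conv orbit_twisted_diag[OF d PD(1)] by (simp only:)
    also have "\<dots> = ?\<phi> ` (conj_class1 P y \<times> {()})" by force
    finally show "?orb (?\<phi> (y, b)) = ?\<phi> ` (conj_class1 P y \<times> {()})" .
  qed simp
  then show ?thesis unfolding decomp_type_eq I by simp
qed

text \<open>Conjugation by translations moves the coordinate \<open>b\<close> freely and fixes
  \<open>w\<close> and \<open>s\<close>; this gives the factor 5.\<close>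

lemma decomp_type_twisted_R2:
  assumes d: "d \<in> units5" and P: "unit_subgroup P" and reps: "set rs \<subseteq> units5 \<times> {0, 1, 2, 3, 4}"
    "conj_class2 P ` (units5 \<times> {0, 1, 2, 3, 4}) = conj_class2 P ` set rs" "distinct (map (conj_class2 P) rs)"
  shows "decomp_type (S5S5_on (twisted_diag P d f)) (index_R2 U) = mset (map (\<lambda>r. card (conj_class2 P r) * 5) rs)"
proof -
  note PD = unit_subgroupD[OF P]
  let ?k = "aff d f" let ?Y = "units5 \<times> {0, 1, 2, 3, 4 :: int}" let ?T = "{0..4 :: int}"
  let ?\<phi> = "\<lambda>((w, s), b). coset (outer w s b \<circ> inv' ?k)"
  let ?orb = "\<lambda>C. {\<gamma> <#\<^bsub>S5 \<times>\<times> S5\<^esub> C | \<gamma>. \<gamma> \<in> carrier (S5S5_on (twisted_diag P d f))}"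
  have k: "?k \<in> Aff units5" using d unfolding Aff_def by blast
  have T: "{0..4} = {0, 1, 2, 3, 4 :: int}" by auto
  have assoc: "(\<lambda>((w, s), b). (w, s, b)) ` (?Y \<times> ?T) = units5 \<times> {0..4} \<times> {0..4}"
    unfolding T by force
  have "index_R2 U = (\<lambda>x. coset (x \<circ> inv' ?k)) ` (carrier S5 - Aff units5)"
    unfolding index_R2_eq using Aff_shift(2)[OF k] by (metis image_image)
  also have "\<dots> = ?\<phi> ` (?Y \<times> ?T)"
    unfolding outer_image[symmetric] assoc[symmetric] image_image by (simp only: split_def fst_conv snd_conv)
  finally have I: "index_R2 U = ?\<phi> ` (?Y \<times> ?T)" .
  have "image_mset card (mset_set (?orb ` ?\<phi> ` (?Y \<times> ?T))) = mset (map (\<lambda>r. card (conj_class2 P r) * card ?T) rs)"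
  proof (rule orbit_count[OF _ _ _ _ reps])
    show "inj_on ?\<phi> (?Y \<times> ?T)"
    proof (rule inj_onI)
      fix x y assume xy: "x \<in> ?Y \<times> ?T" "y \<in> ?Y \<times> ?T" "?\<phi> x = ?\<phi> y"
      obtain w s b w' s' b' where x: "x = ((w, s), b)" and y: "y = ((w', s'), b')" by (metis surj_pair)
      have "outer w s b = outer w' s' b'"
        using xy(3) injD[OF inj_coset] injD[OF Aff_shift(3)[OF k]] unfolding x y split_conv by blast
      moreover have "(w, s, b) \<in> units5 \<times> {0..4} \<times> {0..4}" "(w', s', b') \<in> units5 \<times> {0..4} \<times> {0..4}"
        using xy(1,2) unfolding x y T by (simp_all only: mem_Sigma_iff)
      ultimately have "(w, s, b) = (w', s', b')" using inj_onD[OF inj_outer] by (metis (mono_tags, lifting) split_conv)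
      then show "x = y" unfolding x y by simp
    qed
    fix y :: "int \<times> int" and b :: int assume y: "y \<in> ?Y"
    obtain w s where ws: "y = (w, s)" by fastforce
    have w: "w \<in> units5" using y unfolding ws by (simp only: mem_Sigma_iff)
    show "conj_class2 P y \<subseteq> ?Y"
    proof
      fix z assume "z \<in> conj_class2 P y"
      then obtain u where u: "u \<in> P" "z = (u * u * w mod 5, u * s mod 5)" unfolding conj_class2_def ws by auto
      then have "u \<in> units5" using PD(1) by blast
      then have "(u * u mod 5) * w mod 5 \<in> units5" by (intro units5_mult w)
      then show "z \<in> ?Y" unfolding u(2) mem_Sigma_iff using residue_cases by (simp only: mod_simps simp_thms)
    qed
    have act: "aff u b0 \<circ> outer w s b \<circ> inv' (aff u b0) = outer (u * u * w mod 5) (u * s mod 5) ((b0 + u * b) mod 5)"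
      if "u \<in> P" for u b0
    proof -
      have u: "u \<in> units5" using that PD(1) by blast
      have "b0 + u * b - b0 + u * (s - b) = u * s" by (simp add: algebra_simps)
      then show ?thesis unfolding outer_act[OF u] outer_mod by (simp only:)
    qed
    have "{aff u b0 \<circ> outer w s b \<circ> inv' (aff u b0) | u b0. u \<in> P} = (\<lambda>((w, s), b). outer w s b) ` (conj_class2 P y \<times> ?T)"
    proof (intro equalityI subsetI)
      fix x assume "x \<in> {aff u b0 \<circ> outer w s b \<circ> inv' (aff u b0) | u b0. u \<in> P}"
      then obtain u b0 where u: "u \<in> P" "x = outer (u * u * w mod 5) (u * s mod 5) ((b0 + u * b) mod 5)" using act by blast
      have "(u * u * w mod 5, u * s mod 5) \<in> conj_class2 P y" unfolding conj_class2_def ws split_conv using u(1) by (rule imageI)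
      then show "x \<in> (\<lambda>((w, s), b). outer w s b) ` (conj_class2 P y \<times> ?T)" unfolding u(2)
        by (intro image_eqI[of _ _ "((u * u * w mod 5, u * s mod 5), (b0 + u * b) mod 5)"])
          (simp_all only: split_conv mem_Sigma_iff residue_interval simp_thms)
    next
      fix x assume "x \<in> (\<lambda>((w, s), b). outer w s b) ` (conj_class2 P y \<times> ?T)"
      then obtain u b' where u: "u \<in> P" "x = outer (u * u * w mod 5) (u * s mod 5) b'"
        unfolding conj_class2_def ws by auto
      have "x = aff u (b' - u * b) \<circ> outer w s b \<circ> inv' (aff u (b' - u * b))"
        unfolding act[OF u(1)] u(2) outer_mod by simp
      then show "x \<in> {aff u b0 \<circ> outer w s b \<circ> inv' (aff u b0) | u b0. u \<in> P}" using u(1) by blast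
    qed
    then have "?orb (?\<phi> (y, b)) = (\<lambda>z. coset (z \<circ> inv' ?k)) ` (\<lambda>((w, s), b). outer w s b) ` (conj_class2 P y \<times> ?T)"
      unfolding ws split_conv orbit_twisted_diag[OF d PD(1)] by (simp only:)
    also have "\<dots> = ?\<phi> ` (conj_class2 P y \<times> ?T)" unfolding image_image by (simp only: split_def)
    finally show "?orb (?\<phi> (y, b)) = ?\<phi> ` (conj_class2 P y \<times> ?T)" .
  qed simp
  then show ?thesis unfolding decomp_type_eq I by simp
qed

end

section \<open>Evaluation of the decomposition types of all groups in the table\<close>

context diagonal_cosets
begin

lemma decomp_types_Aff2I:
  assumes "Q \<subseteq> units5 \<times> units5"
    and "set rs \<subseteq> units5" "class1 Q ` units5 = class1 Q ` set rs" "distinct (map (class1 Q) rs)"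
    and "map (\<lambda>r. card (class1 Q r) * 5) rs = ns"
    and "set rs' \<subseteq> units5" "class2 Q ` units5 = class2 Q ` set rs'" "distinct (map (class2 Q) rs')"
    and "map (\<lambda>r. card (class2 Q r) * 25) rs' = ns'"
  shows "decomp_type (S5S5_on (Aff2 Q)) (index_R1 U) = mset ns \<and> decomp_type (S5S5_on (Aff2 Q)) (index_R2 U) = mset ns'"
  using decomp_type_Aff2_R1[OF assms(1-4)] decomp_type_Aff2_R2[OF assms(1,6-8)] assms(5,9) by (simp only:)

text \<open>Classes are cosets of the group of values u / v, respectively u v, taken on the pairs of
  scalings. That group is trivial, the squares, or everything, with representatives 1, 2, 3, 4, or
  1, 2, or 1.\<close>

lemma decomp_types_Aff2:
  shows "decomp_type (S5S5_on (Aff2 (units5 \<times> units5))) (index_R1 U) = mset [20] \<and> decomp_type (S5S5_on (Aff2 (units5 \<times> units5))) (index_R2 U) = mset [100]"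
    "decomp_type (S5S5_on (Aff2 (Q_I2))) (index_R1 U) = mset [10, 10] \<and> decomp_type (S5S5_on (Aff2 (Q_I2))) (index_R2 U) = mset [50, 50]"
    "decomp_type (S5S5_on (Aff2 (Q_I3))) (index_R1 U) = mset [5, 5, 5, 5] \<and> decomp_type (S5S5_on (Aff2 (Q_I3))) (index_R2 U) = mset [50, 50]"
    "decomp_type (S5S5_on (Aff2 (Q_I4))) (index_R1 U) = mset [10, 10] \<and> decomp_type (S5S5_on (Aff2 (Q_I4))) (index_R2 U) = mset [25, 25, 25, 25]"
    "decomp_type (S5S5_on (Aff2 (units5 \<times> {1, 4}))) (index_R1 U) = mset [20] \<and> decomp_type (S5S5_on (Aff2 (units5 \<times> {1, 4}))) (index_R2 U) = mset [100]"
    "decomp_type (S5S5_on (Aff2 (Q_I7))) (index_R1 U) = mset [20] \<and> decomp_type (S5S5_on (Aff2 (Q_I7))) (index_R2 U) = mset [100]"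
    "decomp_type (S5S5_on (Aff2 (units5 \<times> {1}))) (index_R1 U) = mset [20] \<and> decomp_type (S5S5_on (Aff2 (units5 \<times> {1}))) (index_R2 U) = mset [100]"
    "decomp_type (S5S5_on (Aff2 ({1, 4} \<times> {1, 4}))) (index_R1 U) = mset [10, 10] \<and> decomp_type (S5S5_on (Aff2 ({1, 4} \<times> {1, 4}))) (index_R2 U) = mset [50, 50]"
    "decomp_type (S5S5_on (Aff2 (Q_II2))) (index_R1 U) = mset [5, 5, 5, 5] \<and> decomp_type (S5S5_on (Aff2 (Q_II2))) (index_R2 U) = mset [25, 25, 25, 25]"
    "decomp_type (S5S5_on (Aff2 ({1, 4} \<times> {1}))) (index_R1 U) = mset [10, 10] \<and> decomp_type (S5S5_on (Aff2 ({1, 4} \<times> {1}))) (index_R2 U) = mset [50, 50]"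
    "decomp_type (S5S5_on (Aff2 ({1} \<times> {1}))) (index_R1 U) = mset [5, 5, 5, 5] \<and> decomp_type (S5S5_on (Aff2 ({1} \<times> {1}))) (index_R2 U) = mset [25, 25, 25, 25]"
  apply (rule decomp_types_Aff2I[of _ "[1]" _ "[1]"]; code_simp)
  apply (rule decomp_types_Aff2I[of _ "[1, 2]" _ "[1, 2]"]; code_simp)
  apply (rule decomp_types_Aff2I[of _ "[1, 2, 3, 4]" _ "[1, 2]"]; code_simp)
  apply (rule decomp_types_Aff2I[of _ "[1, 2]" _ "[1, 2, 3, 4]"]; code_simp)
  apply (rule decomp_types_Aff2I[of _ "[1]" _ "[1]"]; code_simp)
  apply (rule decomp_types_Aff2I[of _ "[1]" _ "[1]"]; code_simp)
  apply (rule decomp_types_Aff2I[of _ "[1]" _ "[1]"]; code_simp)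
  apply (rule decomp_types_Aff2I[of _ "[1, 2]" _ "[1, 2]"]; code_simp)
  apply (rule decomp_types_Aff2I[of _ "[1, 2, 3, 4]" _ "[1, 2, 3, 4]"]; code_simp)
  apply (rule decomp_types_Aff2I[of _ "[1, 2]" _ "[1, 2]"]; code_simp)
  apply (rule decomp_types_Aff2I[of _ "[1, 2, 3, 4]" _ "[1, 2, 3, 4]"]; code_simp)
  done

lemma decomp_types_twisted_diagI:
  assumes "d \<in> units5" "unit_subgroup P"
    and "set rs \<subseteq> units5 \<times> {0, 1, 2, 3, 4}"
    "conj_class1 P ` (units5 \<times> {0, 1, 2, 3, 4}) = conj_class1 P ` set rs" "distinct (map (conj_class1 P) rs)"
    "map (\<lambda>r. card (conj_class1 P r) * 1) rs = ns"
    and "set rs' \<subseteq> units5 \<times> {0, 1, 2, 3, 4}"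
    "conj_class2 P ` (units5 \<times> {0, 1, 2, 3, 4}) = conj_class2 P ` set rs'" "distinct (map (conj_class2 P) rs')"
    "map (\<lambda>r. card (conj_class2 P r) * 5) rs' = ns'"
  shows "decomp_type (S5S5_on (twisted_diag P d f)) (index_R1 U) = mset ns \<and>
         decomp_type (S5S5_on (twisted_diag P d f)) (index_R2 U) = mset ns'"
  using decomp_type_twisted_R1[OF assms(1-5)] decomp_type_twisted_R2[OF assms(1,2,7-9)] assms(6,10) by (simp only:)

text \<open>In the first resolvent the representatives are translations up to \<open>P\<close> and
  one map for each scaling other than 1. In the second, for F20 the pairs with s = 0 split by the
  quadratic character of \<open>w\<close>, and all others can be scaled to s = 1; for D5 the unit
  \<open>w\<close> is fixed and \<open>s\<close> counts up to sign; for C5 nothing is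
  identified.\<close>

lemma decomp_types_twisted_diag:
  assumes d: "d \<in> units5"
  shows "decomp_type (S5S5_on (twisted_diag units5 d f)) (index_R1 U) = mset [1, 4, 5, 5, 5] \<and>
         decomp_type (S5S5_on (twisted_diag units5 d f)) (index_R2 U) = mset [10, 10, 20, 20, 20, 20]"
    "decomp_type (S5S5_on (twisted_diag {1, 4} d f)) (index_R1 U) = mset [1, 2, 2, 5, 5, 5] \<and>
         decomp_type (S5S5_on (twisted_diag {1, 4} d f)) (index_R2 U) = mset [5, 10, 10, 5, 10, 10, 5, 10, 10, 5, 10, 10]"
    "decomp_type (S5S5_on (twisted_diag {1} d f)) (index_R1 U) = mset [1, 1, 1, 1, 1, 5, 5, 5] \<and>
         decomp_type (S5S5_on (twisted_diag {1} d f)) (index_R2 U) = mset (replicate 20 5)"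
proof -
  have us: "unit_subgroup units5" "unit_subgroup {1, 4}" "unit_subgroup {1}" by (simp_all add: unit_subgroup_def)
  show "decomp_type (S5S5_on (twisted_diag units5 d f)) (index_R1 U) = mset [1, 4, 5, 5, 5] \<and>
         decomp_type (S5S5_on (twisted_diag units5 d f)) (index_R2 U) = mset [10, 10, 20, 20, 20, 20]"
    by (rule decomp_types_twisted_diagI[OF d us(1), of "[(1, 0), (1, 1), (2, 0), (3, 0), (4, 0)]" _
      "[(1, 0), (2, 0), (1, 1), (2, 1), (3, 1), (4, 1)]"]; code_simp)
  show "decomp_type (S5S5_on (twisted_diag {1, 4} d f)) (index_R1 U) = mset [1, 2, 2, 5, 5, 5] \<and>
         decomp_type (S5S5_on (twisted_diag {1, 4} d f)) (index_R2 U) = mset [5, 10, 10, 5, 10, 10, 5, 10, 10, 5, 10, 10]"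
    by (rule decomp_types_twisted_diagI[OF d us(2), of "[(1, 0), (1, 1), (1, 2), (2, 0), (3, 0), (4, 0)]" _
      "List.product [1, 2, 3, 4] [0, 1, 2]"]; code_simp)
  show "decomp_type (S5S5_on (twisted_diag {1} d f)) (index_R1 U) = mset [1, 1, 1, 1, 1, 5, 5, 5] \<and>
         decomp_type (S5S5_on (twisted_diag {1} d f)) (index_R2 U) = mset (replicate 20 5)"
    by (rule decomp_types_twisted_diagI[OF d us(3), of "[(1, 0), (1, 1), (1, 2), (1, 3), (1, 4), (2, 0), (3, 0), (4, 0)]" _
      "List.product [1, 2, 3, 4] [0, 1, 2, 3, 4]"]; code_simp)
qed

end

section \<open>The rows of the table\<close>

text \<open>Orders of the three groups and number of orbits in the first resolvent. The orders alone
  separate all rows except I-3 and I-4, which have four and two orbits.\<close>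

fun row_key :: "table_row \<Rightarrow> nat \<times> nat \<times> nat \<times> nat" where
  "row_key I_1 = (20, 20, 400, 1)"
| "row_key I_2 = (20, 20, 200, 2)"
| "row_key I_3 = (20, 20, 100, 4)"
| "row_key I_4 = (20, 20, 100, 2)"
| "row_key I_5 = (20, 20, 20, 5)"
| "row_key I_6 = (20, 10, 200, 1)"
| "row_key I_7 = (20, 10, 100, 1)"
| "row_key I_8 = (20, 5, 100, 1)"
| "row_key II_1 = (10, 10, 100, 2)"
| "row_key II_2 = (10, 10, 50, 4)"
| "row_key II_3 = (10, 10, 10, 6)"
| "row_key II_4 = (10, 5, 50, 2)"
| "row_key III_1 = (5, 5, 25, 4)"
| "row_key III_2 = (5, 5, 5, 8)"

lemma card_groups:
  "card (carrier F20) = 20" "card (carrier D5) = 10" "card (carrier C5) = 5"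
  "card (carrier SmallGroup_200_42) = 200" "card (carrier SmallGroup_50_4) = 50"
  "card (carrier SmallGroup_100_10) = 100" "card (carrier SmallGroup_100_11) = 100" "card (carrier SmallGroup_100_12) = 100"
proof -
  show "card (carrier F20) = 20" "card (carrier D5) = 10" "card (carrier C5) = 5"
    using card_Aff[of units5] card_Aff[of "{1, 4}"] card_Aff[of "{1}"] by (simp_all add: F20_eq D5_eq C5_eq)
qed (simp_all add: SmallGroup_200_42_def SmallGroup_50_4_def SmallGroup_100_10_def SmallGroup_100_11_def
    SmallGroup_100_12_def C5xC5_C4_def semidirect_def DirProd_def carrier_integer_mod_group card_cartesian_product)

lemma satisfies_row_key:
  assumes "satisfies_row r A B G L L' R1 R2"
  shows "(card (carrier A), card (carrier B), card (carrier G), size R1) = row_key r"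
  using assms
  by (cases r) (auto dest!: iso_same_card simp: card_groups DirProd_def card_cartesian_product)

lemma satisfies_row_unique:
  assumes "satisfies_row r A B G L L' R1 R2" "satisfies_row r' A B G L L' R1 R2"
  shows "r = r'"
proof -
  have "row_key r = row_key r'" using satisfies_row_key[OF assms(1)] satisfies_row_key[OF assms(2)] by simp
  then show ?thesis by (cases r; cases r') simp_all
qed

text \<open>The homomorphism to C2 is the quadratic character of the first scaling. It equals that
  of the second one, so its kernel is the full product of two dihedral groups.\<close>

lemma Q_I2_normal:
  defines "G \<equiv> S5S5_on (Aff2 Q_I2)"
  assumes grp: "group G"
  shows "\<exists>N. N \<lhd> G \<and> G\<lparr>carrier := N\<rparr> \<cong> D5 \<times>\<times> D5 \<and> G Mod N \<cong> Z 2"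
proof -
  let ?D = "Aff {1, 4}"
  define \<chi> :: "(nat \<Rightarrow> nat) \<times> (nat \<Rightarrow> nat) \<Rightarrow> int" where "\<chi> x = (if fst x \<in> ?D then 0 else 1)" for x
  have inQ: "aff u b \<in> ?D \<longleftrightarrow> u \<in> {1, 4}" if "u \<in> units5" for u b by (rule Aff_iff[OF _ that]) simp
  have elem: "\<exists>u b v c. x = (aff u b, aff v c) \<and> (u, v) \<in> Q_I2" if "x \<in> carrier G" for x
  proof -
    from that have "x \<in> Aff2 Q_I2" by (simp add: G_def)
    then show ?thesis unfolding Aff2_def by blast
  qed
  have mem: "(aff u b, aff v c) \<in> carrier G" if "(u, v) \<in> Q_I2" for u b v c
  proof -
    have "(aff u b, aff v c) \<in> Aff2 Q_I2" unfolding Aff2_def using that by blast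
    then show ?thesis by (simp add: G_def)
  qed
  have Q: "u \<in> units5 \<and> v \<in> units5 \<and> (u \<in> {1, 4} \<longleftrightarrow> v \<in> {1, 4})" if "(u, v) \<in> Q_I2" for u v
    using that by auto
  have hom: "\<chi> \<in> hom G (Z 2)"
  proof (rule homI)
    show "\<chi> x \<in> carrier (Z 2)" for x by (simp add: \<chi>_def carrier_integer_mod_group)
    fix x y assume "x \<in> carrier G" "y \<in> carrier G"
    then obtain u b v c u' b' v' c' where x: "x = (aff u b, aff v c)" "(u, v) \<in> Q_I2"
      and y: "y = (aff u' b', aff v' c')" "(u', v') \<in> Q_I2" using elem by metis
    have u: "u \<in> units5" "u' \<in> units5" using Q x(2) y(2) by blast+
    have "fst (x \<otimes>\<^bsub>G\<^esub> y) = aff (u * u' mod 5) (b + u * b')" by (simp add: x y G_def aff_comp)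
    then have 1: "\<chi> (x \<otimes>\<^bsub>G\<^esub> y) = (if u * u' mod 5 \<in> {1, 4} then 0 else 1)"
      unfolding \<chi>_def using inQ[OF units5_mult[OF u]] by (simp only:)
    have 2: "\<chi> x = (if u \<in> {1, 4} then 0 else 1)" "\<chi> y = (if u' \<in> {1, 4} then 0 else 1)"
      unfolding \<chi>_def x(1) y(1) fst_conv inQ[OF u(1)] inQ[OF u(2)] by (rule refl)+
    show "\<chi> (x \<otimes>\<^bsub>G\<^esub> y) = \<chi> x \<otimes>\<^bsub>Z 2\<^esub> \<chi> y"
      unfolding 1 2 using u by (elim insertE emptyE) simp_all
  qed
  interpret group_hom G "Z 2" \<chi>
    using grp hom by (intro group_hom.intro group_hom_axioms.intro) auto
  have ker: "kernel G (Z 2) \<chi> = ?D \<times> ?D"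
  proof (intro equalityI subsetI)
    fix x assume "x \<in> kernel G (Z 2) \<chi>"
    then have x: "x \<in> carrier G" "fst x \<in> ?D" by (auto simp: kernel_def \<chi>_def split: if_splits)
    then obtain u b v c where "x = (aff u b, aff v c)" "(u, v) \<in> Q_I2" using elem by blast
    then show "x \<in> ?D \<times> ?D" using x(2) Q inQ by (metis fst_conv mem_Sigma_iff)
  next
    fix x assume "x \<in> ?D \<times> ?D"
    then obtain u b v c where x: "x = (aff u b, aff v c)" "u \<in> {1, 4}" "v \<in> {1, 4}" by (auto simp: Aff_def)
    then have "(u, v) \<in> Q_I2" by auto
    then have "x \<in> carrier G" unfolding G_def Aff2_def using x by auto
    then show "x \<in> kernel G (Z 2) \<chi>" using \<open>x \<in> ?D \<times> ?D\<close> by (auto simp: kernel_def \<chi>_def)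
  qed
  have "\<chi> ` carrier G = carrier (Z 2)"
  proof (intro equalityI subsetI)
    fix i assume "i \<in> carrier (Z 2)"
    then have "i \<in> {0, 1}" by (auto simp: carrier_integer_mod_group)
    moreover have "\<chi> (aff 1 0, aff 1 0) = 0" "\<chi> (aff 2 0, aff 2 0) = 1"
      unfolding \<chi>_def fst_conv using inQ[of 1 0] inQ[of 2 0] by simp_all
    moreover have "(aff 1 0, aff 1 0) \<in> carrier G" "(aff 2 0, aff 2 0) \<in> carrier G"
      by (rule mem; simp)+
    ultimately show "i \<in> \<chi> ` carrier G" by (metis imageI insertE singletonD)
  qed (use hom in \<open>auto simp: hom_def\<close>)
  then have "G Mod (?D \<times> ?D) \<cong> Z 2" using FactGroup_iso ker by simp
  moreover have "G\<lparr>carrier := ?D \<times> ?D\<rparr> \<cong> D5 \<times>\<times> D5"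
  proof -
    have "G\<lparr>carrier := ?D \<times> ?D\<rparr> = D5 \<times>\<times> D5" by (simp add: G_def D5_eq S5S5_on_Times)
    then show ?thesis by simp
  qed
  moreover have "?D \<times> ?D \<lhd> G" using normal_kernel ker by simp
  ultimately show ?thesis by blast
qed

text \<open>A graph is isomorphic to its domain by the first projection.\<close>

lemma twisted_diag_iso:
  assumes P: "unit_subgroup P"
  shows "S5S5_on (twisted_diag P d f) \<cong> S5\<lparr>carrier := Aff P\<rparr>"
proof -
  let ?G = "S5S5_on (twisted_diag P d f)"
  have "fst \<in> iso ?G (S5\<lparr>carrier := Aff P\<rparr>)"
    unfolding iso_def
  proof (intro CollectI conjI)
    show "fst \<in> hom ?G (S5\<lparr>carrier := Aff P\<rparr>)"
    proof (rule homI)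
      fix x assume "x \<in> carrier ?G"
      then have "x \<in> twisted_diag P d f" by simp
      then have "fst x \<in> Aff P" unfolding twisted_diag_def Aff_def by force
      then show "fst x \<in> carrier (S5\<lparr>carrier := Aff P\<rparr>)" by simp
    qed (simp add: DirProd_def split_def)
    have "x = y" if xy: "x \<in> twisted_diag P d f" "y \<in> twisted_diag P d f" "fst x = fst y" for x y
    proof -
      obtain u b where x: "x = (aff u b, aff u (d * b + (1 - u) * f))" using xy(1) by (auto simp: twisted_diag_def)
      obtain v c where y: "y = (aff v c, aff v (d * c + (1 - v) * f))" using xy(2) by (auto simp: twisted_diag_def)
      have uv: "u mod 5 = v mod 5" "b mod 5 = c mod 5" using xy(3) by (simp_all add: x y aff_eq_iff)
      then have "(d * b + (1 - u) * f) mod 5 = (d * c + (1 - v) * f) mod 5"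
        by (intro mod_add_cong mod_mult_cong mod_diff_cong refl)
      then show ?thesis using uv by (simp add: x y aff_eq_iff)
    qed
    moreover have "fst ` twisted_diag P d f = Aff P"
      unfolding twisted_diag_def Aff_def by force
    ultimately show "bij_betw fst (carrier ?G) (carrier (S5\<lparr>carrier := Aff P\<rparr>))"
      by (auto simp: bij_betw_def inj_on_def)
  qed
  then show ?thesis by (auto simp: is_iso_def)
qed

text \<open>Since \<open>d\<close> is a unit, the map whose graph is taken is injective, so neither
  projection has a kernel. In field terms the two splitting fields coincide.\<close>

lemma twisted_diag_kernels:
  assumes d: "d \<in> units5" and P: "unit_subgroup P"
  shows "(g, id) \<in> twisted_diag P d f \<Longrightarrow> g = id" "(id, h) \<in> twisted_diag P d f \<Longrightarrow> h = id"
proof -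
  have one: "u = 1" if "u \<in> P" "u mod 5 = 1" for u
    using that unit_subgroupD(1)[OF P] units5_self_mod by auto
  show "g = id" if gid: "(g, id) \<in> twisted_diag P d f"
  proof -
    obtain u b where u: "u \<in> P" "g = aff u b" "aff 1 0 = aff u (d * b + (1 - u) * f)"
      using gid unfolding twisted_diag_def aff_id[symmetric] by blast
    then have "u = 1" using one by (simp add: aff_eq_iff)
    then have "d * b mod 5 = 0" using u(3) by (simp add: aff_eq_iff)
    then have "d ^ 3 * (d * b) mod 5 = 0" by (metis mod_mult_right_eq mult_zero_right mod_0)
    then have "(d ^ 3 * d mod 5) * b mod 5 = 0" by (simp only: mult.assoc mod_mult_left_eq)
    then show ?thesis using \<open>u = 1\<close> u(2) units5_fourth_power[OF d] by (simp add: aff_eq_iff flip: aff_id)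
  qed
  show "h = id" if idh: "(id, h) \<in> twisted_diag P d f"
  proof -
    obtain u b where u: "u \<in> P" "aff 1 0 = aff u b" "h = aff u (d * b + (1 - u) * f)"
      using idh unfolding twisted_diag_def aff_id[symmetric] by blast
    then have "u = 1" "b mod 5 = 0" using one by (simp_all add: aff_eq_iff)
    then have "d * b mod 5 = 0" by (metis mod_mult_right_eq mult_zero_right mod_0)
    then show ?thesis using \<open>u = 1\<close> u(3) by (simp add: aff_eq_iff flip: aff_id)
  qed
qed

lemma row_exists:
  fixes L L' :: "'m::field alg_closure set"
  assumes G: "affine_pair_group G P R" and U: "diagonal_cosets U V" and grp: "group (S5S5_on G)"
    and deg: "ext_degree (L \<inter> L') n" "n * card G = card (Aff P) * card (Aff R)" "n = 1 \<Longrightarrow> L \<inter> L' = base_field"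
    and eq: "L = L' \<longleftrightarrow> (\<forall>g. (g, id) \<in> G \<longrightarrow> g = id) \<and> (\<forall>h. (id, h) \<in> G \<longrightarrow> h = id)"
  shows "\<exists>r. satisfies_row r (S5\<lparr>carrier := Aff P\<rparr>) (S5\<lparr>carrier := Aff R\<rparr>) (S5S5_on G) L L'
           (decomp_type (S5S5_on G) (index_R1 U)) (decomp_type (S5S5_on G) (index_R2 U))"
proof -
  interpret affine_pair_group G P R by (rule G)
  interpret diagonal_cosets U V by (rule U)
  note id_Aff = F20_eq[symmetric] D5_eq[symmetric] C5_eq[symmetric]
  have mset_simps: "replicate_mset 2 a = mset [a, a]" "replicate_mset 3 a = mset [a, a, a]"
    "replicate_mset 4 a = mset [a, a, a, a]" "replicate_mset 5 a = mset [a, a, a, a, a]"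
    "replicate_mset 8 a = mset [a, a, a, a, a, a, a, a]" for a :: nat
    by (simp_all add: numeral_eq_Suc)
  show ?thesis
  \<comment> \<open>The dichotomy behind the table: a nontrivial translation in the second component
    alone forces all pairs of translations, its absence forces a graph.\<close>
  proof (cases "\<exists>d. T 1 0 1 d \<and> d mod 5 \<noteq> 0")
    case True
    then obtain Q where Q: "Q \<subseteq> units5 \<times> units5" "fst ` Q = P" "snd ` Q = R" "G = Aff2 Q"
      "\<forall>u v u' v'. (u, v) \<in> Q \<longrightarrow> (u', v') \<in> Q \<longrightarrow> (u * u' mod 5, v * v' mod 5) \<in> Q"
      using full_case by blast
    note card = card_Aff[OF PD(1)] card_Aff[OF RD(1)] card_Aff2[OF Q(1)]
    \<comment> \<open>The numbers of translations cancel, so the degree is read off from the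
      scalings.\<close>
    have n: "n * card Q = card P * card R" using deg(2) unfolding Q(4) card by simp
    consider "Q = P \<times> R" | "P = units5" "R = units5" "Q = Q_I2" | "P = units5" "R = units5" "Q = Q_I3"
      | "P = units5" "R = units5" "Q = Q_I4" | "P = units5" "R = {1, 4}" "Q = Q_I7" | "P = {1, 4}" "R = {1, 4}" "Q = Q_II2"
      using pair_subgroup_cases[OF P R RP Q(1-3,5)] by (elim disjE conjE insertE emptyE) (simp_all only: simp_thms)
    then show ?thesis
    proof cases
      case 1
      have fin: "finite P" "finite R" "P \<noteq> {}" "R \<noteq> {}" using P R by (auto simp: unit_subgroup_def)
      then have "card P * card R > 0" by (simp add: card_gt_0_iff)
      then have "n = 1" using n unfolding 1 card_cartesian_product by simp
      then have base: "L \<inter> L' = base_field" by (rule deg(3))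
      have G_eq: "S5S5_on G = S5\<lparr>carrier := Aff P\<rparr> \<times>\<times> S5\<lparr>carrier := Aff R\<rparr>"
        unfolding Q(4) 1 Aff2_Times S5S5_on_Times ..
      have "P = units5 \<and> R = units5 \<or> P = units5 \<and> R = {1, 4} \<or> P = units5 \<and> R = {1} \<or>
          P = {1, 4} \<and> R = {1, 4} \<or> P = {1, 4} \<and> R = {1} \<or> P = {1} \<and> R = {1}"
        using P R RP unfolding unit_subgroup_def by (elim disjE) (simp_all only: simp_thms, auto)
      then show ?thesis
      proof (elim disjE conjE)
        assume c: "P = units5" "R = units5"
        show ?thesis
          by (rule exI[of _ I_1]) (use base decomp_types_Aff2(1) in \<open>simp add: c G_eq id_Aff, simp add: c 1 Q(4) flip: G_eq[unfolded c id_Aff]\<close>)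
      next
        assume c: "P = units5" "R = {1, 4}"
        show ?thesis
          by (rule exI[of _ I_6]) (use base decomp_types_Aff2(5) in \<open>simp add: c G_eq id_Aff, simp add: c 1 Q(4) flip: G_eq[unfolded c id_Aff]\<close>)
      next
        assume c: "P = units5" "R = {1}"
        show ?thesis
          by (rule exI[of _ I_8]) (use base decomp_types_Aff2(7) in \<open>simp add: c G_eq id_Aff, simp add: c 1 Q(4) flip: G_eq[unfolded c id_Aff]\<close>)
      next
        assume c: "P = {1, 4}" "R = {1, 4}"
        show ?thesis
          by (rule exI[of _ II_1]) (use base decomp_types_Aff2(8) in \<open>simp add: c G_eq id_Aff, simp add: c 1 Q(4) mset_simps flip: G_eq[unfolded c id_Aff]\<close>)
      next
        assume c: "P = {1, 4}" "R = {1}"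
        show ?thesis
          by (rule exI[of _ II_4]) (use base decomp_types_Aff2(10) in \<open>simp add: c G_eq id_Aff, simp add: c 1 Q(4) mset_simps flip: G_eq[unfolded c id_Aff]\<close>)
      next
        assume c: "P = {1}" "R = {1}"
        \<comment> \<open>Row III-1 asserts distinct fields, and this element violates injectivity
          of the second projection.\<close>
        have "(aff 1 1, id) \<in> G" unfolding Q(4) 1 c Aff2_def aff_id[symmetric] by blast
        moreover have "aff 1 1 \<noteq> id" by (simp add: aff_eq_iff flip: aff_id)
        ultimately have "L \<noteq> L'" using eq by blast
        then show ?thesis
          by (intro exI[of _ III_1]) (use decomp_types_Aff2(11) in \<open>simp add: c G_eq id_Aff, simp add: c 1 Q(4) mset_simps flip: G_eq[unfolded c id_Aff]\<close>)
      qed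
    next
      case 2
      have "n = 2" using n unfolding 2 by simp
      then show ?thesis
        by (intro exI[of _ I_2]) (use deg(1) Aff2_iso_200_42 Q_I2_normal[OF grp[unfolded Q(4) 2]] decomp_types_Aff2(2)
          in \<open>simp add: Q(4) 2 id_Aff mset_simps\<close>)
    next
      case 3
      have "n = 4" using n unfolding 3 by simp
      moreover have "S5S5_on (Aff2 Q_I3) \<cong> SmallGroup_100_11"
        unfolding SmallGroup_100_11_def by (rule Aff2_iso_C5xC5_C4) auto
      ultimately show ?thesis
        by (intro exI[of _ I_3]) (use deg(1) decomp_types_Aff2(3) in \<open>simp add: Q(4) 3 id_Aff mset_simps\<close>)
    next
      case 4
      have "n = 4" using n unfolding 4 by simp
      moreover have "S5S5_on (Aff2 Q_I4) \<cong> SmallGroup_100_12"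
        unfolding SmallGroup_100_12_def by (rule Aff2_iso_C5xC5_C4) auto
      ultimately show ?thesis
        by (intro exI[of _ I_4]) (use deg(1) decomp_types_Aff2(4) in \<open>simp add: Q(4) 4 id_Aff mset_simps\<close>)
    next
      case 5
      have "n = 2" using n unfolding 5 by simp
      moreover have "S5S5_on (Aff2 Q_I7) \<cong> SmallGroup_100_10"
        unfolding SmallGroup_100_10_def by (rule Aff2_iso_C5xC5_C4) auto
      ultimately show ?thesis
        by (intro exI[of _ I_7]) (use deg(1) decomp_types_Aff2(6) in \<open>simp add: Q(4) 5 id_Aff\<close>)
    next
      case 6
      have "n = 2" using n unfolding 6 by simp
      then show ?thesis
        by (intro exI[of _ II_2]) (use deg(1) Aff2_iso_50_4 decomp_types_Aff2(9) in \<open>simp add: Q(4) 6 id_Aff mset_simps\<close>)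
    qed
  next
    case False
    then obtain d f where PR: "R = P" and d: "d \<in> units5" and G: "G = twisted_diag P d f"
      using diag_case by blast
    have "L = L'" unfolding eq G using twisted_diag_kernels[OF d P] by blast
    note iso = twisted_diag_iso[OF P, of d f]
    consider "P = units5" | "P = {1, 4}" | "P = {1}" using P unfolding unit_subgroup_def by blast
    then show ?thesis
    proof cases
      case 1
      show ?thesis
        by (rule exI[of _ I_5])
          (use iso decomp_types_twisted_diag(1)[OF d, of f] \<open>L = L'\<close> in \<open>simp add: PR G 1 id_Aff mset_simps\<close>)
    next
      case 2
      show ?thesis
        by (rule exI[of _ II_3])
          (use iso decomp_types_twisted_diag(2)[OF d, of f] \<open>L = L'\<close> in \<open>simp add: PR G 2 id_Aff mset_simps\<close>)
    next
      case 3
      show ?thesis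
        by (rule exI[of _ III_2])
          (use iso decomp_types_twisted_diag(3)[OF d, of f] \<open>L = L'\<close> in \<open>simp add: PR G 3 id_Aff mset_simps\<close>)
    qed
  qed
qed

section \<open>Evaluation of multivariate polynomials\<close>

definition ring_map :: "('a::comm_ring_1 \<Rightarrow> 'b::comm_ring_1) \<Rightarrow> bool" where
  "ring_map \<phi> \<longleftrightarrow> \<phi> 0 = 0 \<and> \<phi> 1 = 1 \<and> (\<forall>x y. \<phi> (x + y) = \<phi> x + \<phi> y \<and> \<phi> (x * y) = \<phi> x * \<phi> y)"

lemma ring_mapD:
  assumes "ring_map \<phi>"
  shows "\<phi> 0 = 0" "\<phi> 1 = 1" "\<phi> (x + y) = \<phi> x + \<phi> y" "\<phi> (x * y) = \<phi> x * \<phi> y"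
    "\<phi> (- x) = - \<phi> x" "\<phi> (x - y) = \<phi> x - \<phi> y" "\<phi> (x ^ n) = \<phi> x ^ n"
    "\<phi> (sum f A) = (\<Sum>a\<in>A. \<phi> (f a))" "\<phi> (prod f A) = (\<Prod>a\<in>A. \<phi> (f a))"
proof -
  show z: "\<phi> 0 = 0" and o: "\<phi> 1 = 1" and add: "\<phi> (x + y) = \<phi> x + \<phi> y" and mult: "\<phi> (x * y) = \<phi> x * \<phi> y" for x y
    using assms by (auto simp: ring_map_def)
  show neg: "\<phi> (- x) = - \<phi> x" for x using add[of x "- x"] z by (simp add: eq_neg_iff_add_eq_0 add.commute)
  show "\<phi> (x - y) = \<phi> x - \<phi> y" using add[of x "- y"] neg by simp
  show "\<phi> (x ^ n) = \<phi> x ^ n" by (induction n) (simp_all add: o mult)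
  show "\<phi> (sum f A) = (\<Sum>a\<in>A. \<phi> (f a))" by (induction A rule: infinite_finite_induct) (simp_all add: z add)
  show "\<phi> (prod f A) = (\<Prod>a\<in>A. \<phi> (f a))" by (induction A rule: infinite_finite_induct) (simp_all add: o mult)
qed

definition mmonom :: "(nat \<Rightarrow> 's::comm_ring_1) \<Rightarrow> (nat \<Rightarrow>\<^sub>0 nat) \<Rightarrow> 's" where
  "mmonom \<nu> m = (\<Prod>i\<in>Poly_Mapping.keys m. \<nu> i ^ Poly_Mapping.lookup m i)"

lemma mmonom_superset:
  assumes "finite A" "Poly_Mapping.keys m \<subseteq> A"
  shows "mmonom \<nu> m = (\<Prod>i\<in>A. \<nu> i ^ Poly_Mapping.lookup m i)"
  unfolding mmonom_def using assms by (intro prod.mono_neutral_left) (auto simp: in_keys_iff)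

lemma mmonom_add: "mmonom \<nu> (m + n) = mmonom \<nu> m * mmonom \<nu> n"
proof -
  let ?A = "Poly_Mapping.keys m \<union> Poly_Mapping.keys n"
  have "mmonom \<nu> (m + n) = (\<Prod>i\<in>?A. \<nu> i ^ Poly_Mapping.lookup (m + n) i)"
    by (rule mmonom_superset) (use Poly_Mapping.keys_add[of m n] in auto)
  also have "\<dots> = (\<Prod>i\<in>?A. \<nu> i ^ Poly_Mapping.lookup m i) * (\<Prod>i\<in>?A. \<nu> i ^ Poly_Mapping.lookup n i)"
    by (simp add: lookup_add power_add prod.distrib)
  finally show ?thesis using mmonom_superset[of ?A m \<nu>] mmonom_superset[of ?A n \<nu>] by simp
qed

lemma meval_superset:
  assumes "ring_map \<phi>" "finite A" "Poly_Mapping.keys P \<subseteq> A"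
  shows "meval \<phi> \<nu> P = (\<Sum>m\<in>A. \<phi> (Poly_Mapping.lookup P m) * mmonom \<nu> m)"
  unfolding meval_def mmonom_def[symmetric] using assms
  by (intro sum.mono_neutral_left) (auto simp: in_keys_iff ring_mapD)

lemma meval_add:
  assumes "ring_map \<phi>" shows "meval \<phi> \<nu> (P + Q) = meval \<phi> \<nu> P + meval \<phi> \<nu> Q"
proof -
  let ?A = "Poly_Mapping.keys P \<union> Poly_Mapping.keys Q"
  have "meval \<phi> \<nu> (P + Q) = (\<Sum>m\<in>?A. \<phi> (Poly_Mapping.lookup (P + Q) m) * mmonom \<nu> m)"
    by (rule meval_superset[OF assms]) (use Poly_Mapping.keys_add[of P Q] in auto)
  also have "\<dots> = (\<Sum>m\<in>?A. \<phi> (Poly_Mapping.lookup P m) * mmonom \<nu> m) + (\<Sum>m\<in>?A. \<phi> (Poly_Mapping.lookup Q m) * mmonom \<nu> m)"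
    by (simp add: lookup_add ring_mapD[OF assms] distrib_right sum.distrib)
  finally show ?thesis using meval_superset[OF assms, of ?A P \<nu>] meval_superset[OF assms, of ?A Q \<nu>] by simp
qed

lemma meval_single:
  assumes "ring_map \<phi>" shows "meval \<phi> \<nu> (Poly_Mapping.single m c) = \<phi> c * mmonom \<nu> m"
  using meval_superset[OF assms, of "{m}" "Poly_Mapping.single m c" \<nu>] by simp

lemma meval_zero: "ring_map \<phi> \<Longrightarrow> meval \<phi> \<nu> 0 = 0"
  by (simp add: meval_def)

lemma meval_sum: "ring_map \<phi> \<Longrightarrow> meval \<phi> \<nu> (sum f A) = (\<Sum>a\<in>A. meval \<phi> \<nu> (f a))"
  by (induction A rule: infinite_finite_induct) (simp_all add: meval_zero meval_add)

lemma mpoly_sum_single: "P = (\<Sum>m\<in>Poly_Mapping.keys P. Poly_Mapping.single m (Poly_Mapping.lookup P m))"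
  by (rule poly_mapping_eqI) (auto simp: lookup_sum lookup_single when_def in_keys_iff)

lemma meval_mult:
  assumes "ring_map \<phi>" shows "meval \<phi> \<nu> (P * Q) = meval \<phi> \<nu> P * meval \<phi> \<nu> Q"
proof -
  let ?s = "\<lambda>P m. Poly_Mapping.single m (Poly_Mapping.lookup P m)"
  have "P * Q = (\<Sum>m\<in>Poly_Mapping.keys P. ?s P m) * (\<Sum>n\<in>Poly_Mapping.keys Q. ?s Q n)"
    by (simp only: mpoly_sum_single[symmetric])
  also have "\<dots> = (\<Sum>m\<in>Poly_Mapping.keys P. \<Sum>n\<in>Poly_Mapping.keys Q. ?s P m * ?s Q n)"
    by (simp only: sum_product)
  finally have "meval \<phi> \<nu> (P * Q) = (\<Sum>m\<in>Poly_Mapping.keys P. \<Sum>n\<in>Poly_Mapping.keys Q. meval \<phi> \<nu> (?s P m * ?s Q n))"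
    by (simp only: meval_sum[OF assms])
  also have "\<dots> = (\<Sum>m\<in>Poly_Mapping.keys P. \<Sum>n\<in>Poly_Mapping.keys Q.
      (\<phi> (Poly_Mapping.lookup P m) * mmonom \<nu> m) * (\<phi> (Poly_Mapping.lookup Q n) * mmonom \<nu> n))"
    by (simp add: mult_single meval_single[OF assms] ring_mapD[OF assms] mmonom_add ac_simps)
  also have "\<dots> = meval \<phi> \<nu> P * meval \<phi> \<nu> Q"
    unfolding meval_def mmonom_def[symmetric] by (simp only: sum_product)
  finally show ?thesis .
qed

lemma ring_map_meval: assumes "ring_map \<phi>" shows "ring_map (meval \<phi> \<nu>)"
proof -
  have "meval \<phi> \<nu> 1 = 1"
    using meval_single[OF assms, of \<nu> 0 1] by (simp add: ring_mapD[OF assms] mmonom_def single_one)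
  then show ?thesis by (simp add: ring_map_def meval_zero[OF assms] meval_add[OF assms] meval_mult[OF assms])
qed

lemma meval_mvar: "ring_map \<phi> \<Longrightarrow> meval \<phi> \<nu> (mvar i) = \<nu> i"
  unfolding mvar_def by (simp add: meval_single ring_mapD mmonom_def)

lemma ring_map_mconst: "ring_map mconst"
  by (simp add: ring_map_def mconst_def single_add mult_single single_one)

lemma meval_ring_map:
  assumes "ring_map \<psi>"
  shows "\<psi> (meval \<phi> \<nu> P) = meval (\<lambda>c. \<psi> (\<phi> c)) (\<lambda>i. \<psi> (\<nu> i)) P"
  by (simp add: meval_def ring_mapD[OF assms])

lemma meval_cong:
  assumes "\<And>i. i \<in> mvars P \<Longrightarrow> \<nu> i = \<nu>' i"
  shows "meval \<phi> \<nu> P = meval \<phi> \<nu>' P"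
  unfolding meval_def
proof (intro sum.cong refl arg_cong2[where f = "(*)"] prod.cong)
  fix m i assume "m \<in> Poly_Mapping.keys P" "i \<in> Poly_Mapping.keys m"
  then have "i \<in> mvars P" by (auto simp: mvars_def)
  then show "\<nu> i ^ Poly_Mapping.lookup m i = \<nu>' i ^ Poly_Mapping.lookup m i" using assms by simp
qed

lemma ring_map_comp: "ring_map \<phi> \<Longrightarrow> ring_map \<psi> \<Longrightarrow> ring_map (\<lambda>x. \<psi> (\<phi> x))"
  by (simp add: ring_map_def)

lemma ring_map_Fract: "ring_map (\<lambda>P :: 'a::idom. Fract P 1)"
  by (simp add: ring_map_def Zero_fract_def One_fract_def)

text \<open>Equality of fractions is a cross-multiplied identity, which \<open>\<phi>\<close>
  preserves; so every representation with nonvanishing denominator gives the same value.\<close>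

lemma fract_eval_Fract:
  assumes \<phi>: "ring_map \<phi>" and d: "\<phi> d \<noteq> (0 :: 's::field)"
  shows "fract_eval \<phi> (Fract n d) = \<phi> n / \<phi> d"
  unfolding fract_eval_def
proof (rule the_equality)
  show "\<exists>n' d'. Fract n d = Fract n' d' \<and> \<phi> d' \<noteq> 0 \<and> \<phi> n / \<phi> d = \<phi> n' / \<phi> d'" using d by blast
  fix y assume "\<exists>n' d'. Fract n d = Fract n' d' \<and> \<phi> d' \<noteq> 0 \<and> y = \<phi> n' / \<phi> d'"
  then obtain n' d' where y: "Fract n d = Fract n' d'" "\<phi> d' \<noteq> 0" "y = \<phi> n' / \<phi> d'" by blast
  have "d \<noteq> 0" "d' \<noteq> 0" using d y(2) ring_mapD(1)[OF \<phi>] by auto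
  then have "n * d' = n' * d" using y(1) by (simp add: eq_fract)
  then have "\<phi> n * \<phi> d' = \<phi> n' * \<phi> d" by (metis ring_mapD(4)[OF \<phi>])
  then show "y = \<phi> n / \<phi> d" unfolding y(3) using d y(2) by (simp add: frac_eq_eq)
qed

text \<open>The polynomial counterpart of \<open>perm_act\<close>, needed to permute numerator and
  denominator of the invariant separately.\<close>

definition perm_mpoly :: "(nat \<Rightarrow> nat) \<times> (nat \<Rightarrow> nat) \<Rightarrow> 'k::field mpoly \<Rightarrow> 'k mpoly" where
  "perm_mpoly \<pi> = meval mconst (join_xy (\<lambda>i. mvar (fst \<pi> i)) (\<lambda>i. mvar (5 + snd \<pi> i)))"

lemma perm_act_Fract:
  fixes N D :: "'k::field mpoly"
  assumes "perm_mpoly \<pi> D \<noteq> 0"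
  shows "perm_act \<pi> (Fract N D) = Fract (perm_mpoly \<pi> N) (perm_mpoly \<pi> D)"
proof -
  let ?\<psi> = "meval (\<lambda>c. Fract (mconst c) 1) (join_xy (\<lambda>i. Fract (mvar (fst \<pi> i)) 1) (\<lambda>i. Fract (mvar (5 + snd \<pi> i)) 1)) :: 'k mpoly \<Rightarrow> 'k mpoly fract"
  have "?\<psi> P = Fract (perm_mpoly \<pi> P) 1" for P
  proof -
    have "Fract (perm_mpoly \<pi> P) 1 = meval (\<lambda>c. Fract (mconst c) 1) (\<lambda>i. Fract (join_xy (\<lambda>i. mvar (fst \<pi> i)) (\<lambda>i. mvar (5 + snd \<pi> i)) i) 1) P"
      unfolding perm_mpoly_def by (rule meval_ring_map[OF ring_map_Fract])
    also have "(\<lambda>i. Fract (join_xy (\<lambda>i. mvar (fst \<pi> i)) (\<lambda>i. mvar (5 + snd \<pi> i)) i) 1 :: 'k mpoly fract) =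
        join_xy (\<lambda>i. Fract (mvar (fst \<pi> i)) 1) (\<lambda>i. Fract (mvar (5 + snd \<pi> i)) 1)"
      by (auto simp: join_xy_def)
    finally show ?thesis by simp
  qed
  moreover have "ring_map ?\<psi>" by (rule ring_map_meval[OF ring_map_comp[OF ring_map_mconst ring_map_Fract]])
  moreover have "Fract (perm_mpoly \<pi> D) 1 \<noteq> 0" using assms by (simp add: Zero_fract_def eq_fract)
  ultimately show ?thesis unfolding perm_act_def by (simp add: fract_eval_Fract)
qed

section \<open>The resolvent\<close>

lemma poly_map_poly_to_ac: "poly (map_poly to_ac r) (to_ac k) = to_ac (poly r k)"
  by (induction r) (simp_all add: map_poly_pCons)

text \<open>Fixes one representation of the invariant with Vandermonde denominator. Of primitivity
  only invariance under \<open>U\<close> is carried along.\<close>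

locale evaluated_invariant = two_separable_quintics p q \<alpha> \<beta>
  for p q :: "'m::field poly" and \<alpha> \<beta> :: "nat \<Rightarrow> 'm alg_closure" +
  fixes \<iota> :: "'k::field \<Rightarrow> 'm" and U V and \<Theta> :: "'k mpoly fract" and N :: "'k mpoly" and a b :: nat
  assumes \<iota>: "ring_map \<iota>" and UV: "diagonal_cosets U V"
    and \<Theta>: "\<Theta> = Fract N (Delta_x ^ a * Delta_y ^ b)" and N: "mvars N \<subseteq> {1..10}"
    and stab: "\<And>u. u \<in> U \<Longrightarrow> perm_act u \<Theta> = \<Theta>"
begin

interpretation diagonal_cosets U V by (rule UV)

definition den :: "'k mpoly" where "den = Delta_x ^ a * Delta_y ^ b"

definition ev :: "(nat \<Rightarrow> nat) \<times> (nat \<Rightarrow> nat) \<Rightarrow> 'k mpoly \<Rightarrow> 'm alg_closure" where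
  "ev \<pi> = meval (\<lambda>c. to_ac (\<iota> c)) (join_xy (\<lambda>i. \<alpha> (fst \<pi> i)) (\<lambda>i. \<beta> (snd \<pi> i)))"

text \<open>The value at the roots of the permuted invariant, as the quotient of two polynomial
  evaluations at permuted roots.\<close>

definition val :: "(nat \<Rightarrow> nat) \<times> (nat \<Rightarrow> nat) \<Rightarrow> 'm alg_closure" where
  "val \<pi> = ev \<pi> N / ev \<pi> den"

lemma ring_map_const: "ring_map (\<lambda>c. to_ac (\<iota> c))"
  by (rule ring_map_comp[OF \<iota>]) (simp add: ring_map_def)

lemma ring_map_ev: "ring_map (ev \<pi>)"
  unfolding ev_def by (rule ring_map_meval[OF ring_map_const])

lemma ev_Delta:
  "ev \<pi> Delta_x = (\<Prod>j\<in>{1..5}. \<Prod>i\<in>{1..<j}. \<alpha> (fst \<pi> i) - \<alpha> (fst \<pi> j))"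
  "ev \<pi> Delta_y = (\<Prod>j\<in>{1..5}. \<Prod>i\<in>{1..<j}. \<beta> (snd \<pi> i) - \<beta> (snd \<pi> j))"
proof -
  have x: "ev \<pi> (mvar i) = \<alpha> (fst \<pi> i)" if "i \<le> 5" for i
    unfolding ev_def by (simp add: meval_mvar[OF ring_map_const] join_xy_def that)
  have y: "ev \<pi> (mvar (5 + i)) = \<beta> (snd \<pi> i)" if "1 \<le> i" for i
    unfolding ev_def using that by (simp add: meval_mvar[OF ring_map_const] join_xy_def)
  show "ev \<pi> Delta_x = (\<Prod>j\<in>{1..5}. \<Prod>i\<in>{1..<j}. \<alpha> (fst \<pi> i) - \<alpha> (fst \<pi> j))"
    unfolding Delta_x_def ring_mapD(9,6)[OF ring_map_ev] by (intro prod.cong refl arg_cong2[where f = minus] x) auto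
  show "ev \<pi> Delta_y = (\<Prod>j\<in>{1..5}. \<Prod>i\<in>{1..<j}. \<beta> (snd \<pi> i) - \<beta> (snd \<pi> j))"
    unfolding Delta_y_def ring_mapD(9,6)[OF ring_map_ev] by (intro prod.cong refl arg_cong2[where f = minus] y) auto
qed

text \<open>Permuted roots stay distinct, so neither Vandermonde product vanishes.\<close>

lemma ev_den_nonzero:
  assumes "fst \<pi> permutes {1..5}" "snd \<pi> permutes {1..5}"
  shows "ev \<pi> den \<noteq> 0"
proof -
  have nz: "(\<Prod>j\<in>{1..5::nat}. \<Prod>i\<in>{1..<j}. \<gamma> (g i) - \<gamma> (g j)) \<noteq> 0"
    if inj: "inj_on \<gamma> {1..5}" and g: "g permutes {1..5}" for \<gamma> :: "nat \<Rightarrow> 'm alg_closure" and g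
  proof -
    have "\<gamma> (g i) \<noteq> \<gamma> (g j)" if "j \<in> {1..5}" "i \<in> {1..<j}" for i j
    proof
      assume "\<gamma> (g i) = \<gamma> (g j)"
      moreover have "i \<in> {1..5}" using that by auto
      ultimately have "g i = g j" using inj_onD[OF inj] permutes_in_image[OF g] that(1) by metis
      then have "i = j" using permutes_inj[OF g] by (meson injD)
      then show False using that by simp
    qed
    then show ?thesis by (simp only: prod_zero_iff finite_atLeastAtMost finite_atLeastLessThan right_minus_eq bex_simps) blast
  qed
  show ?thesis
    unfolding den_def ring_mapD(4,7)[OF ring_map_ev] ev_Delta
    using nz[OF P.inj_roots assms(1)] nz[OF Q.inj_roots assms(2)] by (simp only: mult_eq_0_iff power_eq_0_iff) blast
qed

text \<open>An indeterminate with index i passes to index \<pi>(i) and from there to the root with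
  index \<rho>(\<pi>(i)), which explains the order of composition.\<close>

lemma ev_perm_mpoly:
  assumes \<pi>: "fst \<pi> permutes {1..5}" "snd \<pi> permutes {1..5}"
  shows "ev \<rho> (perm_mpoly \<pi> f) = ev (fst \<rho> \<circ> fst \<pi>, snd \<rho> \<circ> snd \<pi>) f"
proof -
  \<comment> \<open>The blocks of \<open>join_xy\<close> are cut at 5 on all natural numbers, so the
    index 0 and indices beyond the range have to be checked too; permutations leave them
    fixed.\<close>
  have small: "fst \<pi> i \<le> 5 \<longleftrightarrow> i \<le> 5" for i
  proof (cases "i \<in> {1..5}")
    case True
    then show ?thesis using permutes_in_image[OF \<pi>(1), of i] by simp
  next
    case False
    then show ?thesis using permutes_not_in[OF \<pi>(1)] by metis
  qed
  have pos: "1 \<le> snd \<pi> i" if "1 \<le> i" for i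
  proof (cases "i \<in> {1..5}")
    case True
    then show ?thesis using permutes_in_image[OF \<pi>(2), of i] by simp
  next
    case False
    then show ?thesis using permutes_not_in[OF \<pi>(2)] that by metis
  qed
  have "ev \<rho> (perm_mpoly \<pi> f) =
    meval (\<lambda>c. ev \<rho> (mconst c)) (\<lambda>i. ev \<rho> (join_xy (\<lambda>i. mvar (fst \<pi> i)) (\<lambda>i. mvar (5 + snd \<pi> i)) i)) f"
    unfolding perm_mpoly_def by (rule meval_ring_map[OF ring_map_ev])
  also have "(\<lambda>c. ev \<rho> (mconst c)) = (\<lambda>c. to_ac (\<iota> c))"
    unfolding ev_def mconst_def meval_single[OF ring_map_const] by (simp add: mmonom_def)
  also have "(\<lambda>i. ev \<rho> (join_xy (\<lambda>i. mvar (fst \<pi> i)) (\<lambda>i. mvar (5 + snd \<pi> i)) i)) =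
      join_xy (\<lambda>i. \<alpha> ((fst \<rho> \<circ> fst \<pi>) i)) (\<lambda>i. \<beta> ((snd \<rho> \<circ> snd \<pi>) i))"
  proof
    fix i
    show "ev \<rho> (join_xy (\<lambda>i. mvar (fst \<pi> i)) (\<lambda>i. mvar (5 + snd \<pi> i)) i) =
      join_xy (\<lambda>i. \<alpha> ((fst \<rho> \<circ> fst \<pi>) i)) (\<lambda>i. \<beta> ((snd \<rho> \<circ> snd \<pi>) i)) i"
    proof (cases "i \<le> 5")
      case True
      then show ?thesis using small[of i] by (simp add: join_xy_def ev_def meval_mvar[OF ring_map_const])
    next
      case False
      then have "1 \<le> snd \<pi> (i - 5)" by (intro pos) simp
      then show ?thesis using False by (simp add: join_xy_def ev_def meval_mvar[OF ring_map_const])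
    qed
  qed
  finally show ?thesis by (simp add: ev_def)
qed

text \<open>A polynomial with a nonzero value is nonzero, and the enumerated roots supply such a
  value.\<close>

lemma perm_den_nonzero:
  assumes "fst \<pi> permutes {1..5}" "snd \<pi> permutes {1..5}"
  shows "perm_mpoly \<pi> den \<noteq> 0"
proof
  assume "perm_mpoly \<pi> den = 0"
  then have "ev (id, id) (perm_mpoly \<pi> den) = 0" by (simp add: ring_mapD(1)[OF ring_map_ev])
  then have "ev (fst \<pi>, snd \<pi>) den = 0" unfolding ev_perm_mpoly[OF assms] by simp
  then show False using ev_den_nonzero[of "(fst \<pi>, snd \<pi>)"] assms by simp
qed

lemma omega_eq_val:
  assumes "fst \<pi> permutes {1..5}" "snd \<pi> permutes {1..5}"
  shows "omega \<iota> \<alpha> \<beta> (perm_act \<pi> \<Theta>) = val \<pi>"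
proof -
  have "omega \<iota> \<alpha> \<beta> = fract_eval (ev (id, id))" by (simp add: omega_def ev_def)
  moreover have "perm_act \<pi> \<Theta> = Fract (perm_mpoly \<pi> N) (perm_mpoly \<pi> den)"
    unfolding \<Theta> den_def[symmetric] by (rule perm_act_Fract[OF perm_den_nonzero[OF assms]])
  moreover have "ev (id, id) (perm_mpoly \<pi> f) = ev \<pi> f" for f unfolding ev_perm_mpoly[OF assms] by simp
  ultimately show ?thesis
    using fract_eval_Fract[OF ring_map_ev, of "(id, id)" "perm_mpoly \<pi> den" "perm_mpoly \<pi> N"] ev_den_nonzero[OF assms]
    by (simp add: val_def)
qed

text \<open>Invariance under \<open>(f, f)\<close> is an identity of fractions; cross-multiplied it
  is an identity of polynomials, which may be evaluated at the roots permuted by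
  \<open>(g, h)\<close>.\<close>

lemma val_invariant:
  assumes \<pi>: "g permutes {1..5}" "h permutes {1..5}" and f: "f \<in> V"
  shows "val (g \<circ> f, h \<circ> f) = val (g, h)"
proof -
  have per: "f permutes {1..5}" using f subgroup.subset[OF V] by auto
  let ?u = "(f, f)"
  have "?u \<in> U" using U f by auto
  then have "Fract (perm_mpoly ?u N) (perm_mpoly ?u den) = Fract N den"
    using stab[of ?u] perm_act_Fract[OF perm_den_nonzero, of ?u N] per unfolding \<Theta> den_def[symmetric] by simp
  moreover have "den \<noteq> 0" using ev_den_nonzero[of "(id, id)"] ring_mapD(1)[OF ring_map_ev, of "(id, id)"] permutes_id by auto
  moreover have "perm_mpoly ?u den \<noteq> 0" using perm_den_nonzero[of ?u] per by simp
  ultimately have "perm_mpoly ?u N * den = N * perm_mpoly ?u den" by (simp add: eq_fract)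
  then have "ev (g, h) (perm_mpoly ?u N) * ev (g, h) den = ev (g, h) N * ev (g, h) (perm_mpoly ?u den)"
    by (metis ring_mapD(4)[OF ring_map_ev])
  then have "ev (g \<circ> f, h \<circ> f) N * ev (g, h) den = ev (g, h) N * ev (g \<circ> f, h \<circ> f) den"
    using ev_perm_mpoly[of ?u] per by simp
  moreover have "ev (g \<circ> f, h \<circ> f) den \<noteq> 0" "ev (g, h) den \<noteq> 0"
    using ev_den_nonzero[of "(g \<circ> f, h \<circ> f)"] ev_den_nonzero[of "(g, h)"] \<pi>
      permutes_compose[OF per \<pi>(1)] permutes_compose[OF per \<pi>(2)] by simp_all
  ultimately show ?thesis unfolding val_def by (simp add: frac_eq_eq)
qed

text \<open>An automorphism is known only on the ten roots. The bound on the indeterminates of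
  \<open>N\<close> ensures that nothing else is evaluated.\<close>

lemma abs_gal_val:
  assumes s: "s \<in> abs_gal" "\<forall>i\<in>{1..5}. s (\<alpha> i) = \<alpha> (g i) \<and> s (\<beta> i) = \<beta> (h i)"
    and \<pi>: "fst \<pi> permutes {1..5}" "snd \<pi> permutes {1..5}"
  shows "s (val \<pi>) = val (g \<circ> fst \<pi>, h \<circ> snd \<pi>)"
proof -
  have rs: "ring_map s" by (simp add: ring_map_def abs_gal_simps[OF s(1)])
  have im: "fst \<pi> i \<in> {1..5}" "snd \<pi> i \<in> {1..5}" if "i \<in> {1..5}" for i
    using permutes_in_image[OF \<pi>(1)] permutes_in_image[OF \<pi>(2)] that by blast+
  have "s (ev \<pi> N) = ev (g \<circ> fst \<pi>, h \<circ> snd \<pi>) N"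
    unfolding ev_def meval_ring_map[OF rs] abs_gal_simps(3)[OF s(1)]
  proof (rule meval_cong)
    fix i assume "i \<in> mvars N"
    then have i: "i \<in> {1..10}" using N by blast
    show "s (join_xy (\<lambda>i. \<alpha> (fst \<pi> i)) (\<lambda>i. \<beta> (snd \<pi> i)) i) =
        join_xy (\<lambda>i. \<alpha> (fst (g \<circ> fst \<pi>, h \<circ> snd \<pi>) i)) (\<lambda>i. \<beta> (snd (g \<circ> fst \<pi>, h \<circ> snd \<pi>) i)) i"
    proof (cases "i \<le> 5")
      case True
      then have "i \<in> {1..5}" using i by auto
      then show ?thesis using s(2) im(1)[of i] True by (simp add: join_xy_def)
    next
      case False
      then have "i - 5 \<in> {1..5}" using i by auto
      then show ?thesis using s(2) im(2)[of "i - 5"] False by (simp add: join_xy_def)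
    qed
  qed
  moreover have "s (ev \<pi> den) = ev (g \<circ> fst \<pi>, h \<circ> snd \<pi>) den"
  proof -
    have "s (ev \<pi> Delta_x) = ev (g \<circ> fst \<pi>, h \<circ> snd \<pi>) Delta_x"
      unfolding ev_Delta ring_mapD(9,6)[OF rs]
      by (intro prod.cong refl arg_cong2[where f = minus]) (use s(2) im(1) in auto)
    moreover have "s (ev \<pi> Delta_y) = ev (g \<circ> fst \<pi>, h \<circ> snd \<pi>) Delta_y"
      unfolding ev_Delta ring_mapD(9,6)[OF rs]
      by (intro prod.cong refl arg_cong2[where f = minus]) (use s(2) im(2) in auto)
    ultimately show ?thesis unfolding den_def by (simp only: ring_mapD(4,7)[OF ring_map_ev] ring_mapD(4,7)[OF rs])
  qed
  moreover have "s (x / y) = s x / s y" if "y \<noteq> 0" for x y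
  proof -
    have "s (x / y) * s y = s x" using that by (simp flip: abs_gal_simps(2)[OF s(1)])
    moreover have "s y \<noteq> 0" using that abs_gal_inj[OF s(1)] abs_gal_simps(4)[OF s(1)] by (metis injD)
    ultimately show ?thesis by (simp add: eq_divide_eq)
  qed
  ultimately show ?thesis unfolding val_def using ev_den_nonzero[OF \<pi>] by simp
qed

lemma val_in_field_hull:
  assumes \<pi>: "fst \<pi> permutes {1..5}" "snd \<pi> permutes {1..5}"
  shows "val \<pi> \<in> field_hull (\<alpha> ` {1..5} \<union> \<beta> ` {1..5})" (is "_ \<in> ?E")
proof -
  note E = field_hull_intermediate[of "\<alpha> ` {1..5} \<union> \<beta> ` {1..5}"]
  have im: "fst \<pi> i \<in> {1..5}" "snd \<pi> i \<in> {1..5}" if "i \<in> {1..5}" for i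
    using permutes_in_image[OF \<pi>(1)] permutes_in_image[OF \<pi>(2)] that by blast+
  have root: "\<alpha> i \<in> ?E" "\<beta> i \<in> ?E" if "i \<in> {1..5}" for i
    using field_hull_superset[of "\<alpha> ` {1..5} \<union> \<beta> ` {1..5}"] that by blast+
  have "ev \<pi> N \<in> ?E"
    unfolding ev_def meval_def
  proof (intro intermediate_sum[OF E] intermediateD(6)[OF E] intermediateD(1)[OF E] intermediate_prod[OF E] intermediateD(9)[OF E])
    fix m i assume "m \<in> Poly_Mapping.keys N" "i \<in> Poly_Mapping.keys m"
    then have i: "i \<in> {1..10}" using N by (auto simp: mvars_def)
    show "join_xy (\<lambda>i. \<alpha> (fst \<pi> i)) (\<lambda>i. \<beta> (snd \<pi> i)) i \<in> ?E"
    proof (cases "i \<le> 5")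
      case True
      then have "i \<in> {1..5}" using i by auto
      then show ?thesis using root(1)[OF im(1)] True by (simp add: join_xy_def)
    next
      case False
      then have "i - 5 \<in> {1..5}" using i by auto
      then show ?thesis using root(2)[OF im(2)] False by (simp add: join_xy_def)
    qed
  qed
  moreover have "ev \<pi> den \<in> ?E"
    unfolding den_def ring_mapD(4,7)[OF ring_map_ev] ev_Delta
    by (intro intermediateD(6,8,9)[OF E] intermediate_prod[OF E] root im) auto
  ultimately show ?thesis unfolding val_def divide_inverse
    by (intro intermediateD(6)[OF E] intermediate_inverse[OF E])
qed

definition root_of :: "((nat \<Rightarrow> nat) \<times> (nat \<Rightarrow> nat)) set \<Rightarrow> 'm alg_closure" where
  "root_of C = omega \<iota> \<alpha> \<beta> (perm_act (SOME \<pi>. \<pi> \<in> C) \<Theta>)"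

text \<open>Whatever representative is chosen, it differs from \<open>(x, id)\<close> by a diagonal
  element, under which the value does not change.\<close>

lemma root_of_coset:
  assumes "x \<in> Aff units5" shows "root_of (coset x) = val (x, id)"
proof -
  have x: "x permutes {1..5}" using assms aff_permutes by (auto simp: Aff_def simp del: insert_iff)
  have "(SOME \<pi>. \<pi> \<in> coset x) \<in> coset x"
    by (rule someI[of _ "(x, id)"]) (use V_facts(1) in \<open>force simp: coset_def\<close>)
  then obtain f where f: "f \<in> V" "(SOME \<pi>. \<pi> \<in> coset x) = (x \<circ> f, f)" by (auto simp: coset_def)
  have per: "f permutes {1..5}" using f subgroup.subset[OF V] by auto
  have "root_of (coset x) = val (x \<circ> f, f)"
    unfolding root_of_def f(2) by (rule omega_eq_val) (use permutes_compose[OF per x] per in simp_all)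
  also have "\<dots> = val (x, id)" using val_invariant[OF x permutes_id f(1)] by simp
  finally show ?thesis .
qed

context
  assumes ord: "carrier (perm_gal2 \<alpha> p \<beta> q) \<subseteq> Aff units5 \<times> Aff units5"
begin

lemma Aff_closed:
  assumes "x \<in> Aff units5" "(g, h) \<in> carrier (perm_gal2 \<alpha> p \<beta> q)"
  shows "g \<circ> x \<circ> inv' h \<in> Aff units5"
proof -
  have A: "subgroup (Aff units5) S5" by (rule subgroup_Aff) (simp add: unit_subgroup_def)
  have gh: "g \<in> Aff units5" "h \<in> Aff units5" using ord assms(2) by auto
  have "h permutes {1..5}" using gh(2) subgroup.subset[OF A] by auto
  then show ?thesis
    using subgroup.m_closed[OF A subgroup.m_closed[OF A gh(1) assms(1)] subgroup.m_inv_closed[OF A gh(2)]]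
    by (simp only: S5_simps inv_S5)
qed

text \<open>The bridge between fields and groups: the Galois action on the values is left
  multiplication on the cosets, since a second component in \<open>V\<close> can be cancelled by
  invariance.\<close>

lemma abs_gal_root_of:
  assumes s: "s \<in> abs_gal" "\<forall>i\<in>{1..5}. s (\<alpha> i) = \<alpha> (g i) \<and> s (\<beta> i) = \<beta> (h i)"
    and gh: "(g, h) \<in> carrier (perm_gal2 \<alpha> p \<beta> q)" and x: "x \<in> Aff units5"
  shows "s (root_of (coset x)) = root_of (coset (g \<circ> x \<circ> inv' h))"
proof -
  have per: "g permutes {1..5}" "h permutes {1..5}" using gh perm_gal2_iff by blast+
  have h: "h \<in> V" using ord gh F20_V by blast
  have xp: "x permutes {1..5}" using x aff_permutes by (auto simp: Aff_def simp del: insert_iff)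
  have "s (root_of (coset x)) = val (g \<circ> x, h)"
    unfolding root_of_coset[OF x] using abs_gal_val[OF s, of "(x, id)"] xp permutes_id by simp
  also have "\<dots> = val (g \<circ> x \<circ> inv' h \<circ> h, id \<circ> h)"
    using permutes_inv_o(2)[OF per(2)] by (simp add: comp_assoc)
  also have "\<dots> = val (g \<circ> x \<circ> inv' h, id)"
    by (rule val_invariant[OF _ permutes_id h]) (intro permutes_compose permutes_inv per xp)
  finally show ?thesis unfolding root_of_coset[OF Aff_closed[OF x gh]] .
qed

lemma finite_Aff: "finite (Aff units5)"
  using bij_betw_finite[OF bij_betw_Aff[OF order_refl]] by simp

lemma separable_roots: "z \<in> \<alpha> ` {1..5} \<union> \<beta> ` {1..5} \<Longrightarrow> separable_over base_field z"
  using P.separable[OF intermediate_base] Q.separable[OF intermediate_base] by blast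

text \<open>The joint group lies in F20 \<times> F20 and so permutes the 20 affine labels;
  automorphisms permute the linear factors accordingly.\<close>

lemma resolvent_R1_descends:
  "\<exists>r. map_poly to_ac r = resolvent \<iota> \<alpha> \<beta> \<Theta> (index_R1 U)"
  unfolding resolvent_def root_of_def[symmetric]
proof (rule resolvent_descends)
  show "finite (index_R1 U)" unfolding index_R1_eq using finite_Aff by simp
  show "finite (\<alpha> ` {1..5} \<union> \<beta> ` {1..5})" by simp
  show "root_of C \<in> field_hull (\<alpha> ` {1..5} \<union> \<beta> ` {1..5})" if C: "C \<in> index_R1 U" for C
  proof -
    obtain x where x: "x \<in> Aff units5" "C = coset x" using C unfolding index_R1_eq by blast
    then have "x permutes {1..5}" using aff_permutes by (auto simp: Aff_def simp del: insert_iff)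
    then show ?thesis unfolding x(2) root_of_coset[OF x(1)] using val_in_field_hull[of "(x, id)"] permutes_id by simp
  qed
  show "\<exists>\<pi>. bij_betw \<pi> (index_R1 U) (index_R1 U) \<and> (\<forall>C\<in>index_R1 U. s (root_of C) = root_of (\<pi> C))"
    if s: "s \<in> abs_gal" for s
  proof -
    obtain g h where gh: "(g, h) \<in> carrier (perm_gal2 \<alpha> p \<beta> q)"
      "\<forall>i\<in>{1..5}. s (\<alpha> i) = \<alpha> (g i) \<and> s (\<beta> i) = \<beta> (h i)" using perm_pair_exists[OF s] by blast
    have per: "g permutes {1..5}" "h permutes {1..5}" using gh(1) perm_gal2_iff by blast+
    have h: "h \<in> V" using ord gh(1) F20_V by blast
    let ?\<pi> = "\<lambda>C. (g, h) <#\<^bsub>S5 \<times>\<times> S5\<^esub> C"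
    note act = l_coset_coset[OF h, of g]
    have "inj_on ?\<pi> (index_R1 U)"
    proof (rule inj_onI)
      fix C C' assume "C \<in> index_R1 U" "C' \<in> index_R1 U" "?\<pi> C = ?\<pi> C'"
      then obtain x y where xy: "C = coset x" "C' = coset y" "coset (g \<circ> x \<circ> inv' h) = coset (g \<circ> y \<circ> inv' h)"
        unfolding index_R1_eq using act by auto
      then have "g \<circ> x \<circ> inv' h = g \<circ> y \<circ> inv' h" using injD[OF inj_coset] by blast
      then have "inv' g \<circ> (g \<circ> x \<circ> inv' h) \<circ> h = inv' g \<circ> (g \<circ> y \<circ> inv' h) \<circ> h" by simp
      then have "(inv' g \<circ> g) \<circ> x \<circ> (inv' h \<circ> h) = (inv' g \<circ> g) \<circ> y \<circ> (inv' h \<circ> h)" by (simp only: comp_assoc)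
      then have "x = y" by (simp only: permutes_inv_o[OF per(1)] permutes_inv_o[OF per(2)] id_comp comp_id)
      then show "C = C'" using xy by simp
    qed
    moreover have "?\<pi> ` index_R1 U \<subseteq> index_R1 U"
      unfolding index_R1_eq using act Aff_closed[OF _ gh(1)] by auto
    ultimately have "bij_betw ?\<pi> (index_R1 U) (index_R1 U)"
      unfolding bij_betw_def using endo_inj_surj[of "index_R1 U" ?\<pi>] finite_Aff index_R1_eq by auto
    moreover have "\<forall>C\<in>index_R1 U. s (root_of C) = root_of (?\<pi> C)"
      unfolding index_R1_eq using abs_gal_root_of[OF s gh(2,1)] act by auto
    ultimately show ?thesis by (intro exI[of _ ?\<pi>] conjI)
  qed
qed (rule separable_roots)

text \<open>The value at a fixed coset is fixed by all automorphisms and lies in the field of the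
  roots, hence in the base field.\<close>

lemma fixed_coset_imp_linear_factor:
  assumes r: "map_poly to_ac r = resolvent \<iota> \<alpha> \<beta> \<Theta> (index_R1 U)" and x: "x \<in> Aff units5"
    and fixed: "\<And>g h. (g, h) \<in> carrier (perm_gal2 \<alpha> p \<beta> q) \<Longrightarrow> g \<circ> x \<circ> inv' h = x"
  shows "\<exists>l. Polynomial.degree l = 1 \<and> l dvd r"
proof -
  have xp: "x permutes {1..5}" using x aff_permutes by (auto simp: Aff_def simp del: insert_iff)
  have "root_of (coset x) \<in> base_field"
  proof (rule fixed_in_base[OF _ intermediate_base separable_roots])
    show "root_of (coset x) \<in> field_hull (base_field \<union> (\<alpha> ` {1..5} \<union> \<beta> ` {1..5}))"
      unfolding root_of_coset[OF x]
      using val_in_field_hull[of "(x, id)"] xp permutes_id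
        field_hull_mono[of "\<alpha> ` {1..5} \<union> \<beta> ` {1..5}" "base_field \<union> (\<alpha> ` {1..5} \<union> \<beta> ` {1..5})"] by auto
    fix s :: "'m alg_closure \<Rightarrow> 'm alg_closure" assume s: "s \<in> abs_gal"
    obtain g h where gh: "(g, h) \<in> carrier (perm_gal2 \<alpha> p \<beta> q)"
      "\<forall>i\<in>{1..5}. s (\<alpha> i) = \<alpha> (g i) \<and> s (\<beta> i) = \<beta> (h i)" using perm_pair_exists[OF s] by blast
    show "s (root_of (coset x)) = root_of (coset x)" using abs_gal_root_of[OF s gh(2,1) x] fixed[OF gh(1)] by simp
  qed simp
  then obtain k where k: "root_of (coset x) = to_ac k" by blast
  have "poly (map_poly to_ac r) (to_ac k) = 0"
    unfolding r resolvent_def root_of_def[symmetric] poly_prod index_R1_eq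
    using finite_Aff x k by (intro prod_zero) (auto intro!: bexI[of _ x])
  then have "to_ac (poly r k) = 0" by (simp add: poly_map_poly_to_ac)
  then have "[:- k, 1:] dvd r" by (simp add: poly_eq_0_iff_dvd)
  then show ?thesis by (intro exI[of _ "[:- k, 1:]"]) simp
qed

text \<open>A root in the base field is fixed by every automorphism, so the joint group permutes the
  cosets carrying this value; squarefreeness leaves only one such coset.\<close>

lemma linear_factor_imp_fixed_coset:
  assumes r: "map_poly to_ac r = resolvent \<iota> \<alpha> \<beta> \<Theta> (index_R1 U)" and sf: "squarefree r"
    and l: "Polynomial.degree l = 1" "l dvd r"
  obtains x where "x \<in> Aff units5" "\<And>g h. (g, h) \<in> carrier (perm_gal2 \<alpha> p \<beta> q) \<Longrightarrow> g \<circ> x \<circ> inv' h = x"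
proof -
  obtain k where k: "poly l k = 0"
  proof -
    let ?c = "Polynomial.coeff l 0" and ?e = "Polynomial.coeff l 1"
    have "l = [:?c, ?e:]"
      using l(1) by (intro poly_eqI) (auto simp: coeff_pCons coeff_eq_0 split: nat.split)
    moreover have "?e \<noteq> 0" using l(1) by (metis leading_coeff_0_iff degree_0 zero_neq_one)
    ultimately obtain c e where "l = [:c, e:]" "e \<noteq> 0" by blast
    then have "poly l (- c / e) = 0" by simp
    then show ?thesis using that by blast
  qed
  then have "poly r k = 0" using l(2) by auto
  then obtain t where t: "r = [:- k, 1:] * t" by (auto simp: poly_eq_0_iff_dvd dvd_def)
  have fin: "finite (index_R1 U)" unfolding index_R1_eq using finite_Aff by simp
  let ?f = "\<lambda>C. [:- root_of C, 1:]"
  have res: "map_poly to_ac r = (\<Prod>C\<in>index_R1 U. ?f C)"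
    unfolding r resolvent_def root_of_def[symmetric] ..
  have "poly (map_poly to_ac r) (to_ac k) = 0" using \<open>poly r k = 0\<close> by (simp add: poly_map_poly_to_ac)
  then obtain C where C: "C \<in> index_R1 U" "root_of C = to_ac k"
    unfolding res poly_prod using fin by (auto simp: prod_zero_iff)
  have unique: "C' = C" if C': "C' \<in> index_R1 U" "root_of C' = to_ac k" for C'
  \<comment> \<open>A second coset with the same value would make the linear factor a repeated one.
    The comparison over the closure is brought down to the base field by cancelling one factor and
    evaluating the cofactor.\<close>
  proof (rule ccontr)
    assume "C' \<noteq> C"
    then have "(\<Prod>D\<in>index_R1 U - {C}. ?f D) = ?f C' * (\<Prod>D\<in>index_R1 U - {C} - {C'}. ?f D)"
      using fin C'(1) by (intro prod.remove) auto
    then have 1: "map_poly to_ac r = ?f C * (?f C' * (\<Prod>D\<in>index_R1 U - {C} - {C'}. ?f D))"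
      unfolding res prod.remove[OF fin C(1)] by (simp only:)
    have 2: "map_poly to_ac r = ?f C * map_poly to_ac t"
      unfolding t C(2) map_poly_to_ac_mult by (simp add: map_poly_pCons)
    have nz: "?f C \<noteq> 0" by simp
    have "map_poly to_ac t = ?f C' * (\<Prod>D\<in>index_R1 U - {C} - {C'}. ?f D)"
      by (rule mult_left_cancel[OF nz, THEN iffD1, OF trans[OF 2[symmetric] 1]])
    then have "poly (map_poly to_ac t) (to_ac k) = 0" using C'(2) by simp
    then have "poly t k = 0" by (simp add: poly_map_poly_to_ac)
    then have "[:- k, 1:] dvd t" by (simp add: poly_eq_0_iff_dvd)
    then have "[:- k, 1:] ^ 2 dvd r" unfolding t power2_eq_square by (rule mult_dvd_mono[OF dvd_refl])
    then have "is_unit [:- k, 1:]" using sf unfolding squarefree_def by blast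
    then show False by (simp add: is_unit_iff_degree)
  qed
  obtain x where x: "x \<in> Aff units5" "C = coset x" using C(1) unfolding index_R1_eq by blast
  have "g \<circ> x \<circ> inv' h = x" if gh: "(g, h) \<in> carrier (perm_gal2 \<alpha> p \<beta> q)" for g h
  proof -
    obtain s where s: "s \<in> abs_gal" "\<forall>i\<in>{1..5}. s (\<alpha> i) = \<alpha> (g i) \<and> s (\<beta> i) = \<beta> (h i)"
      using gh unfolding perm_gal2_iff by blast
    have "root_of (coset (g \<circ> x \<circ> inv' h)) = to_ac k"
      using abs_gal_root_of[OF s gh x(1)] C(2) x(2) abs_gal_simps(3)[OF s(1)] by simp
    moreover have "coset (g \<circ> x \<circ> inv' h) \<in> index_R1 U" unfolding index_R1_eq using Aff_closed[OF x(1) gh] by blast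
    ultimately have "coset (g \<circ> x \<circ> inv' h) = coset x" using unique x(2) by simp
    then show ?thesis using injD[OF inj_coset] by blast
  qed
  with x(1) show ?thesis using that by blast
qed

end

end

section \<open>From the specialized quintics to affine groups, the table and the linear factor
  criterion\<close>

theorem theorem7p1:
  fixes \<iota> :: "'k::field \<Rightarrow> 'm::field"
    and H :: "(nat \<Rightarrow> nat) set"
    and f :: "'k poly poly fract poly"
    and a a' :: "'m \<times> 'm"
    and \<alpha> \<beta> :: "nat \<Rightarrow> 'm alg_closure"
    and U :: "((nat \<Rightarrow> nat) \<times> (nat \<Rightarrow> nat)) set"
    and \<Theta> :: "'k mpoly fract"
  defines "fa \<equiv> specialize \<iota> a f" and "fa' \<equiv> specialize \<iota> a' f"
  defines "Ga \<equiv> perm_gal \<alpha> fa" and "Ga' \<equiv> perm_gal \<beta> fa'"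
    and "Gaa' \<equiv> perm_gal2 \<alpha> fa \<beta> fa'"
  assumes embedding: "\<iota> \<in> ring_hom ring_of_type_algebra ring_of_type_algebra"
    and infinite_M: "infinite (UNIV :: 'm set)"
    and H: "subgroup H F20"
    and quintic: "Polynomial.degree f = 5"
    and generic: "generic_poly (F20\<lparr>carrier := H\<rparr>) f"
    and specializable: "specializable \<iota> a f" "specializable \<iota> a' f"
    and irred: "Factorial_Ring.irreducible fa" "Factorial_Ring.irreducible fa'"
    and roots: "enumerates_roots \<alpha> fa" "enumerates_roots \<beta> fa'"
    and ordering: "carrier Ga \<subseteq> carrier F20" "carrier Ga' \<subseteq> carrier F20"
    and Ga_ge: "carrier Ga' \<subseteq> carrier Ga"
    and stabilizer: "U = diagonal F20 \<or> U = diagonal S5"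
    and Theta: "primitive_invariant U \<Theta>"
  shows "(\<exists>!r. satisfies_row r Ga Ga' Gaa' (Spl fa) (Spl fa')
             (decomp_type Gaa' (index_R1 U)) (decomp_type Gaa' (index_R2 U))) \<and>
         (\<exists>R1 :: 'm poly. map_poly to_ac R1 = resolvent \<iota> \<alpha> \<beta> \<Theta> (index_R1 U) \<and>
            (squarefree R1 \<longrightarrow>
              (Spl fa = Spl fa' \<longleftrightarrow> (\<exists>l. Polynomial.degree l = 1 \<and> l dvd R1))))"
proof -
  have nz: "fa \<noteq> 0" "fa' \<noteq> 0" using irred by auto
  \<comment> \<open>Specialization cannot raise the degree, and the enumeration supplies five
    distinct roots, so the leading coefficient survives.\<close>
  have deg: "Polynomial.degree (specialize \<iota> c f) = 5"
    if "enumerates_roots \<gamma> (specialize \<iota> c f)" "specialize \<iota> c f \<noteq> 0" for c \<gamma>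
  proof -
    let ?Z = "{x. poly (map_poly to_ac (specialize \<iota> c f)) x = 0}"
    have "card ?Z = 5" using bij_betw_same_card[OF that(1)[unfolded enumerates_roots_def]] by simp
    moreover have "map_poly to_ac (specialize \<iota> c f) \<noteq> 0" using that(2) by (simp add: map_poly_eq_0_iff)
    then have "card ?Z \<le> Polynomial.degree (map_poly to_ac (specialize \<iota> c f))" by (rule card_poly_roots_bound)
    then have "card ?Z \<le> Polynomial.degree (specialize \<iota> c f)" by (simp add: degree_map_poly)
    moreover have "Polynomial.degree (specialize \<iota> c f) \<le> 5"
      unfolding specialize_def using quintic map_poly_degree_eq map_poly_degree_less
      by (metis less_imp_le_nat order_refl zero_neq_numeral)
    ultimately show ?thesis by simp
  qed
  interpret two_separable_quintics fa fa' \<alpha> \<beta>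
    using roots deg nz unfolding fa_def fa'_def
    by (intro two_separable_quintics.intro separable_quintic.intro) auto
  obtain V where V: "U = {(f, f) | f. f \<in> V}" "subgroup V S5" "Aff units5 \<subseteq> V"
    using diagonal_subgroup[OF stabilizer] .
  have UV: "diagonal_cosets U V" by (rule diagonal_cosets.intro) (rule V)+
  obtain N m n where N: "\<Theta> = Fract N (Delta_x ^ m * Delta_y ^ n)" "mvars N \<subseteq> {1..10}"
    using Theta unfolding primitive_invariant_def localized_ring_def by blast
  have \<iota>: "ring_map \<iota>"
  proof -
    have add: "\<iota> (x + y) = \<iota> x + \<iota> y" and mult: "\<iota> (x * y) = \<iota> x * \<iota> y" and one: "\<iota> 1 = 1" for x y
      using embedding by (auto simp: ring_hom_def)
    have "\<iota> 0 = 0" using add[of 0 0] by (metis add.right_neutral add_left_cancel)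
    then show ?thesis using add mult one by (simp add: ring_map_def)
  qed
  have "perm_act u \<Theta> = \<Theta>" if "u \<in> U" for u
    using Theta that unfolding primitive_invariant_def by blast
  then interpret evaluated_invariant fa fa' \<alpha> \<beta> \<iota> U V \<Theta> N m n
    by (intro evaluated_invariant.intro evaluated_invariant_axioms.intro two_separable_quintics_axioms \<iota> UV N)
  interpret diagonal_cosets U V by (rule UV)
  let ?G = "carrier Gaa'"
  have comp: "(g \<circ> g', h \<circ> h') \<in> ?G" if "(g, h) \<in> ?G" "(g', h') \<in> ?G" for g h g' h'
    using perm_gal2_comp that unfolding Gaa'_def .
  have inv: "(inv' g, inv' h) \<in> ?G" if "(g, h) \<in> ?G" for g h
    using perm_gal2_inv that unfolding Gaa'_def .
  have fstG: "fst ` ?G = carrier Ga" unfolding Gaa'_def Ga_def by (rule fst_perm_gal2)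
  have sndG: "snd ` ?G = carrier Ga'" unfolding Gaa'_def Ga'_def by (rule snd_perm_gal2)
  have sub: "carrier Ga \<subseteq> Aff units5" "carrier Ga' \<subseteq> Aff units5" using ordering by (simp_all add: F20_eq)
  have "\<exists>P. unit_subgroup P \<and> carrier Ga = Aff P"
  proof (rule transitive_affine_group[OF sub(1)])
    show "g \<circ> h \<in> carrier Ga" if "g \<in> carrier Ga" "h \<in> carrier Ga" for g h
      using that comp unfolding fstG[symmetric] by force
    show "inv' g \<in> carrier Ga" if "g \<in> carrier Ga" for g using that inv unfolding fstG[symmetric] by force
    show "\<exists>g\<in>carrier Ga. g i = j" if "i \<in> {1..5}" "j \<in> {1..5}" for i j
      unfolding Ga_def by (rule P.perm_gal_transitive[OF irred(1) that])
  qed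
  then obtain P where P: "unit_subgroup P" "carrier Ga = Aff P" by blast
  have "\<exists>R. unit_subgroup R \<and> carrier Ga' = Aff R"
  proof (rule transitive_affine_group[OF sub(2)])
    show "g \<circ> h \<in> carrier Ga'" if "g \<in> carrier Ga'" "h \<in> carrier Ga'" for g h
      using that comp unfolding sndG[symmetric] by force
    show "inv' g \<in> carrier Ga'" if "g \<in> carrier Ga'" for g using that inv unfolding sndG[symmetric] by force
    show "\<exists>g\<in>carrier Ga'. g i = j" if "i \<in> {1..5}" "j \<in> {1..5}" for i j
      unfolding Ga'_def by (rule Q.perm_gal_transitive[OF irred(2) that])
  qed
  then obtain R where R: "unit_subgroup R" "carrier Ga' = Aff R" by blast
  have "R \<subseteq> P"
  proof
    fix u assume u: "u \<in> R"
    have "aff u 0 \<in> Aff R" unfolding Aff_def using u by blast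
    then have "aff u 0 \<in> Aff P" using Ga_ge unfolding P(2) R(2) by (rule rev_subsetD)
    then show "u \<in> P"
      by (rule Aff_iff[OF unit_subgroupD(1)[OF P(1)] subsetD[OF unit_subgroupD(1)[OF R(1)] u], THEN iffD1])
  qed
  then have apg: "affine_pair_group ?G P R"
    using P(1) R(1) fstG[unfolded P(2)] sndG[unfolded R(2)] comp inv by (intro affine_pair_group.intro)
  have "?G \<subseteq> carrier Ga \<times> carrier Ga'" using subset_fst_snd[of ?G] unfolding fstG sndG .
  then have ord: "carrier (perm_gal2 \<alpha> fa \<beta> fa') \<subseteq> Aff units5 \<times> Aff units5"
    unfolding Gaa'_def[symmetric] by (rule order_trans[OF _ Sigma_mono[OF sub]])
  have Ga: "Ga = S5\<lparr>carrier := Aff P\<rparr>" using P(2) by (simp add: Ga_def perm_gal_def)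
  have Ga': "Ga' = S5\<lparr>carrier := Aff R\<rparr>" using R(2) by (simp add: Ga'_def perm_gal_def)
  have Gaa': "Gaa' = S5S5_on ?G" by (simp add: Gaa'_def perm_gal2_def)
  have grp: "group (S5S5_on ?G)"
  proof (rule subgroup.subgroup_is_group)
    interpret SS: group "S5 \<times>\<times> S5" by (rule DirProd_group[OF group_S5 group_S5])
    show "subgroup ?G (S5 \<times>\<times> S5)"
    proof (rule SS.subgroupI)
      show G: "?G \<subseteq> carrier (S5 \<times>\<times> S5)" unfolding Gaa'_def using perm_gal2_iff by auto
      have "aff 1 0 \<in> fst ` ?G" unfolding fstG P(2) Aff_def using unit_subgroupD(2)[OF P(1)] by blast
      then show "?G \<noteq> {}" by blast
      fix x y assume "x \<in> ?G" "y \<in> ?G"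
      then show "x \<otimes>\<^bsub>S5 \<times>\<times> S5\<^esub> y \<in> ?G" using comp by (cases x; cases y) simp
    next
      fix x assume x: "x \<in> ?G"
      obtain g h where gh: "x = (g, h)" by fastforce
      have per: "g permutes {1..5}" "h permutes {1..5}" using x gh perm_gal2_iff unfolding Gaa'_def by blast+
      then have "inv\<^bsub>S5 \<times>\<times> S5\<^esub> x = (inv' g, inv' h)"
        unfolding gh by (subst inv_DirProd[OF group_S5 group_S5]) (simp_all add: inv_S5)
      then show "inv\<^bsub>S5 \<times>\<times> S5\<^esub> x \<in> ?G" using inv x gh by simp
    qed
  qed (rule DirProd_group[OF group_S5 group_S5])
  have eq: "Spl fa = Spl fa' \<longleftrightarrow> (\<forall>g. (g, id) \<in> ?G \<longrightarrow> g = id) \<and> (\<forall>h. (id, h) \<in> ?G \<longrightarrow> h = id)"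
  proof -
    \<comment> \<open>Exchanging the two quintics turns the criterion for one inclusion into that
      for the other.\<close>
    interpret sw: two_separable_quintics fa' fa \<beta> \<alpha> by unfold_locales
    have "(id, h) \<in> ?G \<longleftrightarrow> (h, id) \<in> carrier (perm_gal2 \<beta> fa' \<alpha> fa)" for h
      unfolding Gaa'_def perm_gal2_iff sw.perm_gal2_iff by blast
    then show ?thesis
      using Spl_subset_iff sw.Spl_subset_iff unfolding Gaa'_def set_eq_subset by blast
  qed
  obtain k where k: "ext_degree (Spl fa \<inter> Spl fa') k" "k * card ?G = card (carrier Ga) * card (carrier Ga')"
    "k = 1 \<longrightarrow> Spl fa \<inter> Spl fa' = base_field"
    using degree_intersection[OF infinite_M] unfolding Gaa'_def Ga_def Ga'_def by blast
  have "\<exists>!r. satisfies_row r Ga Ga' Gaa' (Spl fa) (Spl fa')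
      (decomp_type Gaa' (index_R1 U)) (decomp_type Gaa' (index_R2 U))"
  proof (rule ex_ex1I)
    show "\<exists>r. satisfies_row r Ga Ga' Gaa' (Spl fa) (Spl fa')
        (decomp_type Gaa' (index_R1 U)) (decomp_type Gaa' (index_R2 U))"
      unfolding Ga Ga' using row_exists[OF apg UV grp k(1) k(2)[unfolded P(2) R(2)] k(3)[rule_format] eq]
      unfolding Gaa'[symmetric] .
  qed (rule satisfies_row_unique)
  moreover have "\<exists>R1 :: 'm poly. map_poly to_ac R1 = resolvent \<iota> \<alpha> \<beta> \<Theta> (index_R1 U) \<and>
      (squarefree R1 \<longrightarrow> (Spl fa = Spl fa' \<longleftrightarrow> (\<exists>l. Polynomial.degree l = 1 \<and> l dvd R1)))"
  proof -
    obtain R1 where R1: "map_poly to_ac R1 = resolvent \<iota> \<alpha> \<beta> \<Theta> (index_R1 U)"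
      using resolvent_R1_descends[OF ord] by blast
    have "\<exists>l. Polynomial.degree l = 1 \<and> l dvd R1" if "Spl fa = Spl fa'"
    proof -
      interpret G: affine_pair_group ?G P R by (rule apg)
      \<comment> \<open>Equal splitting fields make the projections injective, which excludes pairs
        (1, t) and puts the group into the graph case.\<close>
      have "d mod 5 = 0" if "G.T 1 0 1 d" for d
      proof -
        have "aff 1 d = id" using that eq \<open>Spl fa = Spl fa'\<close> unfolding G.T_def aff_id by blast
        then show ?thesis by (simp add: aff_eq_iff flip: aff_id)
      qed
      then obtain d e where d: "d \<in> units5" and tw: "?G = twisted_diag P d e" using G.diag_case by blast
      let ?k = "aff d e"
      have kA: "?k \<in> Aff units5" using d unfolding Aff_def by blast
      have idA: "id \<in> Aff units5" unfolding aff_id[symmetric] Aff_def by blast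
      have k: "id \<circ> inv' ?k \<in> Aff units5"
        using imageI[OF idA, of "\<lambda>x. x \<circ> inv' ?k"] unfolding Aff_shift(1)[OF kA] .
      \<comment> \<open>The coset of the identity, relabelled by the conjugating element, is fixed
        because the identity is central.\<close>
      have "g \<circ> (id \<circ> inv' ?k) \<circ> inv' h = id \<circ> inv' ?k" if gh: "(g, h) \<in> carrier (perm_gal2 \<alpha> fa \<beta> fa')" for g h
      proof -
        have "(g, h) \<in> twisted_diag P d e" using gh tw unfolding Gaa'_def by simp
        from twisted_diag_conj(2)[OF d unit_subgroupD(1)[OF P(1)] this, of id]
        have "g \<circ> (id \<circ> inv' ?k) \<circ> inv' h = (g \<circ> inv' g) \<circ> inv' ?k" by simp
        moreover have "g permutes {1..5}" using gh perm_gal2_iff by blast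
        ultimately show ?thesis using permutes_inv_o(1) by metis
      qed
      then show ?thesis by (rule fixed_coset_imp_linear_factor[OF ord R1 k])
    qed
    moreover have "Spl fa = Spl fa'" if linear: "squarefree R1" "Polynomial.degree l = 1" "l dvd R1" for l
    proof -
      obtain x where x: "x \<in> Aff units5" "\<And>g h. (g, h) \<in> carrier (perm_gal2 \<alpha> fa \<beta> fa') \<Longrightarrow> g \<circ> x \<circ> inv' h = x"
        by (rule linear_factor_imp_fixed_coset[OF ord R1 linear]) (rule that)
      have xp: "x permutes {1..5}" using x aff_permutes by (auto simp: Aff_def simp del: insert_iff)
      \<comment> \<open>A fixed coset exhibits the two components as conjugate through
        \<open>x\<close>, so either one is trivial as soon as the other is.\<close>
      have gx: "g \<circ> x = x \<circ> h" if gh: "(g, h) \<in> ?G" for g h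
      proof -
        have "h permutes {1..5}" using gh perm_gal2_iff unfolding Gaa'_def by blast
        then have "g \<circ> x \<circ> (inv' h \<circ> h) = g \<circ> x" using permutes_inv_o(2) by (metis comp_id)
        moreover have "g \<circ> x \<circ> inv' h = x" using x(2) gh unfolding Gaa'_def by blast
        ultimately show ?thesis by (metis comp_assoc)
      qed
      have xx: "x \<circ> inv' x = id" "inv' x \<circ> x = id" using permutes_inv_o[OF xp] by blast+
      have "g = id" if "(g, id) \<in> ?G" for g
      proof -
        have "g \<circ> x \<circ> inv' x = x \<circ> inv' x" using gx[OF that] by simp
        then show ?thesis using xx by (simp add: comp_assoc)
      qed
      moreover have "h = id" if "(id, h) \<in> ?G" for h
      proof -
        have "inv' x \<circ> (x \<circ> h) = inv' x \<circ> x" using gx[OF that] by simp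
        then show ?thesis using xx by (simp add: comp_assoc[symmetric])
      qed
      ultimately show ?thesis unfolding eq by (intro conjI allI impI)
    qed
    ultimately have "squarefree R1 \<longrightarrow> (Spl fa = Spl fa' \<longleftrightarrow> (\<exists>l. Polynomial.degree l = 1 \<and> l dvd R1))"
      by metis
    with R1 show ?thesis by (intro exI[of _ R1] conjI)
  qed
  ultimately show ?thesis by blast
qed

end
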